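(* Let $A\subset\mathbb{R}^n$ be finite, $\Omega=\operatorname{conv}(A)$ with at least two points and diameter $D$, and $f\in C^1(\Omega)$ with $L$-Lipschitz gradient on $\Omega$ ($L>0$). Let $\{x_k\}$ be an infinite sequence generated by the AFW, the PFW or the FDFW with stepsize $\alpha_k=\min(\bar\alpha_k,\alpha_k^{\max})$, $\bar\alpha_k=\frac{\langle-\nabla f(x_k),d_k\rangle}{L\|d_k\|^2}$, and let $f^*=\lim_k f(x_k)$. Let $\mu>0$ and assume that the KL condition with constant $\mu$ holds at every stationary point in the level set $\{x\in\Omega:f(x)=f^*\}$. Then there is $M>0$ such that for all $k$ $$f(x_k)-f^*\le M\,\bar q_{gs}^{\,\bar\gamma(k)},$$ where $\bar\gamma(k)$ is the number of good steps among the first $k$ steps and $$\bar q_{gs}=\max\left(1-\frac{\mu}{L}\left(\frac{\mathrm{PWidth}(A)}{2D}\right)^2,\ \left(1+\frac{\mu}{L}\right)^{-1}\right)\ \text{ for the AFW},$$ $$\bar q_{gs}=1-\frac{\mu}{L}\left(\frac{\mathrm{PWidth}(A)}{D}\right)^2\ \text{ for the PFW},$$ $$\bar q_{gs}=\max\left(1-\frac{\mu}{L}\left(\frac{\mathrm{PFWidth}(\Omega)}{2D}\right)^2,\ \left(1+\frac{\mu}{L}\right)^{-1}\right)\ \text{ for the FDFW}.$$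
   Context: $\|\cdot\|$ is the Euclidean norm. $f\in C^1(\Omega)$ means continuously differentiable on an open set containing $\Omega$; $\|\nabla f(x)-\nabla f(y)\|\le L\|x-y\|$ for $x,y\in\Omega$. $T_\Omega(x)=\mathrm{cl}\{w:\exists\lambda>0,\ x+\lambda w\in\Omega\}$, $\pi(C,\cdot)$ is the Euclidean projection on a closed convex set $C$, $\pi_x(g)=\|\pi(T_\Omega(x),g)\|$; $x$ is stationary if $\pi_x(-\nabla f(x))=0$. KL condition with constant $\mu$ at a stationary point $x^*$: there exist $\eta,\delta>0$ such that $\pi_x(-\nabla f(x))\ge\sqrt{2\mu}\,(f(x)-f(x^* ))^{1/2}$ for every $x\in\Omega$ with $\|x-x^*\|<\delta$ and $f(x^* )<f(x)<f(x^* )+\eta$. Methods. From $x_0\in\Omega$, at iteration $k$ stop if $x_k$ is stationary, otherwise set $x_{k+1}=x_k+\alpha_kd_k$ with $d_k$ chosen as follows, with $g=-\nabla f(x_k)$, $x=x_k$. AFW and PFW keep an active representation $x=\sum_{a\in S}\lambda_aa$, $S\subset A$, $\lambda_a>0$, $\sum_{a\in S}\lambda_a=1$. Let $s\in A$ maximize $\langle s,g\rangle$ over $\Omega$ and let $q\in\arg\min_{q\in S}\langle q,g\rangle$. PFW: $d_k=s-q$, $\alpha_k^{\max}=\lambda_q$; weight $\alpha_k$ is moved from $q$ to $s$. AFW: $d_k\in\arg\max\{\langle g,d\rangle:d\in\{s-x,\,x-q\}\}$; for $d_k=s-x$, $\alpha_k^{\max}=1$, all weights are multiplied by $1-\alpha_k$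 and $\alpha_k$ is added to the weight of $s$; for $d_k=x-q$, $\alpha_k^{\max}=\lambda_q/(1-\lambda_q)$, all weights are multiplied by $1+\alpha_k$ and $\alpha_k$ is subtracted from the weight of $q$. Atoms with zero weight are removed from $S$. FDFW: $d_k\in\arg\max\{\langle g,d\rangle:d\in\{s-x,\,x-x_F\}\}$ with $s\in\arg\max_{s\in\Omega}\langle s,g\rangle$, $x_F\in\arg\min\{\langle g,y\rangle:y\in\mathcal F(x)\}$, $\mathcal F(x)$ the minimal face of $\Omega$ containing $x$; $\alpha_k^{\max}=\max\{\alpha\ge0:x_k+\alpha d_k\in\Omega\}$. Step $k$ is good if $\alpha_k=\bar\alpha_k$ or if it is a full FW step, i.e. $x_{k+1}\in\arg\min_{x\in\Omega}\langle\nabla f(x_k),x\rangle$. With $\mathrm{pfaces}(\Omega)$ the set of nonempty proper faces of $\Omega$ and $\operatorname{dist}(C,E)=\inf\{\|y-z\|:y\in C,z\in E\}$: $\mathrm{PWidth}(A)=\min_{\mathcal F\in\mathrm{pfaces}(\Omega)}\operatorname{dist}(\mathcal F,\operatorname{conv}(A\setminus\mathcal F))$ and $\mathrm{PFWidth}(\Omega)=\min\{\operatorname{dist}(\mathcal F_1,\mathcal F_2):\mathcal F_1,\mathcal F_2\in\mathrm{pfaces}(\Omega),\ \mathcal F_1\cap\mathcal F_2=\emptyset\}$. *)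

theory Defs
  imports "HOL-Analysis.Analysis"
begin

definition tangent_cone :: "'a::euclidean_space set \<Rightarrow> 'a \<Rightarrow> 'a set" where
  "tangent_cone \<Omega> x = closure {w. \<exists>l>0. x + l *\<^sub>R w \<in> \<Omega>}"

definition proj_slope :: "'a::euclidean_space set \<Rightarrow> 'a \<Rightarrow> 'a \<Rightarrow> real" where
  "proj_slope \<Omega> x g = norm (closest_point (tangent_cone \<Omega> x) g)"

text \<open>Throughout, \<open>f'\<close> is the gradient map of the objective \<open>f\<close>.\<close>

definition stationary :: "'a::euclidean_space set \<Rightarrow> ('a \<Rightarrow> 'a) \<Rightarrow> 'a \<Rightarrow> bool" where
  "stationary \<Omega> f' x \<longleftrightarrow> proj_slope \<Omega> x (- f' x) = 0"

definition KL_at ::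
  "'a::euclidean_space set \<Rightarrow> ('a \<Rightarrow> real) \<Rightarrow> ('a \<Rightarrow> 'a) \<Rightarrow> real \<Rightarrow> 'a \<Rightarrow> bool" where
  "KL_at \<Omega> f f' \<mu> z \<longleftrightarrow>
    (\<exists>\<eta>>0. \<exists>\<delta>>0. \<forall>x\<in>\<Omega>. norm (x - z) < \<delta> \<and> f z < f x \<and> f x < f z + \<eta> \<longrightarrow>
       proj_slope \<Omega> x (- f' x) \<ge> sqrt (2 * \<mu>) * sqrt (f x - f z))"

definition pfaces :: "'a::euclidean_space set \<Rightarrow> 'a set set" where
  "pfaces \<Omega> = {F. F face_of \<Omega> \<and> F \<noteq> {} \<and> F \<noteq> \<Omega>}"

definition min_face :: "'a::euclidean_space set \<Rightarrow> 'a \<Rightarrow> 'a set" where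
  "min_face \<Omega> x = \<Inter>{F. F face_of \<Omega> \<and> x \<in> F}"

text \<open>For finite \<open>A\<close> whose hull has at least two points, both minima below range over finite
  nonempty sets, and \<^const>\<open>setdist\<close> is only applied to nonempty sets (a proper face of the hull
  does not contain \<open>A\<close>), where it is the infimum of the distances.\<close>

definition PWidth :: "'a::euclidean_space set \<Rightarrow> real" where
  "PWidth A = Min ((\<lambda>F. setdist F (convex hull (A - F))) ` pfaces (convex hull A))"

definition PFWidth :: "'a::euclidean_space set \<Rightarrow> real" where
  "PFWidth \<Omega> = Min {setdist F G | F G. F \<in> pfaces \<Omega> \<and> G \<in> pfaces \<Omega> \<and> F \<inter> G = {}}"

text \<open>The stepsize \<open>\<alpha>\<bar>\<close> for direction \<open>d\<close>, where \<open>g\<close> is the negative gradient.\<close>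

definition short_step :: "real \<Rightarrow> 'a::euclidean_space \<Rightarrow> 'a \<Rightarrow> real" where
  "short_step L g d = (g \<bullet> d) / (L * (norm d)\<^sup>2)"

text \<open>An active representation is encoded by a weight function \<open>w\<close> on \<open>A\<close>; the active set \<open>S\<close>
  is the set of atoms of positive weight, so atoms reaching weight zero leave it automatically.\<close>

definition active_set :: "'a::euclidean_space set \<Rightarrow> ('a \<Rightarrow> real) \<Rightarrow> 'a set" where
  "active_set A w = {a \<in> A. 0 < w a}"

definition active_rep :: "'a::euclidean_space set \<Rightarrow> ('a \<Rightarrow> real) \<Rightarrow> 'a \<Rightarrow> bool" where
  "active_rep A w x \<longleftrightarrow>
    (\<forall>a\<in>A. 0 \<le> w a) \<and> (\<Sum>a\<in>A. w a) = 1 \<and> x = (\<Sum>a\<in>A. w a *\<^sub>R a)"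

text \<open>One step of each method: at the point \<open>x\<close> with negative gradient \<open>g\<close> the method may choose
  direction \<open>d\<close> and stepsize \<open>\<alpha>\<close>, and (for AFW and PFW) replace the weights \<open>w\<close> by \<open>w'\<close>.
  Ties are broken arbitrarily.\<close>

definition afw_step :: "'a::euclidean_space set \<Rightarrow> real \<Rightarrow> 'a \<Rightarrow> 'a \<Rightarrow> ('a \<Rightarrow> real) \<Rightarrow>
    'a \<Rightarrow> real \<Rightarrow> ('a \<Rightarrow> real) \<Rightarrow> bool" where
  "afw_step A L g x w d \<alpha> w' \<longleftrightarrow>
    (\<exists>s q. s \<in> A \<and> is_arg_max (\<lambda>y. y \<bullet> g) (\<lambda>y. y \<in> convex hull A) s \<and>
       is_arg_min (\<lambda>y. y \<bullet> g) (\<lambda>y. y \<in> active_set A w) q \<and>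
       is_arg_max (\<lambda>v. g \<bullet> v) (\<lambda>v. v \<in> {s - x, x - q}) d \<and>
       (d = s - x \<and> \<alpha> = min (short_step L g d) 1 \<and>
          w' = (\<lambda>a. (1 - \<alpha>) * w a + (if a = s then \<alpha> else 0)) \<or>
        d = x - q \<and> \<alpha> = min (short_step L g d) (w q / (1 - w q)) \<and>
          w' = (\<lambda>a. (1 + \<alpha>) * w a - (if a = q then \<alpha> else 0))))"

definition pfw_step :: "'a::euclidean_space set \<Rightarrow> real \<Rightarrow> 'a \<Rightarrow> ('a \<Rightarrow> real) \<Rightarrow>
    'a \<Rightarrow> real \<Rightarrow> ('a \<Rightarrow> real) \<Rightarrow> bool" where
  "pfw_step A L g w d \<alpha> w' \<longleftrightarrow>
    (\<exists>s q. s \<in> A \<and> is_arg_max (\<lambda>y. y \<bullet> g) (\<lambda>y. y \<in> convex hull A) s \<and>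
       is_arg_min (\<lambda>y. y \<bullet> g) (\<lambda>y. y \<in> active_set A w) q \<and>
       d = s - q \<and> \<alpha> = min (short_step L g d) (w q) \<and>
       w' = (\<lambda>a. w a + (if a = s then \<alpha> else 0) - (if a = q then \<alpha> else 0)))"

definition fdfw_step :: "'a::euclidean_space set \<Rightarrow> real \<Rightarrow> 'a \<Rightarrow> 'a \<Rightarrow> 'a \<Rightarrow> real \<Rightarrow> bool" where
  "fdfw_step \<Omega> L g x d \<alpha> \<longleftrightarrow>
    (\<exists>s z. is_arg_max (\<lambda>y. y \<bullet> g) (\<lambda>y. y \<in> \<Omega>) s \<and>
       is_arg_min (\<lambda>y. g \<bullet> y) (\<lambda>y. y \<in> min_face \<Omega> x) z \<and>
       is_arg_max (\<lambda>v. g \<bullet> v) (\<lambda>v. v \<in> {s - x, x - z}) d \<and>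
       \<alpha> = min (short_step L g d) (GREATEST t. 0 \<le> t \<and> x + t *\<^sub>R d \<in> \<Omega>))"

datatype fw_variant = AFW | PFW | FDFW

text \<open>\<open>x\<close>, \<open>d\<close> and \<open>\<alpha>\<close> are the iterates, directions and stepsizes of an infinite run, i.e.\ one
  that never stops at a stationary point. For AFW and PFW it starts from an arbitrary active
  representation of the first iterate; the weight updates then keep it one of the current
  iterate.\<close>

fun variant_steps :: "fw_variant \<Rightarrow> 'a::euclidean_space set \<Rightarrow> ('a \<Rightarrow> 'a) \<Rightarrow> real \<Rightarrow>
    (nat \<Rightarrow> 'a) \<Rightarrow> (nat \<Rightarrow> 'a) \<Rightarrow> (nat \<Rightarrow> real) \<Rightarrow> bool" where
  "variant_steps AFW A f' L x d \<alpha> \<longleftrightarrow>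
    (\<exists>w. active_rep A (w 0) (x 0) \<and>
      (\<forall>k. afw_step A L (- f' (x k)) (x k) (w k) (d k) (\<alpha> k) (w (Suc k))))"
| "variant_steps PFW A f' L x d \<alpha> \<longleftrightarrow>
    (\<exists>w. active_rep A (w 0) (x 0) \<and>
      (\<forall>k. pfw_step A L (- f' (x k)) (w k) (d k) (\<alpha> k) (w (Suc k))))"
| "variant_steps FDFW A f' L x d \<alpha> \<longleftrightarrow>
    (\<forall>k. fdfw_step (convex hull A) L (- f' (x k)) (x k) (d k) (\<alpha> k))"

definition infinite_run :: "fw_variant \<Rightarrow> 'a::euclidean_space set \<Rightarrow> ('a \<Rightarrow> 'a) \<Rightarrow> real \<Rightarrow>
    (nat \<Rightarrow> 'a) \<Rightarrow> (nat \<Rightarrow> 'a) \<Rightarrow> (nat \<Rightarrow> real) \<Rightarrow> bool" where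
  "infinite_run m A f' L x d \<alpha> \<longleftrightarrow>
    x 0 \<in> convex hull A \<and>
    (\<forall>k. \<not> stationary (convex hull A) f' (x k)) \<and>
    (\<forall>k. x (Suc k) = x k + \<alpha> k *\<^sub>R d k) \<and>
    variant_steps m A f' L x d \<alpha>"

definition good_step :: "'a::euclidean_space set \<Rightarrow> ('a \<Rightarrow> 'a) \<Rightarrow> real \<Rightarrow>
    (nat \<Rightarrow> 'a) \<Rightarrow> (nat \<Rightarrow> 'a) \<Rightarrow> (nat \<Rightarrow> real) \<Rightarrow> nat \<Rightarrow> bool" where
  "good_step \<Omega> f' L x d \<alpha> k \<longleftrightarrow>
    \<alpha> k = short_step L (- f' (x k)) (d k) \<or>
    is_arg_min (\<lambda>y. f' (x k) \<bullet> y) (\<lambda>y. y \<in> \<Omega>) (x (Suc k))"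

definition good_steps :: "'a::euclidean_space set \<Rightarrow> ('a \<Rightarrow> 'a) \<Rightarrow> real \<Rightarrow>
    (nat \<Rightarrow> 'a) \<Rightarrow> (nat \<Rightarrow> 'a) \<Rightarrow> (nat \<Rightarrow> real) \<Rightarrow> nat \<Rightarrow> nat" where
  "good_steps \<Omega> f' L x d \<alpha> k = card {i. i < k \<and> good_step \<Omega> f' L x d \<alpha> i}"

fun q_gs :: "fw_variant \<Rightarrow> 'a::euclidean_space set \<Rightarrow> real \<Rightarrow> real \<Rightarrow> real" where
  "q_gs AFW A L \<mu> =
    max (1 - \<mu> / L * (PWidth A / (2 * diameter (convex hull A)))\<^sup>2) (inverse (1 + \<mu> / L))"
| "q_gs PFW A L \<mu> = 1 - \<mu> / L * (PWidth A / diameter (convex hull A))\<^sup>2"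
| "q_gs FDFW A L \<mu> =
    max (1 - \<mu> / L * (PFWidth (convex hull A) / (2 * diameter (convex hull A)))\<^sup>2)
        (inverse (1 + \<mu> / L))"

end

theory Submission
  imports Defs
begin

text \<open>
  Write \<open>r k\<close> for the gap \<open>f (x k) - fstar\<close>, \<open>h k\<close> for the
  slope \<open>- f' (x k) \<bullet> d k\<close> of the chosen direction, \<open>D\<close> for the
  diameter and \<open>W\<close> for the (facial) width. A short step, that is one with the
  unconstrained stepsize, lowers \<open>f\<close> by \<open>(h k)\<^sup>2 / (2 * L * (norm (d
  k))\<^sup>2)\<close>. If \<open>h k\<close> is at least \<open>W\<close> times the projected
  slope (an angle condition), then the KL inequality turns this into a contraction of
  \<open>r\<close> by \<open>1 - \<mu> / L * (W / D)\<^sup>2\<close>. A full Frank-Wolfe step ends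
  at a point where the old gradient is normal to the polytope, so the new projected slope is at
  most \<open>L\<close> times the length of the step, whereas \<open>f\<close> has dropped by
  \<open>L / 2\<close> times the squared length; this contracts \<open>r\<close> by \<open>inverse
  (1 + \<mu> / L)\<close> (\<open>full_rate\<close>). The KL inequality is available at all late
  good steps (for full ones at their end points), because there the Frank-Wolfe gap tends to zero
  and so all limit points are stationary (\<open>KL_eventually\<close>).

  The angle condition rests on a minimality argument: write a feasible direction \<open>y -
  x\<close> as \<open>M\<close> times a difference of a point \<open>P\<close> of the polytope and
  a point \<open>N\<close> of the hull of the active atoms (or of the minimal face), with
  \<open>M\<close> least. Then \<open>P\<close> and \<open>N\<close> share no mass, so their
  distance is at least the width (\<open>PWidth_slope\<close>, \<open>PFWidth_slope\<close>). The
  away-step and the in-face method choose a direction that is at least half as steep as the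
  pairwise one, which gives the factor \<open>2\<close> in their rates, and these rates are the
  worse of the two contractions. This settles both methods (\<open>afw_rate\<close>,
  \<open>fdfw_rate\<close>).

  The stated rate of the pairwise method is the contraction of the short steps alone, and a full
  step that is not short may fail to reach it. The main work is to show that such shortfalls are
  made up for nearby. Put \<open>P = (W / D)\<^sup>2\<close> and \<open>T = \<mu> / L * P\<close>,
  so that the rate is \<open>1 - T\<close>, and measure the gap by \<open>\<omega>\<close>, in the
  unit in which a short step moves weight at least \<open>\<omega>\<close>. A step that moves
  weight \<open>\<ge> \<omega>\<close> is always good enough, and after a full step that moves
  weight \<open>\<alpha>\<close> the gap satisfies \<open>\<omega>\<^sup>2 \<le> P *
  \<alpha>\<^sup>2\<close>. So nothing falls short if \<open>T + P \<le> 1\<close>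
  (\<open>rate_holds_small\<close>). If \<open>P \<le> 1 / 4\<close>, then otherwise \<open>T
  \<ge> 3 / 4\<close>: the gap decreases so fast that weights are eventually sorted into two
  classes, those above and those below a multiple of \<open>\<omega>\<close>, and a full step
  would have to promote a weight from the lower class (\<open>rate_holds_narrow\<close>).

  If \<open>P > 1 / 4\<close>, then the atoms are affinely independent
  (\<open>affine_dependent_PWidth\<close>), and every set of atoms spans a face. This geometry
  improves on the angle condition at points with an inactive atom that is not among the best ones
  (\<open>simplex_slope\<close>), and bounds the altitudes from below
  (\<open>simplex_altitude\<close>). For at most three atoms a full step is followed by a short
  step whose improvement pays for it (\<open>rate_holds_triangle\<close>). For at least four atoms
  \<open>P \<le> 1 / 2\<close>; if \<open>T \<le> 3 / 4\<close>, the altitudes prevent any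
  shortfall (\<open>rate_holds_altitude\<close>), and if \<open>T \<ge> 3 / 4\<close>, then all
  full steps between two short steps move the same weight, only the first of them can fall short,
  and either a further move of this weight or the improvement at the next short step pays for it
  (\<open>rate_holds_tokens\<close>).
\<close>

section \<open>Tangent cones\<close>

lemma tangent_cone_closed: "closed (tangent_cone \<Omega> x)"
  by (simp add: tangent_cone_def)

lemma tangent_cone_minus:
  assumes "y \<in> \<Omega>"
  shows "y - x \<in> tangent_cone \<Omega> x"
proof -
  have "y - x \<in> {w. \<exists>l>0. x + l *\<^sub>R w \<in> \<Omega>}"
    by (rule CollectI, rule exI[of _ "1::real"]) (use assms in simp)
  then show ?thesis unfolding tangent_cone_def by (rule subsetD[OF closure_subset])
qed

lemma tangent_cone_zero: "x \<in> \<Omega> \<Longrightarrow> 0 \<in> tangent_cone \<Omega> x"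
  using tangent_cone_minus[of x \<Omega> x] by simp

lemma convex_tangent_cone:
  assumes "convex \<Omega>" "x \<in> \<Omega>"
  shows "convex (tangent_cone \<Omega> x)"
proof -
  have "convex {w. \<exists>l>0. x + l *\<^sub>R w \<in> \<Omega>}"
  proof (rule convexI)
    fix v w :: 'a and a b :: real
    assume "v \<in> {w. \<exists>l>0. x + l *\<^sub>R w \<in> \<Omega>}" "w \<in> {w. \<exists>l>0. x + l *\<^sub>R w \<in> \<Omega>}"
      and ab: "0 \<le> a" "0 \<le> b" "a + b = 1"
    then obtain k l where kl: "k > 0" "x + k *\<^sub>R v \<in> \<Omega>" "l > 0" "x + l *\<^sub>R w \<in> \<Omega>" by auto
    define m where "m = k * l / (a * l + b * k)"
    have "0 < a \<or> 0 < b" using ab by linarith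
    then have pos: "a * l + b * k > 0"
      using ab kl by (auto intro: add_pos_nonneg add_nonneg_pos)
    have "(a * l / (a * l + b * k)) *\<^sub>R (x + k *\<^sub>R v) + (b * k / (a * l + b * k)) *\<^sub>R (x + l *\<^sub>R w) \<in> \<Omega>"
      using convexD[OF assms(1) kl(2,4), of "a * l / (a * l + b * k)" "b * k / (a * l + b * k)"] ab kl pos
      by (simp add: add_divide_distrib[symmetric])
    also have "(a * l / (a * l + b * k)) *\<^sub>R (x + k *\<^sub>R v) + (b * k / (a * l + b * k)) *\<^sub>R (x + l *\<^sub>R w)
        = (a * l / (a * l + b * k) + b * k / (a * l + b * k)) *\<^sub>R x + m *\<^sub>R (a *\<^sub>R v + b *\<^sub>R w)"
      by (simp add: m_def algebra_simps)
    also have "a * l / (a * l + b * k) + b * k / (a * l + b * k) = 1"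
      using pos by (simp add: add_divide_distrib[symmetric])
    finally show "a *\<^sub>R v + b *\<^sub>R w \<in> {w. \<exists>l>0. x + l *\<^sub>R w \<in> \<Omega>}"
      by (intro CollectI exI[of _ m]) (use pos kl in \<open>simp add: m_def\<close>)
  qed
  then show ?thesis unfolding tangent_cone_def by (rule convex_closure)
qed

lemma tangent_cone_scale:
  assumes "v \<in> tangent_cone \<Omega> x" "c > 0"
  shows "c *\<^sub>R v \<in> tangent_cone \<Omega> x"
proof -
  let ?C = "{w. \<exists>l>0. x + l *\<^sub>R w \<in> \<Omega>}"
  have "(*\<^sub>R) c ` ?C \<subseteq> ?C"
  proof clarify
    fix w l assume "l > 0" "x + l *\<^sub>R w \<in> \<Omega>"
    then show "\<exists>l>0. x + l *\<^sub>R c *\<^sub>R w \<in> \<Omega>"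
      using assms(2) by (intro exI[of _ "l / c"]) auto
  qed
  then have "closure ((*\<^sub>R) c ` ?C) \<subseteq> closure ?C" by (rule closure_mono)
  then show ?thesis
    using assms by (auto simp: tangent_cone_def closure_scaleR[symmetric])
qed

lemma tangent_cone_add:
  assumes "convex \<Omega>" "x \<in> \<Omega>" "v \<in> tangent_cone \<Omega> x" "w \<in> tangent_cone \<Omega> x"
  shows "v + w \<in> tangent_cone \<Omega> x"
proof -
  have "(1/2) *\<^sub>R v + (1/2) *\<^sub>R w \<in> tangent_cone \<Omega> x"
    using convexD[OF convex_tangent_cone[OF assms(1,2)] assms(3,4), of "1/2" "1/2"] by simp
  from tangent_cone_scale[OF this, of 2] show ?thesis by (simp add: scaleR_add_right)
qed

text \<open>A bound on feasible differences passes to the closure of the cone that they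
  generate.\<close>

lemma tangent_cone_inner_le:
  assumes "\<And>y. y \<in> \<Omega> \<Longrightarrow> c \<bullet> (y - x) \<le> K * norm (y - x)" "v \<in> tangent_cone \<Omega> x"
  shows "c \<bullet> v \<le> K * norm v"
proof -
  have "closed {v. c \<bullet> v \<le> K * norm v}"
    by (intro closed_Collect_le continuous_intros)
  moreover have "{w. \<exists>l>0. x + l *\<^sub>R w \<in> \<Omega>} \<subseteq> {v. c \<bullet> v \<le> K * norm v}"
  proof clarify
    fix w l assume l: "(l::real) > 0" "x + l *\<^sub>R w \<in> \<Omega>"
    have "l * (c \<bullet> w) \<le> l * (K * norm w)" using assms(1)[OF l(2)] l(1) by (simp add: algebra_simps)
    then show "c \<bullet> w \<le> K * norm w" using l(1) by simp
  qed
  ultimately have "tangent_cone \<Omega> x \<subseteq> {v. c \<bullet> v \<le> K * norm v}"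
    unfolding tangent_cone_def by (intro closure_minimal)
  then show ?thesis using assms(2) by auto
qed

text \<open>In a polytope the cone of feasible directions is closed already.\<close>

lemma tangent_cone_polytope:
  assumes "polytope \<Omega>" "x \<in> \<Omega>" "v \<in> tangent_cone \<Omega> x"
  obtains l where "l > 0" "x + l *\<^sub>R v \<in> \<Omega>"
proof -
  let ?C = "{w. \<exists>l>0. x + l *\<^sub>R w \<in> \<Omega>}" and ?S = "(+) (- x) ` \<Omega>"
  have "?C = conic hull ?S"
  proof
    show "?C \<subseteq> conic hull ?S"
    proof clarify
      fix w l assume l: "(l::real) > 0" "x + l *\<^sub>R w \<in> \<Omega>"
      then have "l *\<^sub>R w \<in> ?S" by (intro image_eqI[of _ _ "x + l *\<^sub>R w"]) auto
      moreover have "w = (1/l) *\<^sub>R (l *\<^sub>R w)" using l by simp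
      ultimately show "w \<in> conic hull ?S"
        unfolding conic_hull_explicit using l
        by (intro CollectI exI[of _ "1/l"] exI[of _ "l *\<^sub>R w"]) auto
    qed
    show "conic hull ?S \<subseteq> ?C"
    proof
      fix w assume "w \<in> conic hull ?S"
      then obtain c y where cy: "(0::real) \<le> c" "y \<in> \<Omega>" "w = c *\<^sub>R (y - x)"
        unfolding conic_hull_explicit by auto
      show "w \<in> ?C"
      proof (cases "c = 0")
        case True
        then show ?thesis using cy assms(2) by (intro CollectI exI[of _ "1::real"]) auto
      next
        case False
        then show ?thesis using cy by (intro CollectI exI[of _ "1/c"]) auto
      qed
    qed
  qed
  moreover have "closed (conic hull ?S)"
    using polytope_translation_eq[of "- x" \<Omega>] assms(1) closed_conic_hull_strong by blast
  ultimately have "v \<in> ?C" using assms(3) unfolding tangent_cone_def by simp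
  then show ?thesis using that by auto
qed

context
  fixes \<Omega> :: "'a::euclidean_space set" and x g u :: 'a
  assumes cvx: "convex \<Omega>" and x: "x \<in> \<Omega>"
  defines "u \<equiv> closest_point (tangent_cone \<Omega> x) g"
begin

lemma closest_tangent_in: "u \<in> tangent_cone \<Omega> x"
  unfolding u_def
  by (rule closest_point_in_set[OF tangent_cone_closed]) (use tangent_cone_zero[OF x] in auto)

lemma closest_tangent_polar:
  assumes "v \<in> tangent_cone \<Omega> x"
  shows "(g - u) \<bullet> v \<le> 0"
  using closest_point_dot[OF convex_tangent_cone[OF cvx x] tangent_cone_closed
    tangent_cone_add[OF cvx x closest_tangent_in assms], of g] by (simp add: u_def)

lemma closest_tangent_orth: "(g - u) \<bullet> u = 0"
proof -
  have "(g - u) \<bullet> (0 - u) \<le> 0"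
    unfolding u_def
    by (rule closest_point_dot[OF convex_tangent_cone[OF cvx x] tangent_cone_closed tangent_cone_zero[OF x]])
  moreover have "(g - u) \<bullet> u \<le> 0" by (rule closest_tangent_polar[OF closest_tangent_in])
  ultimately show ?thesis by simp
qed

lemma proj_slope_sq: "(proj_slope \<Omega> x g)\<^sup>2 = g \<bullet> u"
  using closest_tangent_orth
  by (simp add: proj_slope_def u_def power2_norm_eq_inner inner_diff_left)

text \<open>The projected slope is the value of the linear functional \<open>g\<close> at the unit
  vector along the projection, which is a limit of feasible directions.\<close>

lemma proj_slope_le:
  assumes "\<And>y. y \<in> \<Omega> \<Longrightarrow> g \<bullet> (y - x) \<le> K * norm (y - x)" "K \<ge> 0"
  shows "proj_slope \<Omega> x g \<le> K"
proof -
  have "(proj_slope \<Omega> x g)\<^sup>2 \<le> K * proj_slope \<Omega> x g"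
    using tangent_cone_inner_le[OF assms(1) closest_tangent_in]
    unfolding proj_slope_sq by (simp add: proj_slope_def u_def)
  then show ?thesis
    using assms(2) by (cases "proj_slope \<Omega> x g = 0")
      (auto simp: power2_eq_square proj_slope_def)
qed

end

lemma proj_slope_nonneg: "proj_slope \<Omega> x g \<ge> 0"
  by (simp add: proj_slope_def)

text \<open>At a minimizer of the linearisation taken at another point the slope only measures the
  change of the gradient.\<close>

lemma proj_slope_le_grad_diff:
  assumes "convex \<Omega>" "x \<in> \<Omega>" and "\<And>y. y \<in> \<Omega> \<Longrightarrow> g \<bullet> (y - x) \<le> 0"
  shows "proj_slope \<Omega> x g' \<le> norm (g' - g)"
proof (rule proj_slope_le[OF assms(1,2)])
  fix y assume "y \<in> \<Omega>"
  then have "g' \<bullet> (y - x) \<le> (g' - g) \<bullet> (y - x)" using assms(3) by (simp add: inner_diff_left)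
  also have "\<dots> \<le> norm (g' - g) * norm (y - x)" by (rule norm_cauchy_schwarz)
  finally show "g' \<bullet> (y - x) \<le> norm (g' - g) * norm (y - x)" .
qed simp

section \<open>Minimal faces and disjoint decompositions of feasible directions\<close>

lemma min_face_face_of:
  assumes "convex \<Omega>" "x \<in> \<Omega>"
  shows "min_face \<Omega> x face_of \<Omega>"
  unfolding min_face_def using assms by (intro face_of_Inter) (auto intro: face_of_refl)

lemma mem_min_face: "x \<in> min_face \<Omega> x"
  by (auto simp: min_face_def)

lemma min_face_least: "F face_of \<Omega> \<Longrightarrow> x \<in> F \<Longrightarrow> min_face \<Omega> x \<subseteq> F"
  by (auto simp: min_face_def)

text \<open>Otherwise a supporting hyperplane at \<open>x\<close> would cut out a smaller face that
  contains \<open>x\<close>.\<close>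

lemma mem_rel_interior_min_face:
  assumes "convex \<Omega>" "x \<in> \<Omega>"
  shows "x \<in> rel_interior (min_face \<Omega> x)"
proof (rule ccontr)
  let ?F = "min_face \<Omega> x"
  assume no: "x \<notin> rel_interior ?F"
  have F: "?F face_of \<Omega>" by (rule min_face_face_of[OF assms])
  have cF: "convex ?F" using F face_of_imp_convex by blast
  obtain a where a: "\<And>y. y \<in> ?F \<Longrightarrow> a \<bullet> x \<le> a \<bullet> y" "\<And>y. y \<in> rel_interior ?F \<Longrightarrow> a \<bullet> x < a \<bullet> y"
    using supporting_hyperplane_rel_boundary[OF cF mem_min_face no] by metis
  have "(?F \<inter> {y. a \<bullet> y = a \<bullet> x}) face_of ?F"
    by (rule face_of_Int_supporting_hyperplane_ge[OF cF]) (use a(1) in auto)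
  then have "(?F \<inter> {y. a \<bullet> y = a \<bullet> x}) face_of \<Omega>" using F face_of_trans by blast
  then have sub: "?F \<subseteq> ?F \<inter> {y. a \<bullet> y = a \<bullet> x}"
    by (rule min_face_least) (simp add: mem_min_face)
  have "rel_interior ?F \<noteq> {}" using cF mem_min_face[of x \<Omega>] by (auto simp: rel_interior_eq_empty)
  then obtain y where "y \<in> rel_interior ?F" by blast
  then show False using a(2) sub rel_interior_subset by fastforce
qed

text \<open>As \<open>x\<close> is a relative interior point of its minimal face, the segment from
  any point of the face to \<open>x\<close> extends a little beyond \<open>x\<close>.\<close>

lemma min_face_split:
  assumes "convex \<Omega>" "x \<in> \<Omega>" "a \<in> min_face \<Omega> x"
  obtains e y where "0 < e" "e < 1" "y \<in> min_face \<Omega> x" "x = e *\<^sub>R a + (1 - e) *\<^sub>R y"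
proof -
  let ?F = "min_face \<Omega> x"
  have cF: "convex ?F" using min_face_face_of[OF assms(1,2)] face_of_imp_convex by blast
  obtain e where e: "e > 1" "(1 - e) *\<^sub>R a + e *\<^sub>R x \<in> ?F"
    using mem_rel_interior_min_face[OF assms(1,2)] convex_rel_interior_iff[OF cF] assms(3) by blast
  let ?y = "(1 - e) *\<^sub>R a + e *\<^sub>R x"
  have "(1 - 1/e) *\<^sub>R a + (1/e) *\<^sub>R ?y = x"
    using e(1) by (simp add: algebra_simps field_simps) (simp add: scaleR_left_distrib[symmetric] diff_divide_distrib)
  then show ?thesis using that[of "1 - 1/e" ?y] e by auto
qed

text \<open>If a feasible direction is written as a multiple \<open>M\<close> of a difference of two points with \<open>M\<close>
  least possible, then the two points cannot share any mass, as common mass could be cancelled.\<close>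

lemma least_multiple_difference:
  fixes K C :: "'a::euclidean_space set"
  assumes K: "compact K" "convex K" and C: "compact C" "convex C"
    and "y \<in> K" "x \<in> C" "y \<noteq> x"
  obtains M P N where "0 < M" "P \<in> K" "N \<in> C" "y - x = M *\<^sub>R (P - N)"
    "\<And>a e e' P' N'. \<lbrakk>a \<in> K; a \<in> C; 0 < e; e \<le> 1; 0 < e'; e' \<le> 1; P' \<in> K; N' \<in> C;
       P = e *\<^sub>R a + (1 - e) *\<^sub>R P'; N = e' *\<^sub>R a + (1 - e') *\<^sub>R N'\<rbrakk> \<Longrightarrow> False"
proof -
  let ?Z = "({0..1::real} \<times> K \<times> C) \<inter> {z. fst z *\<^sub>R (fst (snd z) - snd (snd z)) = y - x}"
  have "closed {z. fst z *\<^sub>R (fst (snd z) - snd (snd z)) = y - x}"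
    by (intro closed_Collect_eq continuous_intros)
  then have "compact ?Z" using K C by (intro compact_Int_closed compact_Times) auto
  moreover have "(1, y, x) \<in> ?Z" using assms by auto
  ultimately have "\<exists>z\<in>?Z. \<forall>z'\<in>?Z. fst z \<le> fst z'"
    by (intro continuous_attains_inf continuous_on_fst continuous_on_id) blast+
  then obtain z where z: "z \<in> ?Z" and least: "\<And>z'. z' \<in> ?Z \<Longrightarrow> fst z \<le> fst z'"
    by blast
  obtain M P N where zMPN: "z = (M, P, N)" by (cases z) auto
  have MPN: "0 \<le> M" "M \<le> 1" "P \<in> K" "N \<in> C" "y - x = M *\<^sub>R (P - N)"
    using z zMPN by auto
  have M: "M > 0" using MPN \<open>y \<noteq> x\<close> by (cases "M = 0") auto
  show ?thesis
  proof (rule that[OF M MPN(3-5)])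
    fix a e e' P' N'
    assume a: "a \<in> K" "a \<in> C" and e: "0 < e" "e \<le> 1" and e': "0 < e'" "e' \<le> 1"
      and P': "P' \<in> K" and N': "N' \<in> C"
      and P: "P = e *\<^sub>R a + (1 - e) *\<^sub>R P'" and N: "N = e' *\<^sub>R a + (1 - e') *\<^sub>R N'"
    define t where "t = min e e'"
    have t: "0 < t" "t \<le> e" "t \<le> e'" using e e' by (auto simp: t_def)
    have "t \<noteq> 1"
    proof
      assume "t = 1"
      then have "e = 1" "e' = 1" using e e' t by auto
      then have "P = N" using P N by simp
      then show False using MPN(5) \<open>y \<noteq> x\<close> by simp
    qed
    then have t1: "1 - t > 0" using t e by simp
    define P2 where "P2 = ((e - t) / (1 - t)) *\<^sub>R a + ((1 - e) / (1 - t)) *\<^sub>R P'"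
    define N2 where "N2 = ((e' - t) / (1 - t)) *\<^sub>R a + ((1 - e') / (1 - t)) *\<^sub>R N'"
    have "P2 \<in> K" unfolding P2_def
      using convexD[OF K(2) a(1) P', of "(e - t) / (1 - t)" "(1 - e) / (1 - t)"] t t1 e
      by (simp add: add_divide_distrib[symmetric])
    moreover have "N2 \<in> C" unfolding N2_def
      using convexD[OF C(2) a(2) N', of "(e' - t) / (1 - t)" "(1 - e') / (1 - t)"] t t1 e'
      by (simp add: add_divide_distrib[symmetric])
    moreover
    have "(1 - t) *\<^sub>R P2 = (e - t) *\<^sub>R a + (1 - e) *\<^sub>R P'"
      "(1 - t) *\<^sub>R N2 = (e' - t) *\<^sub>R a + (1 - e') *\<^sub>R N'"
      using t1 unfolding P2_def N2_def scaleR_add_right scaleR_scaleR by simp_all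
    then have "(1 - t) *\<^sub>R P2 = P - t *\<^sub>R a" "(1 - t) *\<^sub>R N2 = N - t *\<^sub>R a"
      by (simp_all add: P N scaleR_diff_left)
    then have "(M * (1 - t)) *\<^sub>R (P2 - N2) = y - x"
      by (simp add: MPN(5) scaleR_diff_right flip: scaleR_scaleR)
    moreover have "0 \<le> M * (1 - t)" "M * (1 - t) \<le> 1"
      using M t1 t(1) MPN(2) by (auto intro!: mult_le_one)
    ultimately have "(M * (1 - t), P2, N2) \<in> ?Z" by simp
    from least[OF this] have "M \<le> M * (1 - t)" by (simp add: zMPN)
    then show False using M t by (simp add: mult_le_cancel_left1)
  qed
qed

text \<open>The atoms in \<open>B\<close> have weight zero in every representation, as a positive
  weight could be split off.\<close>

lemma convex_hull_remove_atoms: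
  fixes S :: "'a::real_vector set"
  assumes "finite S" "x \<in> convex hull S"
    and "\<And>a e y. \<lbrakk>a \<in> S; a \<in> B; 0 < e; e \<le> 1; y \<in> convex hull S; x = e *\<^sub>R a + (1 - e) *\<^sub>R y\<rbrakk> \<Longrightarrow> False"
  shows "x \<in> convex hull (S - B)"
proof -
  obtain w where w: "\<And>a. a \<in> S \<Longrightarrow> 0 \<le> w a" "sum w S = 1" "(\<Sum>a\<in>S. w a *\<^sub>R a) = x"
    using assms(2) unfolding convex_hull_finite[OF assms(1)] by auto
  have w0: "w a = 0" if a: "a \<in> S" "a \<in> B" for a
  proof (rule ccontr)
    assume "w a \<noteq> 0"
    then have wa: "0 < w a" using w(1)[OF a(1)] by simp
    have wa1: "w a \<le> 1" using w(2) member_le_sum[of a S w] a(1) w(1) assms(1) by auto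
    have x: "x = w a *\<^sub>R a + (\<Sum>b\<in>S - {a}. w b *\<^sub>R b)"
      using w(3) sum.remove[OF assms(1) a(1), of "\<lambda>b. w b *\<^sub>R b"] by simp
    have s: "sum w (S - {a}) = 1 - w a" using w(2) sum.remove[OF assms(1) a(1), of w] by simp
    show False
    proof (cases "w a = 1")
      case True
      then have "\<forall>b\<in>S - {a}. w b = 0"
        using s w(1) assms(1) sum_nonneg_eq_0_iff[of "S - {a}" w] by auto
      then have "x = a" using x True by simp
      then show ?thesis using assms(3)[OF a, of 1 a] a by (simp add: hull_inc)
    next
      case False
      then have p: "1 - w a > 0" using wa1 by simp
      define y where "y = (\<Sum>b\<in>S - {a}. (w b / (1 - w a)) *\<^sub>R b)"
      have "y \<in> convex hull S" unfolding y_def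
      proof (rule convex_sum[OF _ convex_convex_hull])
        show "(\<Sum>b\<in>S - {a}. w b / (1 - w a)) = 1"
          using s p by (simp add: sum_divide_distrib[symmetric])
      qed (use assms(1) w(1) p in \<open>auto intro: hull_inc\<close>)
      moreover have "x = w a *\<^sub>R a + (1 - w a) *\<^sub>R y"
        using p x by (simp add: y_def scaleR_sum_right)
      ultimately show ?thesis using assms(3)[OF a wa wa1] by blast
    qed
  qed
  have "sum w (S - B) = sum w S" "(\<Sum>a\<in>S - B. w a *\<^sub>R a) = (\<Sum>a\<in>S. w a *\<^sub>R a)"
    using w0 assms(1) by (auto intro!: sum.mono_neutral_left)
  then show ?thesis
    unfolding convex_hull_finite[OF finite_Diff[OF assms(1)]] using w by auto
qed

lemma pfaces_finite: "finite A \<Longrightarrow> finite (pfaces (convex hull A))"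
  using finite_polytope_faces[of "convex hull A"]
  by (auto simp: pfaces_def polytope_def intro: rev_finite_subset)

lemma PWidth_le:
  assumes "finite A" "F \<in> pfaces (convex hull A)" "y \<in> F" "z \<in> convex hull (A - F)"
  shows "PWidth A \<le> norm (y - z)"
proof -
  have "PWidth A \<le> setdist F (convex hull (A - F))"
    unfolding PWidth_def using assms by (intro Min_le) (auto intro: pfaces_finite)
  also have "\<dots> \<le> dist y z" using assms by (intro setdist_le_dist)
  finally show ?thesis by (simp add: dist_norm)
qed

lemma PFWidth_le:
  assumes "finite A" "F \<in> pfaces (convex hull A)" "G \<in> pfaces (convex hull A)" "F \<inter> G = {}"
    "y \<in> F" "z \<in> G"
  shows "PFWidth (convex hull A) \<le> norm (y - z)"
proof -
  let ?S = "{setdist F G | F G. F \<in> pfaces (convex hull A) \<and> G \<in> pfaces (convex hull A) \<and> F \<inter> G = {}}"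
  have "?S \<subseteq> (\<lambda>(F, G). setdist F G) ` (pfaces (convex hull A) \<times> pfaces (convex hull A))" by auto
  then have "finite ?S" by (rule finite_subset) (simp add: pfaces_finite assms(1))
  then have "PFWidth (convex hull A) \<le> setdist F G"
    unfolding PFWidth_def using assms by (intro Min_le) auto
  also have "\<dots> \<le> dist y z" using assms by (intro setdist_le_dist)
  finally show ?thesis by (simp add: dist_norm)
qed

text \<open>With the least multiple, an atom of \<open>S\<close> in the minimal face of
  \<open>P\<close> cannot occur in \<open>N\<close>, since \<open>P\<close> has some mass at it too.
  So the pyramidal width bounds the distance of \<open>P\<close> and \<open>N\<close> from
  below.\<close>

lemma direction_decomposition:
  fixes A S :: "'a::euclidean_space set"
  assumes "finite A" "S \<subseteq> A" "x \<in> convex hull S" "y \<in> convex hull A" "y \<noteq> x"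
  obtains M P N where "0 < M" "P \<in> convex hull A" "y - x = M *\<^sub>R (P - N)"
    "N \<in> convex hull (S - min_face (convex hull A) P)"
    "min_face (convex hull A) P \<in> pfaces (convex hull A)"
proof -
  let ?\<Omega> = "convex hull A"
  have fS: "finite S" using assms finite_subset by blast
  obtain M P N where M: "0 < M" and P: "P \<in> ?\<Omega>" and N: "N \<in> convex hull S"
    and eq: "y - x = M *\<^sub>R (P - N)"
    and nc: "\<And>a e e' P' N'. \<lbrakk>a \<in> ?\<Omega>; a \<in> convex hull S; 0 < e; e \<le> 1; 0 < e'; e' \<le> 1; P' \<in> ?\<Omega>;
       N' \<in> convex hull S; P = e *\<^sub>R a + (1 - e) *\<^sub>R P'; N = e' *\<^sub>R a + (1 - e') *\<^sub>R N'\<rbrakk> \<Longrightarrow> False"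
    using least_multiple_difference[of ?\<Omega> "convex hull S" y x] assms fS
    by (metis compact_convex_hull convex_convex_hull finite_imp_compact)
  let ?G = "min_face ?\<Omega> P"
  have G: "?G face_of ?\<Omega>" by (rule min_face_face_of[OF convex_convex_hull P])
  have N2: "N \<in> convex hull (S - ?G)"
  proof (rule convex_hull_remove_atoms[OF fS N])
    fix a e' N'
    assume a: "a \<in> S" "a \<in> ?G" and e': "0 < e'" "e' \<le> 1" and N': "N' \<in> convex hull S"
      and NN: "N = e' *\<^sub>R a + (1 - e') *\<^sub>R N'"
    obtain e P' where e: "0 < e" "e < 1" "P' \<in> ?G" "P = e *\<^sub>R a + (1 - e) *\<^sub>R P'"
      using min_face_split[OF convex_convex_hull P a(2)] by blast
    show False
      using nc[of a e e' P' N'] e e' N' NN a assms(2) face_of_imp_subset[OF G]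
      by (auto intro: hull_inc)
  qed
  have "?G \<noteq> ?\<Omega>"
  proof
    assume "?G = ?\<Omega>"
    then have e: "S - ?G = {}" using assms(2) hull_subset[of A convex] by auto
    show False using N2 unfolding e by simp
  qed
  then have "?G \<in> pfaces ?\<Omega>" using G mem_min_face by (auto simp: pfaces_def)
  then show ?thesis using that[OF M P eq N2] by blast
qed

text \<open>The angle condition: \<open>g \<bullet> (y - x) = M * (g \<bullet> (P - N)) \<le> M *
  h\<close>, and \<open>M\<close> is the length of \<open>y - x\<close> divided by the distance of
  \<open>P\<close> and \<open>N\<close>. The hypothesis on \<open>h\<close> is what the choice of
  the extremal atoms provides.\<close>

lemma PWidth_slope:
  fixes A S :: "'a::euclidean_space set"
  assumes "finite A" "S \<subseteq> A" "x \<in> convex hull S"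
    and h: "\<And>p n. p \<in> convex hull A \<Longrightarrow> n \<in> convex hull S \<Longrightarrow> g \<bullet> (p - n) \<le> h"
  shows "PWidth A * proj_slope (convex hull A) x g \<le> h"
proof -
  have S: "convex hull S \<subseteq> convex hull A" using assms(2) by (rule hull_mono)
  then have xA: "x \<in> convex hull A" using assms(3) by auto
  have h0: "h \<ge> 0" using h[of x x] xA assms(3) by simp
  show ?thesis
  proof (cases "PWidth A \<le> 0")
    case True
    then show ?thesis using h0 proj_slope_nonneg mult_nonpos_nonneg order_trans by blast
  next
    case False
    then have W: "PWidth A > 0" by simp
    have "proj_slope (convex hull A) x g \<le> h / PWidth A"
    proof (rule proj_slope_le[OF convex_convex_hull xA])
      fix y assume y: "y \<in> convex hull A"
      show "g \<bullet> (y - x) \<le> h / PWidth A * norm (y - x)"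
      proof (cases "y = x")
        case False
        obtain M P N where d: "0 < M" "P \<in> convex hull A" "y - x = M *\<^sub>R (P - N)"
          "N \<in> convex hull (S - min_face (convex hull A) P)"
          "min_face (convex hull A) P \<in> pfaces (convex hull A)"
          using direction_decomposition[OF assms(1-3) y False] by metis
        have N: "N \<in> convex hull S" using d(4) hull_mono[of "S - min_face (convex hull A) P" S convex] by auto
        have N': "N \<in> convex hull (A - min_face (convex hull A) P)"
          using d(4) assms(2) hull_mono[of "S - min_face (convex hull A) P" "A - min_face (convex hull A) P" convex]
          by auto
        have "PWidth A * (g \<bullet> (P - N)) \<le> PWidth A * h" using h[OF d(2) N] W by simp
        also have "\<dots> \<le> norm (P - N) * h"
          using PWidth_le[OF assms(1) d(5) mem_min_face N'] h0 by (intro mult_right_mono) auto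
        finally have "g \<bullet> (P - N) \<le> h / PWidth A * norm (P - N)" using W by (simp add: field_simps)
        from mult_left_mono[OF this, of M]
        have "M * (g \<bullet> (P - N)) \<le> M * (h / PWidth A * norm (P - N))" using d(1) by linarith
        then show ?thesis using d(1) unfolding d(3) by (simp add: ac_simps)
      qed simp
    qed (use h0 W in auto)
    then show ?thesis using W by (simp add: field_simps)
  qed
qed

text \<open>The same for the facial distance: with the least multiple the minimal faces of
  \<open>P\<close> and \<open>N\<close> are disjoint.\<close>

lemma PFWidth_slope:
  fixes A :: "'a::euclidean_space set"
  assumes "finite A" "x \<in> convex hull A"
    and h: "\<And>p n. p \<in> convex hull A \<Longrightarrow> n \<in> min_face (convex hull A) x \<Longrightarrow> g \<bullet> (p - n) \<le> h"
  shows "PFWidth (convex hull A) * proj_slope (convex hull A) x g \<le> h"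
proof -
  let ?\<Omega> = "convex hull A" and ?F = "min_face (convex hull A) x"
  let ?W = "PFWidth (convex hull A)"
  have F: "?F face_of ?\<Omega>" by (rule min_face_face_of[OF convex_convex_hull assms(2)])
  have comp: "compact ?\<Omega>" using assms(1) by (simp add: compact_convex_hull finite_imp_compact)
  have cF: "compact ?F" "convex ?F" "?F \<subseteq> ?\<Omega>"
    using F comp face_of_imp_compact face_of_imp_convex face_of_imp_subset convex_convex_hull by blast+
  have h0: "h \<ge> 0" using h[of x x] assms(2) mem_min_face[of x ?\<Omega>] by simp
  show ?thesis
  proof (cases "?W \<le> 0")
    case True
    then show ?thesis using h0 proj_slope_nonneg mult_nonpos_nonneg order_trans by blast
  next
    case False
    then have W: "?W > 0" by simp
    have "proj_slope ?\<Omega> x g \<le> h / ?W"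
    proof (rule proj_slope_le[OF convex_convex_hull assms(2)])
      fix y assume y: "y \<in> ?\<Omega>"
      show "g \<bullet> (y - x) \<le> h / ?W * norm (y - x)"
      proof (cases "y = x")
        case False
        obtain M P N where M: "0 < M" and P: "P \<in> ?\<Omega>" and N: "N \<in> ?F"
          and eq: "y - x = M *\<^sub>R (P - N)"
          and nc: "\<And>a e e' P' N'. \<lbrakk>a \<in> ?\<Omega>; a \<in> ?F; 0 < e; e \<le> 1; 0 < e'; e' \<le> 1; P' \<in> ?\<Omega>;
             N' \<in> ?F; P = e *\<^sub>R a + (1 - e) *\<^sub>R P'; N = e' *\<^sub>R a + (1 - e') *\<^sub>R N'\<rbrakk> \<Longrightarrow> False"
          using least_multiple_difference[OF comp convex_convex_hull cF(1,2) y mem_min_face False] by metis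
        have N\<Omega>: "N \<in> ?\<Omega>" using N cF(3) by auto
        let ?G1 = "min_face ?\<Omega> P" and ?G2 = "min_face ?\<Omega> N"
        have G: "?G1 face_of ?\<Omega>" "?G2 face_of ?\<Omega>" "?G2 \<subseteq> ?F"
          using min_face_face_of[OF convex_convex_hull] P N\<Omega> min_face_least[OF F N] by auto
        have disj: "?G1 \<inter> ?G2 = {}"
        proof (rule ccontr)
          assume "\<not> ?thesis"
          then obtain a where a: "a \<in> ?G1" "a \<in> ?G2" by auto
          obtain e P' where e: "0 < e" "e < 1" "P' \<in> ?G1" "P = e *\<^sub>R a + (1 - e) *\<^sub>R P'"
            using min_face_split[OF convex_convex_hull P a(1)] by blast
          obtain e' N' where e': "0 < e'" "e' < 1" "N' \<in> ?G2" "N = e' *\<^sub>R a + (1 - e') *\<^sub>R N'"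
            using min_face_split[OF convex_convex_hull N\<Omega> a(2)] by blast
          show False using nc[of a e e' P' N'] e e' a G face_of_imp_subset by (auto dest: subsetD)
        qed
        then have pf: "?G1 \<in> pfaces ?\<Omega>" "?G2 \<in> pfaces ?\<Omega>"
          using G mem_min_face[of P ?\<Omega>] mem_min_face[of N ?\<Omega>] P N\<Omega> by (auto simp: pfaces_def)
        have "?W * (g \<bullet> (P - N)) \<le> ?W * h" using h[OF P N] W by simp
        also have "\<dots> \<le> norm (P - N) * h"
          using PFWidth_le[OF assms(1) pf disj mem_min_face mem_min_face] h0 by (intro mult_right_mono) auto
        finally have "g \<bullet> (P - N) \<le> h / ?W * norm (P - N)" using W by (simp add: field_simps)
        from mult_left_mono[OF this, of M]
        have "M * (g \<bullet> (P - N)) \<le> M * (h / ?W * norm (P - N))" using M by linarith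
        then show ?thesis using M unfolding eq by (simp add: ac_simps)
      qed simp
    qed (use h0 W in auto)
    then show ?thesis using W by (simp add: field_simps)
  qed
qed

section \<open>Descent along a run\<close>

text \<open>Along the segment the difference of the two sides has a nonpositive derivative.\<close>

lemma descent_lemma:
  fixes f :: "'a::euclidean_space \<Rightarrow> real"
  assumes "convex \<Omega>" and grad: "\<And>y. y \<in> \<Omega> \<Longrightarrow> GDERIV f y :> f' y"
    and lip: "\<And>y z. y \<in> \<Omega> \<Longrightarrow> z \<in> \<Omega> \<Longrightarrow> norm (f' y - f' z) \<le> L * norm (y - z)"
    and xy: "x \<in> \<Omega>" "y \<in> \<Omega>"
  shows "f y \<le> f x + f' x \<bullet> (y - x) + L / 2 * (norm (y - x))\<^sup>2"
proof -
  define v where "v = y - x"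
  define \<phi> where "\<phi> t = f (x + t *\<^sub>R v) - t * (f' x \<bullet> v) - L / 2 * t\<^sup>2 * (norm v)\<^sup>2" for t
  have in\<Omega>: "x + t *\<^sub>R v \<in> \<Omega>" if "0 \<le> t" "t \<le> 1" for t
    using convexD_alt[OF \<open>convex \<Omega>\<close> xy that] by (simp add: v_def algebra_simps)
  have D: "(\<phi> has_real_derivative (f' (x + t *\<^sub>R v) \<bullet> v - f' x \<bullet> v - L * t * (norm v)\<^sup>2)) (at t)"
    if t: "0 \<le> t" "t \<le> 1" for t
  proof -
    have "((\<lambda>t. f (x + t *\<^sub>R v)) has_derivative (\<lambda>h. (h *\<^sub>R v) \<bullet> f' (x + t *\<^sub>R v))) (at t)"
      using grad[OF in\<Omega>[OF t]] unfolding gderiv_def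
      by (rule has_derivative_compose[rotated]) (auto intro!: derivative_eq_intros)
    then have "((\<lambda>t. f (x + t *\<^sub>R v)) has_real_derivative (f' (x + t *\<^sub>R v) \<bullet> v)) (at t)"
      unfolding has_field_derivative_def by (simp add: inner_commute mult_commute_abs)
    then show ?thesis unfolding \<phi>_def
      by (auto intro!: derivative_eq_intros simp: power2_eq_square)
  qed
  have "\<phi> 1 \<le> \<phi> 0"
  proof (rule DERIV_nonpos_imp_nonincreasing[of 0 1 \<phi>], simp)
    fix t :: real assume t: "0 \<le> t" "t \<le> 1"
    have "(f' (x + t *\<^sub>R v) - f' x) \<bullet> v \<le> norm (f' (x + t *\<^sub>R v) - f' x) * norm v"
      by (rule norm_cauchy_schwarz)
    also have "\<dots> \<le> (L * norm (t *\<^sub>R v)) * norm v"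
      using lip[OF in\<Omega>[OF t] xy(1)] by (intro mult_right_mono) auto
    also have "\<dots> = L * t * (norm v)\<^sup>2" using t by (simp add: power2_eq_square)
    finally show "\<exists>y. (\<phi> has_real_derivative y) (at t) \<and> y \<le> 0"
      using D[OF t] by (auto simp: inner_diff_left)
  qed
  then show ?thesis by (simp add: \<phi>_def v_def)
qed

locale smooth_on_polytope =
  fixes A :: "'a::euclidean_space set" and f :: "'a \<Rightarrow> real" and f' :: "'a \<Rightarrow> 'a" and L :: real
  assumes fin: "finite A" and nontriv: "\<exists>y\<in>convex hull A. \<exists>z\<in>convex hull A. y \<noteq> z"
    and grad: "\<And>y. y \<in> convex hull A \<Longrightarrow> GDERIV f y :> f' y" and L: "L > 0"
    and lip: "\<And>y z. y \<in> convex hull A \<Longrightarrow> z \<in> convex hull A \<Longrightarrow> norm (f' y - f' z) \<le> L * norm (y - z)"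
begin

abbreviation "\<Omega> \<equiv> convex hull A"
abbreviation "D \<equiv> diameter (convex hull A)"
abbreviation "slope y \<equiv> proj_slope \<Omega> y (- f' y)"

lemma compact_\<Omega>: "compact \<Omega>"
  by (simp add: fin compact_convex_hull finite_imp_compact)

lemma norm_le_D: "y \<in> \<Omega> \<Longrightarrow> z \<in> \<Omega> \<Longrightarrow> norm (y - z) \<le> D"
  using diameter_bounded_bound[OF compact_imp_bounded[OF compact_\<Omega>]] by (simp add: dist_norm)

lemma D_pos: "D > 0"
proof -
  obtain y z where "y \<in> \<Omega>" "z \<in> \<Omega>" "y \<noteq> z" using nontriv by blast
  then have "0 < norm (y - z)" "norm (y - z) \<le> D" using norm_le_D by auto
  then show ?thesis by linarith
qed

lemma descent: "y \<in> \<Omega> \<Longrightarrow> z \<in> \<Omega> \<Longrightarrow> f z \<le> f y + f' y \<bullet> (z - y) + L / 2 * (norm (z - y))\<^sup>2"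
  by (rule descent_lemma[OF convex_convex_hull grad lip])

lemma continuous_on_f: "continuous_on \<Omega> f"
  using grad unfolding gderiv_def
  by (meson continuous_at_imp_continuous_on has_derivative_continuous)

lemma continuous_on_f': "continuous_on \<Omega> f'"
proof (rule continuous_onI)
  fix y e assume y: "y \<in> \<Omega>" "(e::real) > 0"
  show "\<exists>d>0. \<forall>z\<in>\<Omega>. dist z y < d \<longrightarrow> dist (f' z) (f' y) \<le> e"
  proof (intro exI conjI ballI impI)
    fix z assume "z \<in> \<Omega>" "dist z y < e / L"
    then show "dist (f' z) (f' y) \<le> e"
      using lip[of z y] y L by (simp add: dist_norm field_simps)
  qed (use y L in simp)
qed

lemma nonstationary_direction:
  assumes "x \<in> \<Omega>" "\<not> stationary \<Omega> f' x"
  obtains y where "y \<in> \<Omega>" "- f' x \<bullet> (y - x) > 0"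
proof -
  have "\<exists>y\<in>\<Omega>. - f' x \<bullet> (y - x) > 0"
  proof (rule ccontr)
    assume "\<not> ?thesis"
    then have "- f' x \<bullet> (y - x) \<le> 0 * norm (y - x)" if "y \<in> \<Omega>" for y
      using that by (auto simp: not_less)
    then have "slope x \<le> 0" using proj_slope_le[OF convex_convex_hull assms(1), of "- f' x" 0] by auto
    then show False using assms(2) proj_slope_nonneg[of \<Omega> x "- f' x"] by (simp add: stationary_def)
  qed
  then show ?thesis using that by blast
qed

text \<open>The KL condition is only assumed near stationary points. It applies to all late members of a
  sequence in the polytope whose values tend to the level and whose Frank-Wolfe gap vanishes,
  because every limit point of such a sequence is stationary.\<close>

lemma KL_eventually:
  fixes y :: "nat \<Rightarrow> 'a"
  assumes KL: "\<And>z. z \<in> \<Omega> \<Longrightarrow> f z = c \<Longrightarrow> stationary \<Omega> f' z \<Longrightarrow> KL_at \<Omega> f f' \<mu> z"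
    and \<mu>: "\<mu> > 0" and y: "\<And>n. y n \<in> \<Omega>" and lim: "(\<lambda>n. f (y n)) \<longlonglongrightarrow> c" and ge: "\<And>n. f (y n) \<ge> c"
    and \<delta>: "\<delta> \<longlonglongrightarrow> 0"
    and gap: "\<And>n v. G n \<Longrightarrow> v \<in> \<Omega> \<Longrightarrow> - f' (y n) \<bullet> (v - y n) \<le> \<delta> n"
  shows "\<exists>K. \<forall>n\<ge>K. G n \<longrightarrow> 2 * \<mu> * (f (y n) - c) \<le> (slope (y n))\<^sup>2"
proof (rule ccontr)
  assume no: "\<not> ?thesis"
  define Bad where "Bad = {n. G n \<and> \<not> 2 * \<mu> * (f (y n) - c) \<le> (slope (y n))\<^sup>2}"
  have "infinite Bad"
    unfolding infinite_nat_iff_unbounded_le using no by (auto simp: Bad_def)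
  then have \<phi>: "strict_mono (enumerate Bad)" "\<And>n. enumerate Bad n \<in> Bad"
    by (auto simp: strict_mono_enumerate enumerate_in_set)
  define \<phi> where "\<phi> = enumerate Bad"
  obtain z \<psi> where z: "z \<in> \<Omega>" "strict_mono (\<psi> :: nat \<Rightarrow> nat)" "((\<lambda>n. y (\<phi> n)) \<circ> \<psi>) \<longlonglongrightarrow> z"
    using compact_\<Omega> y unfolding compact_def by (metis (no_types, lifting))
  define \<theta> where "\<theta> = \<phi> \<circ> \<psi>"
  have \<theta>: "strict_mono \<theta>" "\<And>n. \<theta> n \<in> Bad" "(\<lambda>n. y (\<theta> n)) \<longlonglongrightarrow> z"
    using \<phi> z(2,3) strict_mono_o[of \<phi> \<psi>] by (auto simp: \<theta>_def \<phi>_def o_def)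
  have fz: "(\<lambda>n. f (y (\<theta> n))) \<longlonglongrightarrow> f z"
    using continuous_on_tendsto_compose[OF continuous_on_f \<theta>(3) z(1)] y by simp
  have fc: "(\<lambda>n. f (y (\<theta> n))) \<longlonglongrightarrow> c"
    using LIMSEQ_subseq_LIMSEQ[OF lim \<theta>(1)] by (simp add: o_def)
  have "f z = c" using LIMSEQ_unique[OF fz fc] .
  have f'z: "(\<lambda>n. f' (y (\<theta> n))) \<longlonglongrightarrow> f' z"
    using continuous_on_tendsto_compose[OF continuous_on_f' \<theta>(3) z(1)] y by simp
  have "- f' z \<bullet> (v - z) \<le> 0 * norm (v - z)" if v: "v \<in> \<Omega>" for v
  proof -
    have "(\<lambda>n. - f' (y (\<theta> n)) \<bullet> (v - y (\<theta> n))) \<longlonglongrightarrow> - f' z \<bullet> (v - z)"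
      by (intro tendsto_intros f'z \<theta>(3))
    moreover have "(\<lambda>n. \<delta> (\<theta> n)) \<longlonglongrightarrow> 0" using LIMSEQ_subseq_LIMSEQ[OF \<delta> \<theta>(1)] by (simp add: o_def)
    moreover have "- f' (y (\<theta> n)) \<bullet> (v - y (\<theta> n)) \<le> \<delta> (\<theta> n)" for n
      using gap v \<theta>(2)[of n] by (auto simp: Bad_def)
    ultimately show ?thesis using LIMSEQ_le by (metis (no_types, lifting) mult_zero_left)
  qed
  then have "slope z \<le> 0" using proj_slope_le[OF convex_convex_hull z(1), of "- f' z" 0] by auto
  then have "stationary \<Omega> f' z"
    using proj_slope_nonneg[of \<Omega> z "- f' z"] by (simp add: stationary_def)
  from KL[OF z(1) \<open>f z = c\<close> this] obtain \<eta> \<delta>' where \<eta>: "\<eta> > 0" "\<delta>' > 0" and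
    K: "\<And>x. \<lbrakk>x \<in> \<Omega>; norm (x - z) < \<delta>'; f z < f x; f x < f z + \<eta>\<rbrakk> \<Longrightarrow> slope x \<ge> sqrt (2 * \<mu>) * sqrt (f x - f z)"
    unfolding KL_at_def by blast
  have "\<forall>\<^sub>F n in sequentially. norm (y (\<theta> n) - z) < \<delta>'"
    using \<theta>(3) \<eta>(2) unfolding tendsto_iff dist_norm by blast
  moreover have "\<forall>\<^sub>F n in sequentially. f (y (\<theta> n)) < f z + \<eta>"
    using order_tendstoD(2)[OF fz, of "f z + \<eta>"] \<eta>(1) by simp
  ultimately have "\<forall>\<^sub>F n in sequentially. norm (y (\<theta> n) - z) < \<delta>' \<and> f (y (\<theta> n)) < f z + \<eta>"
    by (rule eventually_conj)
  then obtain n where n: "norm (y (\<theta> n) - z) < \<delta>'" "f (y (\<theta> n)) < f z + \<eta>"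
    unfolding eventually_sequentially by blast
  have bad: "\<not> 2 * \<mu> * (f (y (\<theta> n)) - c) \<le> (slope (y (\<theta> n)))\<^sup>2" using \<theta>(2)[of n] by (simp add: Bad_def)
  show False
  proof (cases "f (y (\<theta> n)) = c")
    case True then show ?thesis using bad by simp
  next
    case False
    then have gt: "f (y (\<theta> n)) > c" using ge[of "\<theta> n"] by simp
    then have "sqrt (2 * \<mu>) * sqrt (f (y (\<theta> n)) - c) \<le> slope (y (\<theta> n))"
      using K[OF y n(1) _ n(2)] \<open>f z = c\<close> by simp
    then have "(sqrt (2 * \<mu>) * sqrt (f (y (\<theta> n)) - c))\<^sup>2 \<le> (slope (y (\<theta> n)))\<^sup>2"
      using \<mu> gt by (intro power_mono) auto
    then show ?thesis using bad \<mu> gt by (simp add: power_mult_distrib)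
  qed
qed

end

locale descent_run = smooth_on_polytope +
  fixes x d :: "nat \<Rightarrow> 'a" and \<alpha> :: "nat \<Rightarrow> real"
  assumes x_in: "\<And>k. x k \<in> \<Omega>" and x_Suc: "\<And>k. x (Suc k) = x k + \<alpha> k *\<^sub>R d k"
    and descent_dir: "\<And>k. - f' (x k) \<bullet> d k > 0" and \<alpha>_nonneg: "\<And>k. \<alpha> k \<ge> 0"
    and \<alpha>_le: "\<And>k. \<alpha> k \<le> short_step L (- f' (x k)) (d k)"
begin

abbreviation "h k \<equiv> - f' (x k) \<bullet> d k"
abbreviation "short k \<equiv> short_step L (- f' (x k)) (d k)"

lemma d_nonzero: "d k \<noteq> 0"
  using descent_dir[of k] by auto

lemma \<alpha>_mult_le: "\<alpha> k * (L * (norm (d k))\<^sup>2) \<le> h k"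
  using \<alpha>_le[of k] L d_nonzero[of k] by (simp add: short_step_def field_simps)

lemma decrease: "f (x (Suc k)) \<le> f (x k) - \<alpha> k * h k + L / 2 * (\<alpha> k)\<^sup>2 * (norm (d k))\<^sup>2"
  using descent[OF x_in[of k] x_in[of "Suc k"]] by (simp add: x_Suc power_mult_distrib algebra_simps)

lemma decrease_half: "f (x (Suc k)) \<le> f (x k) - \<alpha> k * h k / 2"
proof -
  have "\<alpha> k * (\<alpha> k * (L * (norm (d k))\<^sup>2)) \<le> \<alpha> k * h k"
    using \<alpha>_mult_le \<alpha>_nonneg by (intro mult_left_mono) auto
  then show ?thesis using decrease[of k] by (simp add: power2_eq_square algebra_simps)
qed

text \<open>The form of the decrease that depends on the length of the step only; it serves for full
  steps, and shows that the steps become short.\<close>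

lemma decrease_dist: "f (x (Suc k)) \<le> f (x k) - L / 2 * (norm (x (Suc k) - x k))\<^sup>2"
proof -
  have "\<alpha> k * (\<alpha> k * (L * (norm (d k))\<^sup>2)) \<le> \<alpha> k * h k"
    using \<alpha>_mult_le \<alpha>_nonneg by (intro mult_left_mono) auto
  then show ?thesis using decrease[of k] by (simp add: x_Suc power_mult_distrib power2_eq_square algebra_simps)
qed

lemma mono: "f (x (Suc k)) \<le> f (x k)"
  using decrease_dist[of k] L by (smt (verit) mult_nonneg_nonneg zero_le_power2 divide_nonneg_nonneg)

lemma decseq_f: "decseq (\<lambda>k. f (x k))"
  using mono by (simp add: decseq_Suc_iff)

lemma convergent_f: "convergent (\<lambda>k. f (x k))"
proof -
  have "bounded (f ` \<Omega>)"
    using compact_continuous_image[OF continuous_on_f compact_\<Omega>] compact_imp_bounded by blast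
  then obtain B where "\<And>y. y \<in> \<Omega> \<Longrightarrow> \<bar>f y\<bar> \<le> B" unfolding bounded_iff by auto
  then have "- B \<le> f (x k)" for k using x_in[of k] by (smt (verit))
  then obtain l where "(\<lambda>k. f (x k)) \<longlonglongrightarrow> l" using decseq_convergent[OF decseq_f] by metis
  then show ?thesis by (auto simp: convergent_def)
qed

definition "fstar = lim (\<lambda>k. f (x k))"
definition "r k = f (x k) - fstar"

lemma tendsto_fstar: "(\<lambda>k. f (x k)) \<longlonglongrightarrow> fstar"
  using convergent_f by (simp add: fstar_def convergent_LIMSEQ_iff)

lemma r_nonneg: "r k \<ge> 0"
  using decseq_ge[OF decseq_f tendsto_fstar, of k] by (simp add: r_def)

lemma r_Suc: "r (Suc k) \<le> r k"
  using mono by (simp add: r_def)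

lemma r_tendsto: "r \<longlonglongrightarrow> 0"
  using tendsto_diff[OF tendsto_fstar tendsto_const[of fstar]] by (simp add: r_def[abs_def])

lemma r_diff_tendsto: "(\<lambda>k. r k - r (Suc k)) \<longlonglongrightarrow> 0"
  using tendsto_diff[OF r_tendsto LIMSEQ_Suc[OF r_tendsto]] by simp

text \<open>The slope of the direction at short steps tends to zero, as the decrease that it causes
  is summable.\<close>

lemma short_step_gap_sq: "norm (d k) \<le> B \<Longrightarrow> \<alpha> k = short k \<Longrightarrow> (h k)\<^sup>2 \<le> 2 * L * B\<^sup>2 * (r k - r (Suc k))"
proof -
  assume B: "norm (d k) \<le> B" and \<alpha>: "\<alpha> k = short k"
  have n: "norm (d k) > 0" using d_nonzero by simp
  have "\<alpha> k * h k / 2 \<le> r k - r (Suc k)" using decrease_half[of k] by (simp add: r_def)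
  then have 1: "(h k)\<^sup>2 / (2 * L * (norm (d k))\<^sup>2) \<le> r k - r (Suc k)"
    unfolding \<alpha> short_step_def by (simp add: power2_eq_square mult_ac)
  have "(h k)\<^sup>2 \<le> 2 * L * (norm (d k))\<^sup>2 * (r k - r (Suc k))"
    using 1 L n by (simp add: divide_le_eq mult_ac)
  also have "\<dots> \<le> 2 * L * B\<^sup>2 * (r k - r (Suc k))"
    using B L r_Suc[of k] by (intro mult_right_mono mult_left_mono power_mono) auto
  finally show ?thesis .
qed

lemma dist_Suc_tendsto: "(\<lambda>k. norm (x (Suc k) - x k)) \<longlonglongrightarrow> 0"
proof -
  have "(\<lambda>k. sqrt (2 / L * (r k - r (Suc k)))) \<longlonglongrightarrow> sqrt (2 / L * 0)"
    by (intro tendsto_intros r_diff_tendsto)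
  then have lim: "(\<lambda>k. sqrt (2 / L * (r k - r (Suc k)))) \<longlonglongrightarrow> 0" by simp
  have "norm (x (Suc k) - x k) \<le> sqrt (2 / L * (r k - r (Suc k)))" for k
    using decrease_dist[of k] L by (intro real_le_rsqrt) (simp add: r_def field_simps)
  then show ?thesis
    by (intro real_tendsto_sandwich[OF _ _ tendsto_const lim]) simp_all
qed

text \<open>As the iterates are in the polytope, this is the second alternative in
  \<open>good_step\<close>.\<close>

definition "full k \<longleftrightarrow> (\<forall>y\<in>\<Omega>. f' (x k) \<bullet> x (Suc k) \<le> f' (x k) \<bullet> y)"

text \<open>The old gradient admits no ascent at the new point, so only the change of the gradient
  counts.\<close>

lemma full_gap:
  assumes "full k" "v \<in> \<Omega>"
  shows "- f' (x (Suc k)) \<bullet> (v - x (Suc k)) \<le> L * norm (x (Suc k) - x k) * D"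
proof -
  have "- f' (x (Suc k)) \<bullet> (v - x (Suc k)) \<le> (f' (x k) - f' (x (Suc k))) \<bullet> (v - x (Suc k))"
    using assms by (auto simp: full_def inner_diff_left inner_diff_right)
  also have "\<dots> \<le> norm (f' (x k) - f' (x (Suc k))) * norm (v - x (Suc k))" by (rule norm_cauchy_schwarz)
  also have "\<dots> \<le> (L * norm (x (Suc k) - x k)) * D"
    using lip[OF x_in[of k] x_in[of "Suc k"]] norm_le_D[OF assms(2) x_in[of "Suc k"]] L
    by (intro mult_mono) (auto simp: norm_minus_commute)
  finally show ?thesis .
qed

lemma full_slope: "full k \<Longrightarrow> slope (x (Suc k)) \<le> L * norm (x (Suc k) - x k)"
proof -
  assume "full k"
  then have "slope (x (Suc k)) \<le> norm (- f' (x (Suc k)) - (- f' (x k)))"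
    by (intro proj_slope_le_grad_diff[OF convex_convex_hull x_in]) (auto simp: full_def inner_diff_right)
  then show ?thesis using lip[OF x_in[of k] x_in[of "Suc k"]] by (simp add: norm_minus_commute)
qed

text \<open>The slope at the new point is at most \<open>L\<close> times the length of the step,
  whereas the decrease is at least \<open>L / 2\<close> times its square.\<close>

lemma full_rate:
  assumes "full k" "2 * \<mu> * r (Suc k) \<le> (slope (x (Suc k)))\<^sup>2" "\<mu> > 0"
  shows "(1 + \<mu> / L) * r (Suc k) \<le> r k"
proof -
  have "2 * \<mu> * r (Suc k) \<le> (L * norm (x (Suc k) - x k))\<^sup>2"
    using assms(2) power_mono[OF full_slope[OF assms(1)] proj_slope_nonneg, of 2] by linarith
  also have "\<dots> = 2 * L * (L / 2 * (norm (x (Suc k) - x k))\<^sup>2)" by (simp add: power_mult_distrib power2_eq_square)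
  also have "\<dots> \<le> 2 * L * (r k - r (Suc k))"
    using decrease_dist[of k] L by (intro mult_left_mono) (auto simp: r_def)
  finally have "\<mu> / L * r (Suc k) \<le> r k - r (Suc k)" using L by (simp add: field_simps)
  then show ?thesis by (simp add: algebra_simps)
qed

lemma KL_full:
  assumes KL: "\<And>z. z \<in> \<Omega> \<Longrightarrow> f z = fstar \<Longrightarrow> stationary \<Omega> f' z \<Longrightarrow> KL_at \<Omega> f f' \<mu> z" and "\<mu> > 0"
  shows "\<exists>K. \<forall>k\<ge>K. full k \<longrightarrow> 2 * \<mu> * r (Suc k) \<le> (slope (x (Suc k)))\<^sup>2"
  unfolding r_def
proof (rule KL_eventually[OF KL \<open>\<mu> > 0\<close>, of fstar "\<lambda>k. x (Suc k)" "\<lambda>k. L * norm (x (Suc k) - x k) * D"])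
  show "(\<lambda>n. f (x (Suc n))) \<longlonglongrightarrow> fstar" by (rule LIMSEQ_Suc[OF tendsto_fstar])
  show "(\<lambda>k. L * norm (x (Suc k) - x k) * D) \<longlonglongrightarrow> 0"
    using tendsto_mult[OF tendsto_mult[OF tendsto_const dist_Suc_tendsto] tendsto_const] by fastforce
qed (use x_in r_nonneg full_gap in \<open>auto simp: r_def\<close>)

text \<open>Directions at least as steep as the Frank-Wolfe direction make the Frank-Wolfe gap
  vanish along the short steps, so that the KL inequality holds there; the multiple of the slope
  turns it into a contraction.\<close>

lemma good_step_rate:
  assumes KL: "\<And>z. z \<in> \<Omega> \<Longrightarrow> f z = fstar \<Longrightarrow> stationary \<Omega> f' z \<Longrightarrow> KL_at \<Omega> f f' \<mu> z" and \<mu>: "\<mu> > 0"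
    and fw: "\<And>k y. y \<in> \<Omega> \<Longrightarrow> - f' (x k) \<bullet> (y - x k) \<le> h k"
    and angle: "\<And>k. c * slope (x k) \<le> h k" and c: "c \<ge> 0" and dD: "\<And>k. norm (d k) \<le> D"
  shows "\<exists>K. \<forall>k\<ge>K. (\<alpha> k = short k \<longrightarrow> r (Suc k) \<le> (1 - \<mu> / L * (c / D)\<^sup>2) * r k) \<and>
                   (full k \<longrightarrow> r (Suc k) \<le> inverse (1 + \<mu> / L) * r k)"
proof -
  obtain K1 where K1: "\<And>k. k \<ge> K1 \<Longrightarrow> full k \<Longrightarrow> 2 * \<mu> * r (Suc k) \<le> (slope (x (Suc k)))\<^sup>2"
    using KL_full[OF KL \<mu>] by blast
  have "\<exists>K. \<forall>k\<ge>K. \<alpha> k = short k \<longrightarrow> 2 * \<mu> * (f (x k) - fstar) \<le> (slope (x k))\<^sup>2"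
  proof (rule KL_eventually[OF KL \<mu>, of fstar x "\<lambda>k. sqrt (2 * L * D\<^sup>2 * (r k - r (Suc k)))"])
    have "(\<lambda>k. sqrt (2 * L * D\<^sup>2 * (r k - r (Suc k)))) \<longlonglongrightarrow> sqrt (2 * L * D\<^sup>2 * 0)"
      by (intro tendsto_intros r_diff_tendsto)
    then show "(\<lambda>k. sqrt (2 * L * D\<^sup>2 * (r k - r (Suc k)))) \<longlonglongrightarrow> 0" by simp
    fix k v assume "\<alpha> k = short k" "v \<in> \<Omega>"
    then have "(h k)\<^sup>2 \<le> 2 * L * D\<^sup>2 * (r k - r (Suc k))" by (intro short_step_gap_sq dD)
    then have "h k \<le> sqrt (2 * L * D\<^sup>2 * (r k - r (Suc k)))" by (rule real_le_rsqrt)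
    then show "- f' (x k) \<bullet> (v - x k) \<le> sqrt (2 * L * D\<^sup>2 * (r k - r (Suc k)))"
      using fw[OF \<open>v \<in> \<Omega>\<close>, of k] by linarith
  qed (use x_in r_nonneg tendsto_fstar in \<open>auto simp: r_def\<close>)
  then obtain K2 where K2: "\<And>k. k \<ge> K2 \<Longrightarrow> \<alpha> k = short k \<Longrightarrow> 2 * \<mu> * r k \<le> (slope (x k))\<^sup>2"
    unfolding r_def by blast
  show ?thesis
  proof (intro exI[of _ "max K1 K2"] allI impI conjI)
    fix k assume k: "k \<ge> max K1 K2"
    { assume \<alpha>: "\<alpha> k = short k"
      have "c\<^sup>2 * (2 * \<mu> * r k) \<le> c\<^sup>2 * (slope (x k))\<^sup>2"
        using K2[OF _ \<alpha>] k by (intro mult_left_mono) auto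
      also have "\<dots> \<le> (h k)\<^sup>2"
        using power_mono[OF angle, of k 2] c proj_slope_nonneg[of \<Omega> "x k"] by (simp add: power_mult_distrib)
      also have "\<dots> \<le> 2 * L * D\<^sup>2 * (r k - r (Suc k))" by (rule short_step_gap_sq[OF dD \<alpha>])
      finally have "\<mu> / L * (c / D)\<^sup>2 * r k \<le> r k - r (Suc k)"
        using L D_pos by (simp add: power_divide field_simps)
      then show "r (Suc k) \<le> (1 - \<mu> / L * (c / D)\<^sup>2) * r k" by (simp add: algebra_simps) }
    { assume "full k"
      then have "(1 + \<mu> / L) * r (Suc k) \<le> r k" using full_rate K1 k \<mu> by auto
      moreover have "1 + \<mu> / L > 0" using \<mu> L by (simp add: add_pos_pos)
      ultimately show "r (Suc k) \<le> inverse (1 + \<mu> / L) * r k"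
        by (simp add: field_simps) }
  qed
qed

end

section \<open>Counting good steps\<close>

definition count_before :: "(nat \<Rightarrow> bool) \<Rightarrow> nat \<Rightarrow> nat" where
  "count_before G k = card {i. i < k \<and> G i}"

lemma count_before_0 [simp]: "count_before G 0 = 0"
  by (simp add: count_before_def)

lemma count_before_Suc: "count_before G (Suc k) = count_before G k + (if G k then 1 else 0)"
proof -
  have "{i. i < Suc k \<and> G i} = (if G k then insert k {i. i < k \<and> G i} else {i. i < k \<and> G i})"
    by (auto simp: less_Suc_eq)
  then show ?thesis by (simp add: count_before_def)
qed

lemma count_before_mono: "j \<le> k \<Longrightarrow> count_before G j \<le> count_before G k"
  unfolding count_before_def by (intro card_mono) auto

lemma count_before_le: "count_before G k \<le> k"
  using card_mono[of "{..<k}" "{i. i < k \<and> G i}"] by (auto simp: count_before_def)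

text \<open>The constant absorbs the finitely many steps before \<open>K\<close>: they decrease the
  gap, and count at most \<open>K\<close> good steps.\<close>

lemma rate_from_late_rate:
  fixes r :: "nat \<Rightarrow> real"
  assumes r: "\<And>k. 0 \<le> r k" "\<And>k. r (Suc k) \<le> r k" and q: "0 < q" "q \<le> 1"
    and late: "C > 0" "\<And>k. k \<ge> K \<Longrightarrow> r k \<le> C * q ^ (count_before G k - count_before G K)"
  shows "\<exists>M>0. \<forall>k. r k \<le> M * q ^ count_before G k"
proof (intro exI[of _ "(r 0 + C) / q ^ K"] conjI allI)
  show "(r 0 + C) / q ^ K > 0" using r(1)[of 0] late(1) q by (simp add: add_nonneg_pos)
  fix k
  let ?c = "count_before G"
  have r0: "r k \<le> r 0" by (rule lift_Suc_antimono_le[of r]) (use r in auto)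
  show "r k \<le> (r 0 + C) / q ^ K * q ^ ?c k"
  proof (cases "k \<ge> K")
    case True
    have "q ^ K * q ^ (?c k - ?c K) \<le> q ^ ?c K * q ^ (?c k - ?c K)"
      using q count_before_le[of G K] by (intro mult_right_mono power_decreasing) auto
    also have "\<dots> = q ^ ?c k" using count_before_mono[OF True, of G] by (simp flip: power_add)
    finally have le: "q ^ (?c k - ?c K) \<le> q ^ ?c k / q ^ K" using q by (simp add: field_simps)
    have "r k \<le> C * q ^ (?c k - ?c K)" by (rule late(2)[OF True])
    also have "\<dots> \<le> (r 0 + C) * (q ^ ?c k / q ^ K)"
      using le r(1)[of 0] late(1) q by (intro mult_mono) auto
    finally show ?thesis by simp
  next
    case False
    have "q ^ K \<le> q ^ ?c k" using False q count_before_le[of G k] by (intro power_decreasing) auto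
    then have "1 \<le> q ^ ?c k / q ^ K" using q by simp
    then have "r 0 * 1 \<le> (r 0 + C) * (q ^ ?c k / q ^ K)" using r(1)[of 0] late(1) by (intro mult_mono) auto
    then show ?thesis using r0 by simp
  qed
qed

lemma rate_from_late_steps:
  fixes r :: "nat \<Rightarrow> real"
  assumes r: "\<And>k. 0 \<le> r k" "\<And>k. r (Suc k) \<le> r k" and q: "0 < q" "q \<le> 1"
    and step: "\<And>k. k \<ge> K \<Longrightarrow> G k \<Longrightarrow> r (Suc k) \<le> q * r k"
  shows "\<exists>M>0. \<forall>k. r k \<le> M * q ^ count_before G k"
proof (rule rate_from_late_rate[where r = r and q = q and C = "r K + 1" and K = K])
  let ?c = "count_before G"
  fix k assume "K \<le> k"
  then show "r k \<le> (r K + 1) * q ^ (?c k - ?c K)"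
  proof (induction k rule: dec_induct)
    case (step k)
    have m: "?c K \<le> ?c k" using step.hyps by (intro count_before_mono) auto
    show ?case
    proof (cases "G k")
      case True
      have "r (Suc k) \<le> q * r k" using assms(5) step.hyps True by auto
      also have "\<dots> \<le> q * ((r K + 1) * q ^ (?c k - ?c K))" using step.IH q by (intro mult_left_mono) auto
      finally show ?thesis using True m by (simp add: count_before_Suc Suc_diff_le mult_ac)
    next
      case False then show ?thesis using step.IH r(2)[of k] by (simp add: count_before_Suc)
    qed
  qed simp
qed (use r(1)[of K] r q in \<open>auto simp: add_nonneg_pos\<close>)

section \<open>The steps of the three methods\<close>

lemma inner_le_convex_hull:
  fixes c :: "'a::euclidean_space"
  assumes "\<And>a. a \<in> S \<Longrightarrow> c \<bullet> a \<le> b" "y \<in> convex hull S"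
  shows "c \<bullet> y \<le> b"
proof -
  have "convex hull S \<subseteq> {y. c \<bullet> y \<le> b}"
    by (rule hull_minimal) (use assms(1) convex_halfspace_le in auto)
  then show ?thesis using assms(2) by auto
qed

lemma inner_ge_convex_hull:
  fixes c :: "'a::euclidean_space"
  assumes "\<And>a. a \<in> S \<Longrightarrow> b \<le> c \<bullet> a" "y \<in> convex hull S"
  shows "b \<le> c \<bullet> y"
  using inner_le_convex_hull[of S "- c" "- b" y] assms by simp

lemma active_rep_hull:
  assumes "finite A" "active_rep A w x"
  shows "x \<in> convex hull (active_set A w)"
proof -
  have f: "finite (active_set A w)" using assms(1) by (simp add: active_set_def)
  have w0: "\<forall>a\<in>A - active_set A w. w a = 0"
    using assms(2) by (force simp: active_set_def active_rep_def)
  have sub: "active_set A w \<subseteq> A" by (auto simp: active_set_def)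
  have 1: "sum w (active_set A w) = sum w A"
    by (rule sum.mono_neutral_left[OF assms(1) sub w0])
  have 2: "(\<Sum>a\<in>active_set A w. w a *\<^sub>R a) = (\<Sum>a\<in>A. w a *\<^sub>R a)"
    by (rule sum.mono_neutral_left[OF assms(1) sub]) (use w0 in simp)
  show ?thesis unfolding convex_hull_finite[OF f]
    by (rule CollectI, rule exI[of _ w]) (use 1 2 assms(2) in \<open>auto simp: active_rep_def active_set_def\<close>)
qed

lemma active_rep_in_hull: "finite A \<Longrightarrow> active_rep A w x \<Longrightarrow> x \<in> convex hull A"
  using active_rep_hull hull_mono[of "active_set A w" A convex] by (fastforce simp: active_set_def)

lemma active_rep_weight_le_1:
  assumes "finite A" "active_rep A w x" "a \<in> A"
  shows "w a \<le> 1"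
  using member_le_sum[of a A w] assms by (auto simp: active_rep_def)

lemma active_rep_eq_atom:
  assumes "finite A" "active_rep A w x" "q \<in> A" "w q = 1"
  shows "x = q"
proof -
  have "sum w (A - {q}) = 0" using assms sum.remove[OF assms(1,3), of w] by (simp add: active_rep_def)
  then have "\<forall>a\<in>A - {q}. w a = 0"
    using assms by (subst (asm) sum_nonneg_eq_0_iff) (auto simp: active_rep_def)
  then have "(\<Sum>a\<in>A - {q}. w a *\<^sub>R a) = 0" by simp
  then show ?thesis using assms sum.remove[OF assms(1,3), of "\<lambda>a. w a *\<^sub>R a"] by (simp add: active_rep_def)
qed

text \<open>The pairwise direction is the steepest among all differences of a point of the polytope
  and a point of the hull of the active atoms.\<close>

lemma active_rep_gap:
  fixes A :: "'a::euclidean_space set"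
  assumes "finite A" "active_rep A w x" and s: "\<And>y. y \<in> convex hull A \<Longrightarrow> y \<bullet> g \<le> s \<bullet> g"
    and q: "\<And>a. a \<in> active_set A w \<Longrightarrow> q \<bullet> g \<le> a \<bullet> g"
  shows "\<And>p n. p \<in> convex hull A \<Longrightarrow> n \<in> convex hull (active_set A w) \<Longrightarrow> g \<bullet> (p - n) \<le> g \<bullet> (s - q)"
    and "g \<bullet> (x - q) \<ge> 0"
proof -
  have n: "q \<bullet> g \<le> g \<bullet> n" if "n \<in> convex hull (active_set A w)" for n
    by (rule inner_ge_convex_hull[OF _ that]) (use q in \<open>auto simp: inner_commute\<close>)
  show "g \<bullet> (p - n) \<le> g \<bullet> (s - q)" if "p \<in> convex hull A" "n \<in> convex hull (active_set A w)" for p n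
    using s[OF that(1)] n[OF that(2)] by (simp add: inner_diff_right inner_commute)
  show "g \<bullet> (x - q) \<ge> 0"
    using n[OF active_rep_hull[OF assms(1,2)]] by (simp add: inner_diff_right inner_commute)
qed

lemma sum_single_weight: "finite A \<Longrightarrow> s \<in> A \<Longrightarrow> (\<Sum>a\<in>A. (if a = s then c else 0) *\<^sub>R a) = c *\<^sub>R (s :: 'a::real_vector)"
  by (simp add: if_distrib[of "\<lambda>c. c *\<^sub>R _"] cong: if_cong)

context
  fixes A :: "'a::euclidean_space set" and L :: real and g x :: 'a and w w' :: "'a \<Rightarrow> real" and d :: 'a and \<alpha> :: real
  assumes fin: "finite A" and rep: "active_rep A w x" and L: "L > 0"
    and ascent: "\<exists>y\<in>convex hull A. g \<bullet> (y - x) > 0"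
begin

text \<open>The pairwise slope is the sum of the slopes of the two candidate directions, whence the
  factor \<open>2\<close>. An away step at an atom of weight \<open>1\<close> cannot occur, since
  then the point would be that atom and the away direction zero.\<close>

lemma afw_step_properties:
  assumes "afw_step A L g x w d \<alpha> w'"
  shows "g \<bullet> d > 0" "0 \<le> \<alpha>" "\<alpha> \<le> short_step L g d" "active_rep A w' (x + \<alpha> *\<^sub>R d)"
    "\<And>y. y \<in> convex hull A \<Longrightarrow> g \<bullet> (y - x) \<le> g \<bullet> d"
    "\<And>p n. p \<in> convex hull A \<Longrightarrow> n \<in> convex hull (active_set A w) \<Longrightarrow> g \<bullet> (p - n) \<le> 2 * (g \<bullet> d)"
    "norm d \<le> diameter (convex hull A)"
proof -
  obtain s q where sA: "s \<in> A" and smax: "is_arg_max (\<lambda>y. y \<bullet> g) (\<lambda>y. y \<in> convex hull A) s"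
    and qmin: "is_arg_min (\<lambda>y. y \<bullet> g) (\<lambda>y. y \<in> active_set A w) q"
    and dmax: "is_arg_max (\<lambda>v. g \<bullet> v) (\<lambda>v. v \<in> {s - x, x - q}) d"
    and step: "d = s - x \<and> \<alpha> = min (short_step L g d) 1 \<and>
          w' = (\<lambda>a. (1 - \<alpha>) * w a + (if a = s then \<alpha> else 0)) \<or>
        d = x - q \<and> \<alpha> = min (short_step L g d) (w q / (1 - w q)) \<and>
          w' = (\<lambda>a. (1 + \<alpha>) * w a - (if a = q then \<alpha> else 0))"
    using assms unfolding afw_step_def by blast
  have s: "s \<in> A" "\<And>y. y \<in> convex hull A \<Longrightarrow> y \<bullet> g \<le> s \<bullet> g"
    using sA smax by (auto simp: is_arg_max_linorder)
  have q: "q \<in> active_set A w" "\<And>a. a \<in> active_set A w \<Longrightarrow> q \<bullet> g \<le> a \<bullet> g"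
    using qmin by (auto simp: is_arg_min_linorder)
  have d: "d = s - x \<or> d = x - q" "g \<bullet> (s - x) \<le> g \<bullet> d" "g \<bullet> (x - q) \<le> g \<bullet> d"
    using dmax unfolding is_arg_max_linorder by blast+
  have qA: "q \<in> A" "w q > 0" using q(1) by (auto simp: active_set_def)
  have xA: "x \<in> convex hull A" by (rule active_rep_in_hull[OF fin rep])
  show le: "g \<bullet> (y - x) \<le> g \<bullet> d" if "y \<in> convex hull A" for y
    using s(2)[OF that] d(2) by (simp add: inner_diff_right inner_commute)
  then show pos: "g \<bullet> d > 0" using ascent by fastforce
  then have "d \<noteq> 0" by auto
  then have short: "short_step L g d > 0" using pos L by (simp add: short_step_def)
  show "g \<bullet> (p - n) \<le> 2 * (g \<bullet> d)" if "p \<in> convex hull A" "n \<in> convex hull (active_set A w)" for p n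
  proof -
    have "g \<bullet> (p - n) \<le> g \<bullet> (s - q)" by (rule active_rep_gap(1)[OF fin rep s(2) q(2) that])
    also have "\<dots> = g \<bullet> (s - x) + g \<bullet> (x - q)" by (simp add: inner_diff_right)
    finally show ?thesis using d(2,3) by linarith
  qed
  have bd: "bounded (convex hull A)" using fin by (simp add: bounded_convex_hull finite_imp_bounded)
  show "norm d \<le> diameter (convex hull A)"
    using d(1) diameter_bounded_bound[OF bd] s(1) qA(1) xA by (auto simp: dist_norm hull_inc)
  have w0: "w a \<ge> 0" if "a \<in> A" for a using rep that by (auto simp: active_rep_def)
  have sums: "sum w A = 1" "(\<Sum>a\<in>A. w a *\<^sub>R a) = x" using rep by (auto simp: active_rep_def)
  from step have "0 \<le> \<alpha> \<and> \<alpha> \<le> short_step L g d \<and> active_rep A w' (x + \<alpha> *\<^sub>R d)"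
  proof
    assume c: "d = s - x \<and> \<alpha> = min (short_step L g d) 1 \<and>
          w' = (\<lambda>a. (1 - \<alpha>) * w a + (if a = s then \<alpha> else 0))"
    then have w': "w' a = (1 - \<alpha>) * w a + (if a = s then \<alpha> else 0)" for a by auto
    have \<alpha>: "0 \<le> \<alpha>" "\<alpha> \<le> 1" "\<alpha> \<le> short_step L g d" using c short by auto
    have "sum w' A = (1 - \<alpha>) * sum w A + \<alpha>"
      using fin s(1) by (simp add: w' sum.distrib sum_distrib_left)
    moreover have "(\<Sum>a\<in>A. w' a *\<^sub>R a) = (1 - \<alpha>) *\<^sub>R (\<Sum>a\<in>A. w a *\<^sub>R a) + \<alpha> *\<^sub>R s"
      unfolding w' scaleR_left_distrib sum.distrib sum_single_weight[OF fin s(1)]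
      by (simp add: scaleR_sum_right)
    moreover have "w' a \<ge> 0" if "a \<in> A" for a using \<alpha> w0[OF that] by (simp add: w')
    moreover have "(1 - \<alpha>) *\<^sub>R x + \<alpha> *\<^sub>R s = x + \<alpha> *\<^sub>R d"
      unfolding conjunct1[OF c] by (simp add: algebra_simps)
    ultimately have "active_rep A w' (x + \<alpha> *\<^sub>R d)"
      unfolding active_rep_def sums by simp
    then show ?thesis using \<alpha> by simp
  next
    assume c: "d = x - q \<and> \<alpha> = min (short_step L g d) (w q / (1 - w q)) \<and>
          w' = (\<lambda>a. (1 + \<alpha>) * w a - (if a = q then \<alpha> else 0))"
    then have w': "w' a = (1 + \<alpha>) * w a - (if a = q then \<alpha> else 0)" for a by auto
    have "w q \<noteq> 1" using active_rep_eq_atom[OF fin rep qA(1)] c \<open>d \<noteq> 0\<close> by auto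
    then have q1: "1 - w q > 0" using active_rep_weight_le_1[OF fin rep qA(1)] by simp
    have \<alpha>: "0 \<le> \<alpha>" "\<alpha> \<le> w q / (1 - w q)" "\<alpha> \<le> short_step L g d" using c short qA(2) q1 by auto
    then have "\<alpha> \<le> (1 + \<alpha>) * w q" using q1 by (simp add: field_simps)
    then have w'0: "w' a \<ge> 0" if "a \<in> A" for a using \<alpha>(1) w0[OF that] by (auto simp: w')
    have "sum w' A = (1 + \<alpha>) * sum w A - \<alpha>"
      using fin qA(1) by (simp add: w' sum_subtractf sum_distrib_left)
    moreover have "(\<Sum>a\<in>A. w' a *\<^sub>R a) = (1 + \<alpha>) *\<^sub>R (\<Sum>a\<in>A. w a *\<^sub>R a) - \<alpha> *\<^sub>R q"
      unfolding w' scaleR_left_diff_distrib sum_subtractf sum_single_weight[OF fin qA(1)]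
      by (simp add: scaleR_sum_right)
    moreover have "(1 + \<alpha>) *\<^sub>R x - \<alpha> *\<^sub>R q = x + \<alpha> *\<^sub>R d"
      unfolding conjunct1[OF c] by (simp add: algebra_simps)
    ultimately have "active_rep A w' (x + \<alpha> *\<^sub>R d)"
      unfolding active_rep_def sums using w'0 by simp
    then show ?thesis using \<alpha> by simp
  qed
  then show "0 \<le> \<alpha>" "\<alpha> \<le> short_step L g d" "active_rep A w' (x + \<alpha> *\<^sub>R d)" by auto
qed

lemma pfw_step_properties:
  assumes "pfw_step A L g w d \<alpha> w'"
  obtains s q where "s \<in> A" "\<And>y. y \<in> convex hull A \<Longrightarrow> g \<bullet> y \<le> g \<bullet> s"
    "q \<in> active_set A w" "\<And>a. a \<in> active_set A w \<Longrightarrow> g \<bullet> q \<le> g \<bullet> a"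
    "d = s - q" "g \<bullet> d > 0" "0 < \<alpha>" "\<alpha> = min (short_step L g d) (w q)"
    "w' = (\<lambda>a. w a + (if a = s then \<alpha> else 0) - (if a = q then \<alpha> else 0))"
    "active_rep A w' (x + \<alpha> *\<^sub>R d)"
proof -
  obtain s q where sA: "s \<in> A" and smax: "is_arg_max (\<lambda>y. y \<bullet> g) (\<lambda>y. y \<in> convex hull A) s"
    and qmin: "is_arg_min (\<lambda>y. y \<bullet> g) (\<lambda>y. y \<in> active_set A w) q"
    and d: "d = s - q" "\<alpha> = min (short_step L g d) (w q)"
      "w' = (\<lambda>a. w a + (if a = s then \<alpha> else 0) - (if a = q then \<alpha> else 0))"
    using assms unfolding pfw_step_def by blast
  have s: "s \<in> A" "\<And>y. y \<in> convex hull A \<Longrightarrow> y \<bullet> g \<le> s \<bullet> g"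
    using sA smax by (auto simp: is_arg_max_linorder)
  have q: "q \<in> active_set A w" "\<And>a. a \<in> active_set A w \<Longrightarrow> q \<bullet> g \<le> a \<bullet> g"
    using qmin by (auto simp: is_arg_min_linorder)
  have qA: "q \<in> A" "w q > 0" using q(1) by (auto simp: active_set_def)
  obtain y where "y \<in> convex hull A" "g \<bullet> (y - x) > 0" using ascent by blast
  then have pos: "g \<bullet> d > 0"
    using s(2)[of y] active_rep_gap(2)[OF fin rep s(2) q(2)] d(1) by (simp add: inner_diff_right inner_commute)
  then have "d \<noteq> 0" by auto
  then have "short_step L g d > 0" using pos L by (simp add: short_step_def)
  then have \<alpha>: "0 < \<alpha>" "\<alpha> \<le> w q" using d(2) qA by auto
  have w': "w' a = w a + ((if a = s then \<alpha> else 0) - (if a = q then \<alpha> else 0))" for a using d(3) by auto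
  have "w' a \<ge> 0" if "a \<in> A" for a using \<alpha> rep that by (auto simp: w' active_rep_def)
  moreover have "sum w' A = sum w A"
    using fin s(1) qA(1) by (simp add: w' sum.distrib sum_subtractf)
  moreover have "(\<Sum>a\<in>A. w' a *\<^sub>R a) = (\<Sum>a\<in>A. w a *\<^sub>R a) + \<alpha> *\<^sub>R d"
    unfolding w' scaleR_left_diff_distrib scaleR_left_distrib sum.distrib sum_subtractf
      sum_single_weight[OF fin qA(1)] sum_single_weight[OF fin s(1)] by (simp add: d(1) scaleR_diff_right)
  ultimately have "active_rep A w' (x + \<alpha> *\<^sub>R d)" using rep by (auto simp: active_rep_def)
  then show ?thesis using that[OF s(1) _ q(1) _ d(1) pos \<alpha>(1) d(2,3)] s(2) q(2) by (simp add: inner_commute)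
qed

end

text \<open>As for the away steps, with the minimal face in place of the active atoms. The maximal
  stepsize exists, because the polytope is compact.\<close>

lemma fdfw_step_properties:
  fixes A :: "'a::euclidean_space set"
  assumes fin: "finite A" and x: "x \<in> convex hull A" and L: "L > 0"
    and ascent: "\<exists>y\<in>convex hull A. g \<bullet> (y - x) > 0"
    and step: "fdfw_step (convex hull A) L g x d \<alpha>"
  shows "g \<bullet> d > 0" "0 \<le> \<alpha>" "\<alpha> \<le> short_step L g d" "x + \<alpha> *\<^sub>R d \<in> convex hull A"
    "\<And>y. y \<in> convex hull A \<Longrightarrow> g \<bullet> (y - x) \<le> g \<bullet> d"
    "\<And>p n. p \<in> convex hull A \<Longrightarrow> n \<in> min_face (convex hull A) x \<Longrightarrow> g \<bullet> (p - n) \<le> 2 * (g \<bullet> d)"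
    "norm d \<le> diameter (convex hull A)"
proof -
  let ?\<Omega> = "convex hull A"
  obtain s z where smax: "is_arg_max (\<lambda>y. y \<bullet> g) (\<lambda>y. y \<in> ?\<Omega>) s"
    and zmin: "is_arg_min (\<lambda>y. g \<bullet> y) (\<lambda>y. y \<in> min_face ?\<Omega> x) z"
    and dmax: "is_arg_max (\<lambda>v. g \<bullet> v) (\<lambda>v. v \<in> {s - x, x - z}) d"
    and \<alpha>: "\<alpha> = min (short_step L g d) (GREATEST t. 0 \<le> t \<and> x + t *\<^sub>R d \<in> ?\<Omega>)"
    using step unfolding fdfw_step_def by blast
  have s: "s \<in> ?\<Omega>" "\<And>y. y \<in> ?\<Omega> \<Longrightarrow> y \<bullet> g \<le> s \<bullet> g"
    using smax by (auto simp: is_arg_max_linorder)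
  have z: "z \<in> min_face ?\<Omega> x" "\<And>a. a \<in> min_face ?\<Omega> x \<Longrightarrow> g \<bullet> z \<le> g \<bullet> a"
    using zmin by (auto simp: is_arg_min_linorder)
  have d: "d = s - x \<or> d = x - z" "g \<bullet> (s - x) \<le> g \<bullet> d" "g \<bullet> (x - z) \<le> g \<bullet> d"
    using dmax unfolding is_arg_max_linorder by blast+
  show le: "g \<bullet> (y - x) \<le> g \<bullet> d" if "y \<in> ?\<Omega>" for y
    using s(2)[OF that] d(2) by (simp add: inner_diff_right inner_commute)
  then show pos: "g \<bullet> d > 0" using ascent by fastforce
  then have d0: "d \<noteq> 0" by auto
  then have short: "short_step L g d > 0" using pos L by (simp add: short_step_def)
  show "g \<bullet> (p - n) \<le> 2 * (g \<bullet> d)" if "p \<in> ?\<Omega>" "n \<in> min_face ?\<Omega> x" for p n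
  proof -
    have "g \<bullet> (p - n) \<le> g \<bullet> (s - x) + g \<bullet> (x - z)"
      using s(2)[OF that(1)] z(2)[OF that(2)] by (simp add: inner_diff_right inner_commute)
    then show ?thesis using d(2,3) by linarith
  qed
  have bd: "bounded ?\<Omega>" using fin by (simp add: bounded_convex_hull finite_imp_bounded)
  have z\<Omega>: "z \<in> ?\<Omega>" using z(1) min_face_face_of[OF convex_convex_hull x] face_of_imp_subset by blast
  show "norm d \<le> diameter ?\<Omega>"
    using d(1) diameter_bounded_bound[OF bd] s(1) z\<Omega> x by (auto simp: dist_norm)
  let ?T = "{t. 0 \<le> t \<and> x + t *\<^sub>R d \<in> ?\<Omega>}"
  have "?T = {0..} \<inter> (\<lambda>t. x + t *\<^sub>R d) -` ?\<Omega>" by auto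
  moreover have "closed ?\<Omega>" using fin by (simp add: compact_imp_closed compact_convex_hull finite_imp_compact)
  then have "closed ((\<lambda>t::real. x + t *\<^sub>R d) -` ?\<Omega>)"
    by (rule closed_vimage) (intro continuous_intros)
  ultimately have clT: "closed ?T" by auto
  have bdT: "bdd_above ?T"
  proof (rule bdd_aboveI)
    fix t assume t: "t \<in> ?T"
    then have "dist (x + t *\<^sub>R d) x \<le> diameter ?\<Omega>" using diameter_bounded_bound[OF bd] x by auto
    then show "t \<le> diameter ?\<Omega> / norm d" using d0 t by (simp add: dist_norm field_simps)
  qed
  have 0: "0 \<in> ?T" using x by simp
  define t where "t = Sup ?T"
  have tT: "t \<in> ?T" unfolding t_def by (rule closed_contains_Sup) (use clT bdT 0 in auto)
  have tmax: "y \<le> t" if "y \<in> ?T" for y unfolding t_def using bdT that by (rule cSup_upper[rotated])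
  have "(GREATEST t. 0 \<le> t \<and> x + t *\<^sub>R d \<in> ?\<Omega>) = t"
    by (rule Greatest_equality) (use tT tmax in auto)
  then have \<alpha>t: "\<alpha> = min (short_step L g d) t" using \<alpha> by simp
  then show a: "0 \<le> \<alpha>" "\<alpha> \<le> short_step L g d" using short tT by auto
  show "x + \<alpha> *\<^sub>R d \<in> ?\<Omega>"
  proof (cases "t = 0")
    case True then show ?thesis using \<alpha>t short x by simp
  next
    case False
    then have t: "t > 0" using tT by simp
    have "(1 - \<alpha> / t) *\<^sub>R x + (\<alpha> / t) *\<^sub>R (x + t *\<^sub>R d) \<in> ?\<Omega>"
      using a \<alpha>t t tT x by (intro convexD[OF convex_convex_hull]) auto
    then show ?thesis using t by (simp add: algebra_simps)
  qed
qed

section \<open>Away-step and in-face methods\<close>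

context smooth_on_polytope
begin

text \<open>In particular there are proper faces, and disjoint ones, so the minima in the two widths
  are over nonempty sets.\<close>

lemma two_vertices:
  obtains v v' where "{v} \<in> pfaces \<Omega>" "{v'} \<in> pfaces \<Omega>" "v \<noteq> v'"
proof -
  let ?E = "{v. v extreme_point_of \<Omega>}"
  have hull: "\<Omega> = convex hull ?E" using Krein_Milman_Minkowski[OF compact_\<Omega> convex_convex_hull] .
  have "\<exists>v\<in>?E. \<exists>v'\<in>?E. v \<noteq> v'"
  proof (rule ccontr)
    assume no: "\<not> ?thesis"
    obtain y z where yz: "y \<in> \<Omega>" "z \<in> \<Omega>" "y \<noteq> z" using nontriv by blast
    then have "convex hull ?E \<noteq> {}" using hull by blast
    then have "?E \<noteq> {}" by (metis convex_hull_empty)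
    then obtain v where "?E = {v}" using no by blast
    then have "\<Omega> = {v}" using hull by (metis convex_hull_singleton)
    then show False using yz by auto
  qed
  then obtain v v' where v: "v extreme_point_of \<Omega>" "v' extreme_point_of \<Omega>" "v \<noteq> v'" by auto
  moreover have "\<Omega> \<noteq> {u}" for u using nontriv by auto
  ultimately show ?thesis using that[of v v'] by (auto simp: pfaces_def face_of_singleton)
qed

lemma PWidth_nonneg: "PWidth A \<ge> 0"
proof -
  have "PWidth A \<in> (\<lambda>F. setdist F (convex hull (A - F))) ` pfaces \<Omega>"
    unfolding PWidth_def using pfaces_finite[OF fin] two_vertices by (intro Min_in) auto
  then show ?thesis by auto
qed

lemma PFWidth_nonneg: "PFWidth \<Omega> \<ge> 0"
proof -
  let ?S = "{setdist F G | F G. F \<in> pfaces \<Omega> \<and> G \<in> pfaces \<Omega> \<and> F \<inter> G = {}}"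
  have "?S \<subseteq> (\<lambda>(F, G). setdist F G) ` (pfaces \<Omega> \<times> pfaces \<Omega>)" by auto
  then have "finite ?S" by (rule finite_subset) (simp add: pfaces_finite fin)
  moreover have "?S \<noteq> {}"
  proof -
    obtain v v' where "{v} \<in> pfaces \<Omega>" "{v'} \<in> pfaces \<Omega>" "v \<noteq> v'" by (rule two_vertices)
    then have "setdist {v} {v'} \<in> ?S" by blast
    then show ?thesis by blast
  qed
  ultimately have "PFWidth \<Omega> \<in> ?S" unfolding PFWidth_def by (rule Min_in)
  then show ?thesis by auto
qed

lemma good_steps_eq_count:
  "good_steps \<Omega> f' L x d \<alpha> k = count_before (\<lambda>k. good_step \<Omega> f' L x d \<alpha> k) k"
  by (simp add: good_steps_def count_before_def)

lemma rate_with_half_angle: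
  assumes run: "descent_run A f f' L x d \<alpha>" and \<mu>: "\<mu> > 0"
    and KL: "\<And>z. z \<in> \<Omega> \<Longrightarrow> f z = lim (\<lambda>k. f (x k)) \<Longrightarrow> stationary \<Omega> f' z \<Longrightarrow> KL_at \<Omega> f f' \<mu> z"
    and fw: "\<And>k y. y \<in> \<Omega> \<Longrightarrow> - f' (x k) \<bullet> (y - x k) \<le> - f' (x k) \<bullet> d k"
    and angle: "\<And>k. W * slope (x k) \<le> 2 * (- f' (x k) \<bullet> d k)" and W: "W \<ge> 0"
    and dD: "\<And>k. norm (d k) \<le> D"
  shows "\<exists>M>0. \<forall>k. f (x k) - lim (\<lambda>k. f (x k)) \<le> M *
    (max (1 - \<mu> / L * (W / (2 * D))\<^sup>2) (inverse (1 + \<mu> / L))) ^ good_steps \<Omega> f' L x d \<alpha> k"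
proof -
  interpret descent_run A f f' L x d \<alpha> by (rule run)
  let ?q = "max (1 - \<mu> / L * (W / (2 * D))\<^sup>2) (inverse (1 + \<mu> / L))"
  have pos: "\<mu> / L > 0" using \<mu> L by simp
  have "0 \<le> \<mu> / L * (W / (2 * D))\<^sup>2" using pos by (intro mult_nonneg_nonneg) auto
  then have q: "0 < ?q" "?q \<le> 1"
    using pos by (simp_all add: less_max_iff_disj inverse_le_1_iff add_pos_pos)
  have angle': "W / 2 * slope (x k) \<le> h k" for k using angle[of k] by simp
  have "\<exists>K. \<forall>k\<ge>K. (\<alpha> k = short k \<longrightarrow> r (Suc k) \<le> (1 - \<mu> / L * (W / 2 / D)\<^sup>2) * r k) \<and>
                   (full k \<longrightarrow> r (Suc k) \<le> inverse (1 + \<mu> / L) * r k)"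
    by (rule good_step_rate) (use KL \<mu> fw angle' W dD in \<open>auto simp: fstar_def\<close>)
  then obtain K where K: "\<And>k. k \<ge> K \<Longrightarrow> (\<alpha> k = short k \<longrightarrow> r (Suc k) \<le> (1 - \<mu> / L * (W / 2 / D)\<^sup>2) * r k) \<and>
                   (full k \<longrightarrow> r (Suc k) \<le> inverse (1 + \<mu> / L) * r k)"
    by blast
  have "\<exists>M>0. \<forall>k. r k \<le> M * ?q ^ count_before (\<lambda>k. good_step \<Omega> f' L x d \<alpha> k) k"
  proof (rule rate_from_late_steps[where r = r and q = ?q and K = K])
    fix k assume k: "K \<le> k" and g: "good_step \<Omega> f' L x d \<alpha> k"
    have g': "\<alpha> k = short k \<or> full k"
      using g by (auto simp: good_step_def full_def is_arg_min_def not_less)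
    show "r (Suc k) \<le> ?q * r k"
    proof -
      have "r (Suc k) \<le> (1 - \<mu> / L * (W / (2 * D))\<^sup>2) * r k \<or> r (Suc k) \<le> inverse (1 + \<mu> / L) * r k"
        using K[OF k] g' by (auto simp: field_simps)
      moreover have "(1 - \<mu> / L * (W / (2 * D))\<^sup>2) * r k \<le> ?q * r k" "inverse (1 + \<mu> / L) * r k \<le> ?q * r k"
        using r_nonneg[of k] by (intro mult_right_mono; simp)+
      ultimately show ?thesis by linarith
    qed
  qed (use r_nonneg r_Suc q in auto)
  then show ?thesis by (simp add: r_def fstar_def good_steps_eq_count)
qed

lemma afw_rate:
  assumes run: "infinite_run AFW A f' L x d \<alpha>" and \<mu>: "\<mu> > 0"
    and KL: "\<And>z. z \<in> \<Omega> \<Longrightarrow> f z = lim (\<lambda>k. f (x k)) \<Longrightarrow> stationary \<Omega> f' z \<Longrightarrow> KL_at \<Omega> f f' \<mu> z"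
  shows "\<exists>M>0. \<forall>k. f (x k) - lim (\<lambda>k. f (x k)) \<le> M * q_gs AFW A L \<mu> ^ good_steps \<Omega> f' L x d \<alpha> k"
proof -
  obtain w where w0: "active_rep A (w 0) (x 0)"
    and st: "\<And>k. afw_step A L (- f' (x k)) (x k) (w k) (d k) (\<alpha> k) (w (Suc k))"
    using run by (auto simp: infinite_run_def)
  have xs: "x (Suc k) = x k + \<alpha> k *\<^sub>R d k" and ns: "\<not> stationary \<Omega> f' (x k)" for k
    using run by (auto simp: infinite_run_def)
  have asc: "\<exists>y\<in>\<Omega>. - f' (x k) \<bullet> (y - x k) > 0" if "active_rep A (w k) (x k)" for k
    using nonstationary_direction[OF active_rep_in_hull[OF fin that] ns] by blast
  have rep: "active_rep A (w k) (x k)" for k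
  proof (induction k)
    case (Suc k)
    then show ?case using afw_step_properties(4)[OF fin Suc L asc[OF Suc] st] by (simp add: xs)
  qed (rule w0)
  note P = afw_step_properties[OF fin rep L asc[OF rep] st]
  have "descent_run A f f' L x d \<alpha>"
    by unfold_locales (use active_rep_in_hull[OF fin rep] xs P(1-3) in auto)
  moreover have "PWidth A * slope (x k) \<le> 2 * (- f' (x k) \<bullet> d k)" for k
    by (rule PWidth_slope[OF fin _ active_rep_hull[OF fin rep] P(6)]) (auto simp: active_set_def)
  ultimately show ?thesis using rate_with_half_angle[OF _ \<mu> KL P(5) _ PWidth_nonneg P(7)] by simp
qed

lemma fdfw_rate:
  assumes run: "infinite_run FDFW A f' L x d \<alpha>" and \<mu>: "\<mu> > 0"
    and KL: "\<And>z. z \<in> \<Omega> \<Longrightarrow> f z = lim (\<lambda>k. f (x k)) \<Longrightarrow> stationary \<Omega> f' z \<Longrightarrow> KL_at \<Omega> f f' \<mu> z"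
  shows "\<exists>M>0. \<forall>k. f (x k) - lim (\<lambda>k. f (x k)) \<le> M * q_gs FDFW A L \<mu> ^ good_steps \<Omega> f' L x d \<alpha> k"
proof -
  have st: "fdfw_step \<Omega> L (- f' (x k)) (x k) (d k) (\<alpha> k)"
    and xs: "x (Suc k) = x k + \<alpha> k *\<^sub>R d k" and ns: "\<not> stationary \<Omega> f' (x k)" and x0: "x 0 \<in> \<Omega>" for k
    using run by (auto simp: infinite_run_def)
  have asc: "\<exists>y\<in>\<Omega>. - f' (x k) \<bullet> (y - x k) > 0" if "x k \<in> \<Omega>" for k
    using nonstationary_direction[OF that ns] by blast
  have x: "x k \<in> \<Omega>" for k
  proof (induction k)
    case (Suc k)
    then show ?case using fdfw_step_properties(4)[OF fin Suc L asc[OF Suc] st] by (simp add: xs)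
  qed (rule x0)
  note P = fdfw_step_properties[OF fin x L asc[OF x] st]
  have "descent_run A f f' L x d \<alpha>"
    by unfold_locales (use x xs P(1-3) in auto)
  moreover have "PFWidth \<Omega> * slope (x k) \<le> 2 * (- f' (x k) \<bullet> d k)" for k
    by (rule PFWidth_slope[OF fin x P(6)])
  ultimately show ?thesis using rate_with_half_angle[OF _ \<mu> KL P(5) _ PFWidth_nonneg P(7)] by simp
qed

end

section \<open>Pairwise runs\<close>

locale pairwise_run = descent_run +
  fixes w :: "nat \<Rightarrow> 'a \<Rightarrow> real" and s q :: "nat \<Rightarrow> 'a"
  assumes rep: "\<And>k. active_rep A (w k) (x k)"
    and s_in: "\<And>k. s k \<in> A" and s_max: "\<And>k y. y \<in> \<Omega> \<Longrightarrow> - f' (x k) \<bullet> y \<le> - f' (x k) \<bullet> s k"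
    and q_active: "\<And>k. q k \<in> active_set A (w k)"
    and q_min: "\<And>k a. a \<in> active_set A (w k) \<Longrightarrow> - f' (x k) \<bullet> q k \<le> - f' (x k) \<bullet> a"
    and d_eq: "\<And>k. d k = s k - q k"
    and \<alpha>_pos: "\<And>k. 0 < \<alpha> k" and \<alpha>_eq: "\<And>k. \<alpha> k = min (short_step L (- f' (x k)) (d k)) (w k (q k))"
    and w_Suc: "\<And>k. w (Suc k) = (\<lambda>a. w k a + (if a = s k then \<alpha> k else 0) - (if a = q k then \<alpha> k else 0))"
begin

abbreviation "g k \<equiv> - f' (x k)"
abbreviation "S k \<equiv> active_set A (w k)"

text \<open>A step is of the kind \<open>bar\<close> if it is short. The other steps are called
  hops: they move the whole weight of the atom \<open>q k\<close> to the atom \<open>s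
  k\<close>.\<close>

definition "bar k \<longleftrightarrow> \<alpha> k = short k"

lemma hop: "\<not> bar k \<Longrightarrow> \<alpha> k = w k (q k) \<and> \<alpha> k < short k"
  using \<alpha>_eq[of k] by (auto simp: bar_def min_def split: if_splits)

lemma q_in: "q k \<in> A"
  using q_active by (auto simp: active_set_def)

lemma s_neq_q: "s k \<noteq> q k"
  using d_nonzero d_eq by auto

lemma w_nonneg: "a \<in> A \<Longrightarrow> 0 \<le> w k a"
  using rep by (auto simp: active_rep_def)

lemma norm_d_le_D: "norm (d k) \<le> D"
  unfolding d_eq by (intro norm_le_D) (auto intro: hull_inc s_in q_in)

lemma f_strict: "f (x (Suc k)) < f (x k)"
  using decrease_half[of k] \<alpha>_pos[of k] descent_dir[of k]
  by (smt (verit) half_gt_zero mult_pos_pos)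

lemma f_strict_less: "i < j \<Longrightarrow> f (x j) < f (x i)"
  by (rule lift_Suc_mono_less[where f = "\<lambda>k. - f (x k)", simplified]) (use f_strict in auto)

lemma r_pos: "r k > 0"
  using r_nonneg[of "Suc k"] f_strict[of k] by (simp add: r_def)

lemma gap_le_h:
  assumes "y \<in> \<Omega>" "n \<in> convex hull (S k)"
  shows "g k \<bullet> (y - n) \<le> h k"
proof -
  have "g k \<bullet> q k \<le> g k \<bullet> n" by (rule inner_ge_convex_hull[OF q_min assms(2)])
  then show ?thesis using s_max[OF assms(1), of k] by (simp add: d_eq inner_diff_right)
qed

text \<open>A block of hops only permutes and merges the weights that are present at its start; as
  the objective decreases strictly, no configuration recurs, so blocks are no longer than the number
  of self-maps of the atoms.\<close>

lemma hop_block: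
  "\<exists>N. \<forall>n. \<exists>m\<in>{n..n + N}. bar m"
proof (intro exI[of _ "card (PiE A (\<lambda>_. A))"] allI)
  let ?N = "card (PiE A (\<lambda>_. A))"
  fix n
  show "\<exists>m\<in>{n..n + ?N}. bar m"
  proof (rule ccontr)
    assume "\<not> ?thesis"
    then have nb: "\<not> bar (n + i)" if "i \<le> ?N" for i using that by auto
    \<comment> \<open>After \<open>i\<close> hops the weight that started at the atom
      \<open>b\<close> is at \<open>\<phi> i b\<close>.\<close>
    define \<phi> where "\<phi> = rec_nat (\<lambda>b\<in>A. b) (\<lambda>i \<psi>. \<lambda>b\<in>A. if \<psi> b = q (n + i) then s (n + i) else \<psi> b)"
    have \<phi>0: "\<phi> 0 = (\<lambda>b\<in>A. b)" by (simp add: \<phi>_def)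
    have \<phi>S: "\<phi> (Suc i) = (\<lambda>b\<in>A. if \<phi> i b = q (n + i) then s (n + i) else \<phi> i b)" for i
      unfolding \<phi>_def by simp
    have \<phi>PiE: "\<phi> i \<in> PiE A (\<lambda>_. A)" for i
      by (induction i) (auto simp: \<phi>0 \<phi>S s_in PiE_iff extensional_def)
    have wi: "i \<le> ?N \<Longrightarrow> a \<in> A \<Longrightarrow> w (n + i) a = (\<Sum>b\<in>A. if \<phi> i b = a then w n b else 0)" for i a
    proof (induction i arbitrary: a)
      case 0
      have "(\<Sum>b\<in>A. if \<phi> 0 b = a then w n b else 0) = (\<Sum>b\<in>A. if b = a then w n b else 0)"
        by (rule sum.cong) (auto simp: \<phi>0)
      then show ?case using 0 fin by simp
    next
      case (Suc i)
      have \<alpha>: "\<alpha> (n + i) = (\<Sum>b\<in>A. if \<phi> i b = q (n + i) then w n b else 0)"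
        using hop[OF nb[of i]] Suc by (simp add: q_in)
      have "w (n + Suc i) a = w (n + i) a + (if a = s (n + i) then \<alpha> (n + i) else 0)
          - (if a = q (n + i) then \<alpha> (n + i) else 0)"
        using w_Suc[of "n + i"] by simp
      also have "\<dots> = (\<Sum>b\<in>A. (if \<phi> i b = a then w n b else 0)
           + (if a = s (n + i) then (if \<phi> i b = q (n + i) then w n b else 0) else 0)
           - (if a = q (n + i) then (if \<phi> i b = q (n + i) then w n b else 0) else 0))"
        using Suc \<alpha> by (simp add: sum.distrib sum_subtractf)
      also have "\<dots> = (\<Sum>b\<in>A. if \<phi> (Suc i) b = a then w n b else 0)"
        by (rule sum.cong) (use s_neq_q[of "n + i"] in \<open>auto simp: \<phi>S\<close>)
      finally show ?case .
    qed
    have xi: "x (n + i) = (\<Sum>b\<in>A. w n b *\<^sub>R \<phi> i b)" if i: "i \<le> ?N" for i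
    proof -
      have "x (n + i) = (\<Sum>a\<in>A. (\<Sum>b\<in>A. if \<phi> i b = a then w n b else 0) *\<^sub>R a)"
        using rep[of "n + i"] wi[OF i] by (simp add: active_rep_def)
      also have "\<dots> = (\<Sum>a\<in>A. \<Sum>b\<in>A. (if \<phi> i b = a then w n b *\<^sub>R a else 0))"
        by (simp add: scaleR_sum_left if_distrib[of "\<lambda>c. c *\<^sub>R _"] cong: if_cong)
      also have "\<dots> = (\<Sum>b\<in>A. \<Sum>a\<in>A. (if \<phi> i b = a then w n b *\<^sub>R a else 0))" by (rule sum.swap)
      also have "\<dots> = (\<Sum>b\<in>A. w n b *\<^sub>R \<phi> i b)"
        using \<phi>PiE[of i] fin by (intro sum.cong) (auto simp: PiE_iff)
      finally show ?thesis .
    qed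
    have "inj_on \<phi> {0..?N}"
    proof (rule linorder_inj_onI')
      fix i j assume "i \<in> {0..?N}" "j \<in> {0..?N}" "i < j"
      then show "\<phi> i \<noteq> \<phi> j" using f_strict_less[of "n + i" "n + j"] xi[of i] xi[of j] by auto
    qed
    then have "card {0..?N} \<le> ?N"
      using \<phi>PiE fin by (intro card_inj_on_le[of \<phi>]) (auto intro: finite_PiE)
    then show False by simp
  qed
qed

text \<open>For the pairwise method the KL inequality holds at all late points, not only at good
  steps: a short step follows soon, and until then the point and the gradient hardly change, so the
  Frank-Wolfe gap tends to zero along the whole run.\<close>

lemma KL_late:
  assumes KL: "\<And>z. z \<in> \<Omega> \<Longrightarrow> f z = fstar \<Longrightarrow> stationary \<Omega> f' z \<Longrightarrow> KL_at \<Omega> f f' \<mu> z" and \<mu>: "\<mu> > 0"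
  shows "\<exists>K. \<forall>k\<ge>K. 2 * \<mu> * r k \<le> (slope (x k))\<^sup>2"
proof -
  obtain N where N: "\<And>n. \<exists>m\<in>{n..n + N}. bar m" using hop_block by blast
  have "bounded (f' ` \<Omega>)"
    using compact_continuous_image[OF continuous_on_f' compact_\<Omega>] compact_imp_bounded by blast
  then obtain B where B: "\<And>y. y \<in> \<Omega> \<Longrightarrow> norm (f' y) \<le> B" unfolding bounded_iff by auto
  have B0: "B \<ge> 0" using B[OF x_in[of 0]] norm_ge_zero order_trans by blast
  define \<sigma> where "\<sigma> n = (\<Sum>i<Suc N. norm (x (Suc (n + i)) - x (n + i)))" for n
  define \<delta> where "\<delta> n = L * \<sigma> n * D + sqrt (2 * L * D\<^sup>2 * (r n - r (n + Suc N))) + B * \<sigma> n" for n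
  have \<sigma>lim: "\<sigma> \<longlonglongrightarrow> (\<Sum>i<Suc N. 0)"
    unfolding \<sigma>_def
  proof (rule tendsto_sum)
    fix i
    show "(\<lambda>n. norm (x (Suc (n + i)) - x (n + i))) \<longlonglongrightarrow> 0"
      using LIMSEQ_ignore_initial_segment[OF dist_Suc_tendsto, of i] by simp
  qed
  have "(\<lambda>n. r (n + Suc N)) \<longlonglongrightarrow> 0" by (rule LIMSEQ_ignore_initial_segment[OF r_tendsto])
  then have "\<delta> \<longlonglongrightarrow> L * 0 * D + sqrt (2 * L * D\<^sup>2 * (0 - 0)) + B * 0"
    unfolding \<delta>_def using \<sigma>lim by (intro tendsto_intros r_tendsto) simp_all
  then have \<delta>lim: "\<delta> \<longlonglongrightarrow> 0" by simp
  have "\<exists>K. \<forall>k\<ge>K. True \<longrightarrow> 2 * \<mu> * (f (x k) - fstar) \<le> (slope (x k))\<^sup>2"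
  proof (rule KL_eventually[OF KL \<mu>, of fstar x \<delta> "\<lambda>_. True"])
    fix n v assume v: "v \<in> \<Omega>"
    obtain m where m: "n \<le> m" "m \<le> n + N" "bar m" using N by fastforce
    have "norm (x (n + j) - x n) \<le> (\<Sum>i<j. norm (x (Suc (n + i)) - x (n + i)))" for j
    proof (induction j)
      case (Suc j)
      have "norm (x (n + Suc j) - x n) \<le> norm (x (Suc (n + j)) - x (n + j)) + norm (x (n + j) - x n)"
        by (metis add_Suc_right norm_triangle_ineq diff_add_cancel add_diff_eq)
      then show ?case using Suc by simp
    qed simp
    from this[of "m - n"] have "norm (x m - x n) \<le> (\<Sum>i<m - n. norm (x (Suc (n + i)) - x (n + i)))"
      using m by simp
    also have "\<dots> \<le> \<sigma> n" unfolding \<sigma>_def using m by (intro sum_mono2) auto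
    finally have \<sigma>: "norm (x m - x n) \<le> \<sigma> n" .
    have "(h m)\<^sup>2 \<le> 2 * L * D\<^sup>2 * (r m - r (Suc m))"
      using m(3) by (intro short_step_gap_sq norm_d_le_D) (simp add: bar_def)
    also have "\<dots> \<le> 2 * L * D\<^sup>2 * (r n - r (n + Suc N))"
      using L m decseqD[OF decseq_f, of n m] decseqD[OF decseq_f, of "Suc m" "n + Suc N"]
      by (intro mult_left_mono) (auto simp: r_def)
    finally have hm: "h m \<le> sqrt (2 * L * D\<^sup>2 * (r n - r (n + Suc N)))" by (rule real_le_rsqrt)
    have "g n \<bullet> (v - x n) = (g n - g m) \<bullet> (v - x n) + g m \<bullet> (v - x m) + g m \<bullet> (x m - x n)"
      by (simp add: algebra_simps)
    moreover have "(g n - g m) \<bullet> (v - x n) \<le> L * \<sigma> n * D"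
    proof -
      have "(g n - g m) \<bullet> (v - x n) \<le> norm (f' (x m) - f' (x n)) * norm (v - x n)"
        using norm_cauchy_schwarz[of "g n - g m" "v - x n"] by simp
      also have "\<dots> \<le> (L * norm (x m - x n)) * D"
        using lip[OF x_in x_in] norm_le_D[OF v x_in] L by (intro mult_mono) auto
      also have "\<dots> \<le> (L * \<sigma> n) * D" using \<sigma> L D_pos by (intro mult_right_mono mult_left_mono) auto
      finally show ?thesis .
    qed
    moreover have "g m \<bullet> (v - x m) \<le> h m" by (rule gap_le_h[OF v active_rep_hull[OF fin rep]])
    moreover have "g m \<bullet> (x m - x n) \<le> B * \<sigma> n"
    proof -
      have "g m \<bullet> (x m - x n) \<le> norm (f' (x m)) * norm (x m - x n)"
        using norm_cauchy_schwarz[of "g m" "x m - x n"] by simp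
      also have "\<dots> \<le> B * \<sigma> n" using B[OF x_in] \<sigma> B0 by (intro mult_mono) auto
      finally show ?thesis .
    qed
    ultimately show "- f' (x n) \<bullet> (v - x n) \<le> \<delta> n" unfolding \<delta>_def using hm by linarith
  qed (use x_in tendsto_fstar r_nonneg \<delta>lim in \<open>auto simp: r_def\<close>)
  then show ?thesis by (simp add: r_def)
qed

end

section \<open>The gap in units of weight\<close>

text \<open>The run is supposed to have reached its late part from the start, so that the KL
  inequality always holds.\<close>

locale pairwise_KL = pairwise_run +
  fixes \<mu> :: real
  assumes \<mu>: "\<mu> > 0" and KL: "\<And>k. 2 * \<mu> * r k \<le> (slope (x k))\<^sup>2"
begin

abbreviation "W \<equiv> PWidth A"

definition "P = (W / D)\<^sup>2"
definition "T = \<mu> / L * P"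

text \<open>The optimality gap measured in the same unit as the stepsizes. In this unit a short step
  moves at least weight \<open>\<omega>\<close>.\<close>

definition "\<omega> k = sqrt (2 * T * r k / (L * D\<^sup>2))"

lemma P_nonneg: "P \<ge> 0"
  by (simp add: P_def)

lemma T_nonneg: "T \<ge> 0"
  using \<mu> L P_nonneg by (simp add: T_def)

lemma P_pos: "T > 0 \<Longrightarrow> P > 0"
  using P_nonneg by (cases "P = 0") (auto simp: T_def)

lemma \<omega>_sq: "(\<omega> k)\<^sup>2 = 2 * T * r k / (L * D\<^sup>2)"
  using T_nonneg r_nonneg[of k] L by (simp add: \<omega>_def)

lemma \<omega>_nonneg: "\<omega> k \<ge> 0"
  using T_nonneg r_nonneg[of k] L by (simp add: \<omega>_def)

lemma \<omega>_pos: "T > 0 \<Longrightarrow> \<omega> k > 0"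
  using r_pos[of k] L D_pos by (simp add: \<omega>_def)

lemma r_rate:
  assumes "(\<omega> (Suc k))\<^sup>2 \<le> c * (\<omega> k)\<^sup>2" "T > 0"
  shows "r (Suc k) \<le> c * r k"
proof -
  have "2 * T / (L * D\<^sup>2) * r (Suc k) \<le> 2 * T / (L * D\<^sup>2) * (c * r k)"
    using assms(1) by (simp add: \<omega>_sq mult_ac)
  moreover have "2 * T / (L * D\<^sup>2) > 0" using assms(2) L D_pos by simp
  ultimately show ?thesis by (simp only: mult_le_cancel_left_pos)
qed

lemma \<omega>_mono: "k \<le> j \<Longrightarrow> \<omega> j \<le> \<omega> k"
proof -
  assume "k \<le> j"
  then have "r j \<le> r k" by (rule lift_Suc_antimono_le[rotated]) (rule r_Suc)
  then show ?thesis unfolding \<omega>_def using T_nonneg L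
    by (intro real_sqrt_le_mono divide_right_mono mult_left_mono) auto
qed

lemma slope_le_h: "W * slope (x k) \<le> h k"
  by (rule PWidth_slope[OF fin _ active_rep_hull[OF fin rep] gap_le_h]) (auto simp: active_set_def)

text \<open>The KL inequality in terms of \<open>\<omega>\<close>: better constants in the angle
  condition improve the bound \<open>L * D\<^sup>2 * \<omega> \<le> h\<close>
  proportionally.\<close>

lemma h_ge_of_slope:
  assumes "c * slope (x k) \<le> h k" "c \<ge> 0"
  shows "c * (L * D\<^sup>2 * \<omega> k) \<le> W * h k"
proof -
  have "(L * D\<^sup>2 * \<omega> k)\<^sup>2 = W\<^sup>2 * (2 * \<mu> * r k)"
    unfolding power_mult_distrib \<omega>_sq T_def P_def power_divide
    using L D_pos by (simp add: field_simps power2_eq_square)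
  then have "(c * (L * D\<^sup>2 * \<omega> k))\<^sup>2 = c\<^sup>2 * W\<^sup>2 * (2 * \<mu> * r k)"
    by (simp add: power_mult_distrib[of c])
  also have "\<dots> \<le> c\<^sup>2 * W\<^sup>2 * (slope (x k))\<^sup>2"
    using KL[of k] by (intro mult_left_mono) auto
  also have "\<dots> = W\<^sup>2 * (c * slope (x k))\<^sup>2" by (simp add: power_mult_distrib)
  also have "\<dots> \<le> W\<^sup>2 * (h k)\<^sup>2"
    using assms proj_slope_nonneg[of \<Omega> "x k"] by (intro mult_left_mono power_mono) auto
  finally have "(c * (L * D\<^sup>2 * \<omega> k))\<^sup>2 \<le> (W * h k)\<^sup>2" by (simp add: power_mult_distrib)
  then show ?thesis
    by (rule power2_le_imp_le) (rule mult_nonneg_nonneg[OF PWidth_nonneg less_imp_le[OF descent_dir]])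
qed

lemma h_ge: "T > 0 \<Longrightarrow> L * D\<^sup>2 * \<omega> k \<le> h k"
proof -
  assume "T > 0"
  then have "W > 0" using P_pos PWidth_nonneg by (cases "W = 0") (auto simp: P_def)
  moreover have "W * (L * D\<^sup>2 * \<omega> k) \<le> W * h k"
    by (rule h_ge_of_slope[OF slope_le_h PWidth_nonneg])
  ultimately show ?thesis by (simp only: mult_le_cancel_left_pos)
qed

lemma \<omega>_le_h: "T > 0 \<Longrightarrow> \<omega> k \<le> h k / (L * D\<^sup>2)"
  using h_ge[of k] L D_pos by (subst pos_le_divide_eq) (simp_all add: mult_ac)

lemma \<omega>_decrease:
  "(\<omega> (Suc k))\<^sup>2 \<le> (\<omega> k)\<^sup>2 - T * (2 * \<alpha> k * h k / (L * D\<^sup>2) - (\<alpha> k)\<^sup>2 * (norm (d k) / D)\<^sup>2)"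
proof -
  let ?c = "2 * T / (L * D\<^sup>2)"
  have c: "?c \<ge> 0" using T_nonneg L by simp
  have "r (Suc k) \<le> r k - \<alpha> k * h k + L / 2 * (\<alpha> k)\<^sup>2 * (norm (d k))\<^sup>2"
    using decrease[of k] by (simp add: r_def)
  from mult_left_mono[OF this c] show ?thesis
    using L D_pos unfolding \<omega>_sq by (simp add: power_divide field_simps)
qed

lemma \<omega>_decrease_half: "(\<omega> (Suc k))\<^sup>2 \<le> (\<omega> k)\<^sup>2 - T * (\<alpha> k * h k / (L * D\<^sup>2))"
proof -
  let ?c = "2 * T / (L * D\<^sup>2)"
  have c: "?c \<ge> 0" using T_nonneg L by simp
  have "r (Suc k) \<le> r k - \<alpha> k * h k / 2" using decrease_half[of k] by (simp add: r_def)
  from mult_left_mono[OF this c] show ?thesis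
    using L D_pos unfolding \<omega>_sq by (simp add: field_simps)
qed

lemma \<omega>_step: "T > 0 \<Longrightarrow> (\<omega> (Suc k))\<^sup>2 \<le> (\<omega> k)\<^sup>2 - T * \<omega> k * \<alpha> k"
proof -
  assume T: "T > 0"
  have "\<omega> k * \<alpha> k \<le> \<alpha> k * h k / (L * D\<^sup>2)"
    using mult_left_mono[OF \<omega>_le_h[OF T, of k] less_imp_le[OF \<alpha>_pos[of k]]] by (simp add: mult_ac)
  then have "T * (\<omega> k * \<alpha> k) \<le> T * (\<alpha> k * h k / (L * D\<^sup>2))" using T by (intro mult_left_mono) auto
  then show ?thesis using \<omega>_decrease_half[of k] by simp
qed

lemma \<omega>_step_quadratic: "T > 0 \<Longrightarrow> (\<omega> (Suc k))\<^sup>2 \<le> (\<omega> k)\<^sup>2 - T * (2 * \<omega> k * \<alpha> k - (\<alpha> k)\<^sup>2)"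
proof -
  assume T: "T > 0"
  have "\<omega> k * \<alpha> k \<le> \<alpha> k * h k / (L * D\<^sup>2)"
    using mult_left_mono[OF \<omega>_le_h[OF T, of k] less_imp_le[OF \<alpha>_pos[of k]]] by (simp add: mult_ac)
  moreover have "(\<alpha> k)\<^sup>2 * (norm (d k) / D)\<^sup>2 \<le> (\<alpha> k)\<^sup>2 * 1"
    using norm_d_le_D[of k] D_pos by (intro mult_left_mono power_le_one) auto
  ultimately have "2 * \<omega> k * \<alpha> k - (\<alpha> k)\<^sup>2 \<le> 2 * \<alpha> k * h k / (L * D\<^sup>2) - (\<alpha> k)\<^sup>2 * (norm (d k) / D)\<^sup>2"
    by simp
  then have "T * (2 * \<omega> k * \<alpha> k - (\<alpha> k)\<^sup>2) \<le> T * (2 * \<alpha> k * h k / (L * D\<^sup>2) - (\<alpha> k)\<^sup>2 * (norm (d k) / D)\<^sup>2)"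
    using T by (intro mult_left_mono) auto
  then show ?thesis using \<omega>_decrease[of k] by simp
qed

lemma bar_\<alpha>: "bar k \<Longrightarrow> h k / (L * D\<^sup>2) \<le> \<alpha> k"
proof -
  assume "bar k"
  then have "\<alpha> k = h k / (L * (norm (d k))\<^sup>2)" by (simp add: bar_def short_step_def)
  moreover have "h k / (L * D\<^sup>2) \<le> h k / (L * (norm (d k))\<^sup>2)"
    using norm_d_le_D[of k] d_nonzero[of k] descent_dir[of k] L
    by (intro divide_left_mono mult_left_mono power_mono mult_pos_pos) (auto simp: D_pos)
  ultimately show ?thesis by simp
qed

lemma bar_\<alpha>_ge: "T > 0 \<Longrightarrow> bar k \<Longrightarrow> \<omega> k \<le> \<alpha> k"
  using \<omega>_le_h[of k] bar_\<alpha>[of k] by linarith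

lemma bar_\<omega>: "bar k \<Longrightarrow> (\<omega> (Suc k))\<^sup>2 \<le> (\<omega> k)\<^sup>2 - T * (h k / (L * D\<^sup>2))\<^sup>2"
proof -
  assume "bar k"
  have "(h k / (L * D\<^sup>2))\<^sup>2 \<le> \<alpha> k * (h k / (L * D\<^sup>2))"
    unfolding power2_eq_square[of "h k / (L * D\<^sup>2)"] using bar_\<alpha>[OF \<open>bar k\<close>] descent_dir[of k] L
    by (intro mult_right_mono divide_nonneg_nonneg) auto
  then have "T * (h k / (L * D\<^sup>2))\<^sup>2 \<le> T * (\<alpha> k * h k / (L * D\<^sup>2))"
    using T_nonneg by (intro mult_left_mono) auto
  then show ?thesis using \<omega>_decrease_half[of k] by simp
qed

lemma bar_rate: "bar k \<Longrightarrow> r (Suc k) \<le> (1 - T) * r k"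
proof (cases "T = 0")
  case False
  then have T: "T > 0" using T_nonneg by simp
  assume "bar k"
  have "T * (\<omega> k)\<^sup>2 \<le> T * (h k / (L * D\<^sup>2))\<^sup>2"
    using \<omega>_le_h[OF T, of k] \<omega>_nonneg T by (intro mult_left_mono power_mono) auto
  then show ?thesis
    using bar_\<omega>[OF \<open>bar k\<close>] by (intro r_rate[OF _ T]) (simp add: algebra_simps)
qed (use r_Suc in simp)

lemma bar_exists: "\<exists>m\<ge>n. bar m"
  using hop_block by (meson atLeastAtMost_iff)

text \<open>A short step keeps the gap positive.\<close>

lemma T_less_1: "T < 1"
proof -
  obtain m where "bar m" using bar_exists by blast
  then have "0 < (1 - T) * r m" using bar_rate[of m] r_pos[of "Suc m"] by linarith
  then show ?thesis using r_pos[of m] by (simp add: zero_less_mult_iff)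
qed

text \<open>The slope at the new point is at most \<open>L\<close> times the length of the step, and
  by the KL inequality it bounds the new gap.\<close>

lemma full_\<omega>_dist: "full k \<Longrightarrow> (\<omega> (Suc k))\<^sup>2 \<le> P * (\<alpha> k)\<^sup>2 * (norm (d k) / D)\<^sup>2"
proof -
  assume "full k"
  have "2 * \<mu> * r (Suc k) \<le> (L * norm (x (Suc k) - x k))\<^sup>2"
    using KL[of "Suc k"] power_mono[OF full_slope[OF \<open>full k\<close>] proj_slope_nonneg, of 2] by linarith
  also have "\<dots> = L\<^sup>2 * (\<alpha> k)\<^sup>2 * (norm (d k))\<^sup>2" by (simp add: x_Suc power_mult_distrib)
  finally have "P / (L\<^sup>2 * D\<^sup>2) * (2 * \<mu> * r (Suc k)) \<le> P / (L\<^sup>2 * D\<^sup>2) * (L\<^sup>2 * (\<alpha> k)\<^sup>2 * (norm (d k))\<^sup>2)"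
    using P_nonneg by (intro mult_left_mono) auto
  also have "P / (L\<^sup>2 * D\<^sup>2) * (2 * \<mu> * r (Suc k)) = (\<omega> (Suc k))\<^sup>2"
    unfolding \<omega>_sq T_def using L by (simp add: power2_eq_square mult_ac)
  also have "P / (L\<^sup>2 * D\<^sup>2) * (L\<^sup>2 * (\<alpha> k)\<^sup>2 * (norm (d k))\<^sup>2) = P * (\<alpha> k)\<^sup>2 * (norm (d k) / D)\<^sup>2"
    using L by (simp add: power_divide)
  finally show ?thesis .
qed

lemma full_\<omega>: "full k \<Longrightarrow> (\<omega> (Suc k))\<^sup>2 \<le> P * (\<alpha> k)\<^sup>2"
proof -
  assume "full k"
  have "(norm (d k) / D)\<^sup>2 \<le> 1" using norm_d_le_D[of k] D_pos by (intro power_le_one) auto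
  then have "P * (\<alpha> k)\<^sup>2 * (norm (d k) / D)\<^sup>2 \<le> P * (\<alpha> k)\<^sup>2 * 1"
    using P_nonneg by (intro mult_left_mono) auto
  then show ?thesis using full_\<omega>_dist[OF \<open>full k\<close>] by simp
qed

lemma full_r: "full k \<Longrightarrow> (1 + \<mu> / L) * r (Suc k) \<le> r k"
  using full_rate KL \<mu> by blast

text \<open>This applies to hops as well as to short steps.\<close>

lemma rate_of_large_step: "T > 0 \<Longrightarrow> \<omega> k \<le> \<alpha> k \<Longrightarrow> (\<omega> (Suc k))\<^sup>2 \<le> (1 - T) * (\<omega> k)\<^sup>2"
proof -
  assume T: "T > 0" and le: "\<omega> k \<le> \<alpha> k"
  have "T * (\<omega> k * \<omega> k) \<le> T * (\<omega> k * \<alpha> k)" using T le \<omega>_nonneg[of k] by (intro mult_left_mono) auto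
  then show ?thesis using \<omega>_step[OF T, of k] by (simp add: algebra_simps power2_eq_square)
qed

definition "rate_holds \<longleftrightarrow> (\<exists>M>0. \<forall>k. r k \<le> M * (1 - T) ^ count_before (\<lambda>k. bar k \<or> full k) k)"

text \<open>Short steps reach the rate anyway, so only full hops matter.\<close>

lemma rate_holdsI:
  assumes "\<And>k. k \<ge> K \<Longrightarrow> full k \<Longrightarrow> \<not> bar k \<Longrightarrow> r (Suc k) \<le> (1 - T) * r k"
  shows "rate_holds"
  unfolding rate_holds_def
proof (rule rate_from_late_steps[where r = r and q = "1 - T" and K = K])
  fix k assume "K \<le> k" "bar k \<or> full k"
  then show "r (Suc k) \<le> (1 - T) * r k" using assms bar_rate by blast
qed (use r_nonneg r_Suc T_less_1 T_nonneg in auto)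

text \<open>A full step that moves less weight than \<open>\<omega>\<close> leaves a gap of at most
  \<open>P * \<omega>\<^sup>2 \<le> (1 - T) * \<omega>\<^sup>2\<close>.\<close>

lemma rate_holds_small:
  assumes "T + P \<le> 1"
  shows "rate_holds"
proof (rule rate_holdsI[of 0])
  fix k assume "full k"
  show "r (Suc k) \<le> (1 - T) * r k"
  proof (cases "T = 0")
    case False
    then have T: "T > 0" using T_nonneg by simp
    show ?thesis
    proof (rule r_rate[OF _ T])
      show "(\<omega> (Suc k))\<^sup>2 \<le> (1 - T) * (\<omega> k)\<^sup>2"
      proof (cases "\<omega> k \<le> \<alpha> k")
        case False
        then have "(\<alpha> k)\<^sup>2 \<le> (\<omega> k)\<^sup>2" using \<alpha>_pos[of k] by (intro power_mono) auto
        then have "P * (\<alpha> k)\<^sup>2 \<le> (1 - T) * (\<omega> k)\<^sup>2"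
          using assms P_nonneg T_less_1 by (intro mult_mono) auto
        then show ?thesis using full_\<omega>[OF \<open>full k\<close>] by linarith
      qed (rule rate_of_large_step[OF T])
    qed
  qed (use r_Suc in simp)
qed

end

section \<open>Tracking the weights\<close>

lemma eventually_constant_mono:
  fixes F :: "nat \<Rightarrow> 'b set"
  assumes "finite B" "\<And>k. F k \<subseteq> B" "\<And>k. F k \<subseteq> F (Suc k)"
  shows "\<exists>K. \<forall>k\<ge>K. F k = F K"
proof -
  have mono: "F i \<subseteq> F j" if "i \<le> j" for i j using that assms(3) by (rule lift_Suc_mono_le[rotated])
  define m where "m = Max ((\<lambda>k. card (F k)) ` UNIV)"
  have fin: "finite ((\<lambda>k. card (F k)) ` UNIV)"
    by (rule finite_subset[of _ "{0..card B}"]) (use card_mono[OF assms(1,2)] in auto)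
  obtain K where K: "card (F K) = m" using Max_in[OF fin] by (auto simp: m_def)
  have "F k = F K" if "k \<ge> K" for k
  proof -
    have "card (F k) \<le> card (F K)" unfolding K m_def using fin by (intro Max_ge) auto
    then show ?thesis using mono[OF that] assms(1,2) finite_subset card_seteq by metis
  qed
  then show ?thesis by blast
qed

lemma eventually_constant_decreasing_nat:
  fixes F :: "nat \<Rightarrow> nat"
  assumes "\<And>k. k \<ge> K0 \<Longrightarrow> F (Suc k) \<le> F k"
  shows "\<exists>K\<ge>K0. \<forall>k\<ge>K. F k = F K"
proof -
  have mono: "F j \<le> F i" if "K0 \<le> i" "i \<le> j" for i j
    using that(2,1) by (induction j rule: dec_induct) (auto intro: order_trans[OF assms])
  define m where "m = (LEAST n. \<exists>k\<ge>K0. F k = n)"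
  obtain K where K: "K \<ge> K0" "F K = m" using LeastI_ex[of "\<lambda>n. \<exists>k\<ge>K0. F k = n"] by (auto simp: m_def)
  have "F k = F K" if "k \<ge> K" for k
  proof -
    have "\<exists>j\<ge>K0. F j = F k" using that K by (intro exI[of _ k]) auto
    then have "m \<le> F k" unfolding m_def by (rule Least_le)
    then show ?thesis using mono[of K k] K that by auto
  qed
  then show ?thesis using K(1) by blast
qed

context pairwise_KL
begin

text \<open>Let \<open>T \<ge> 3 / 4\<close>. Call a weight good if it is at least \<open>\<beta> *
  \<omega>\<close>. The threshold is chosen such that a short step that takes weight off a good atom
  lowers \<open>\<beta> * \<omega>\<close> by at least as much, so good weights stay good. As short
  steps shrink \<open>\<omega>\<close> by the factor \<open>\<sigma> \<le> 1 / 2\<close>, and so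
  \<open>\<beta> * \<sigma> \<le> 1\<close>, they also make their target good.\<close>

definition "\<sigma> = sqrt (1 - T)"
definition "\<beta> = 1 / (1 - \<sigma>)"
definition "Good k = {a\<in>A. \<beta> * \<omega> k \<le> w k a}"
definition "Bad k = {a\<in>A. 0 < w k a \<and> a \<notin> Good k}"

context
  assumes T34: "T \<ge> 3 / 4"
begin

lemma T0: "T > 0"
  using T34 by simp

lemma \<sigma>: "\<sigma>\<^sup>2 = 1 - T" "0 < \<sigma>" "\<sigma> \<le> 1 / 2" "T = (1 - \<sigma>) * (1 + \<sigma>)"
proof -
  show 1: "\<sigma>\<^sup>2 = 1 - T" "0 < \<sigma>" using T_less_1 by (auto simp: \<sigma>_def)
  show "\<sigma> \<le> 1 / 2" by (rule power2_le_imp_le) (use 1 T34 in \<open>auto simp: power_divide\<close>)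
  show "T = (1 - \<sigma>) * (1 + \<sigma>)" using 1(1) by (simp add: power2_eq_square algebra_simps)
qed

lemma \<beta>: "\<beta> * (1 - \<sigma>) = 1" "1 < \<beta>" "\<beta> \<le> 2" "\<beta> * T = 1 + \<sigma>" "\<beta> * \<sigma> \<le> 1" "\<beta> * \<sigma> = \<beta> - 1"
proof -
  show 1: "\<beta> * (1 - \<sigma>) = 1" using \<sigma> by (simp add: \<beta>_def)
  show "1 < \<beta>" "\<beta> \<le> 2" using \<sigma> by (auto simp: \<beta>_def field_simps)
  show "\<beta> * T = 1 + \<sigma>" using 1 \<sigma>(4) by (metis mult.assoc mult_1)
  show 2: "\<beta> * \<sigma> = \<beta> - 1" using 1 by (simp add: algebra_simps)
  show "\<beta> * \<sigma> \<le> 1" using 2 \<open>\<beta> \<le> 2\<close> by simp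
qed

lemma \<omega>_Suc_pos: "(\<omega> k)\<^sup>2 - T * \<omega> k * \<alpha> k > 0"
proof -
  have "(\<omega> (Suc k))\<^sup>2 > 0" using \<omega>_pos[OF T0, of "Suc k"] by simp
  then show ?thesis using \<omega>_step[OF T0, of k] by linarith
qed

text \<open>Moving a good weight would decrease the gap by more than there is.\<close>

lemma hop_not_good: "\<not> bar k \<Longrightarrow> q k \<notin> Good k"
proof
  assume "\<not> bar k" "q k \<in> Good k"
  then have "\<beta> * \<omega> k \<le> \<alpha> k" using hop by (simp add: Good_def)
  then have "T * \<omega> k * (\<beta> * \<omega> k) \<le> T * \<omega> k * \<alpha> k"
    using T0 \<omega>_pos[OF T0, of k] by (intro mult_left_mono) auto
  moreover have "T * \<omega> k * (\<beta> * \<omega> k) = (1 + \<sigma>) * (\<omega> k)\<^sup>2"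
    using \<beta>(4) by (simp add: power2_eq_square mult_ac flip: \<beta>(4))
  moreover have "\<sigma> * (\<omega> k)\<^sup>2 \<ge> 0" using \<sigma>(2) by simp
  ultimately show False using \<omega>_Suc_pos[of k] by (simp add: algebra_simps)
qed

lemma Good_mono: "Good k \<subseteq> Good (Suc k)"
proof
  fix a assume a: "a \<in> Good k"
  then have aA: "a \<in> A" and wa: "\<beta> * \<omega> k \<le> w k a" by (auto simp: Good_def)
  have \<omega>: "\<beta> * \<omega> (Suc k) \<le> \<beta> * \<omega> k" using \<omega>_mono[of k "Suc k"] \<beta>(2) by simp
  show "a \<in> Good (Suc k)"
  proof (cases "a = q k")
    case False
    then have "w k a \<le> w (Suc k) a" using w_Suc[of k] \<alpha>_pos[of k] by simp
    then show ?thesis using wa \<omega> aA by (simp add: Good_def)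
  next
    case True
    then have bar: "bar k" using hop_not_good a by blast
    have \<alpha>: "\<omega> k \<le> \<alpha> k" by (rule bar_\<alpha>_ge[OF T0 bar])
    have \<omega>0: "\<omega> k > 0" by (rule \<omega>_pos[OF T0])
    have "T * \<alpha> k < \<omega> k" using \<omega>_Suc_pos[of k] \<omega>0 by (simp add: power2_eq_square mult_ac)
    then have "\<beta> * (T * \<alpha> k) \<le> \<beta> * \<omega> k" using \<beta>(2) by (intro mult_left_mono) auto
    moreover have "\<beta> * (T * \<alpha> k) = \<alpha> k + \<sigma> * \<alpha> k" using \<beta>(4) by (metis mult.assoc distrib_right mult_1)
    ultimately have le: "\<alpha> k \<le> \<beta> * \<omega> k" using \<sigma>(2) \<alpha>_pos[of k] by (smt (verit) mult_pos_pos)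
    have b: "\<beta> * (1 + \<sigma>) = 2 * \<beta> - 1" using \<beta>(6) by (simp add: algebra_simps)
    have "(\<beta> * \<omega> (Suc k))\<^sup>2 \<le> (\<beta> * \<omega> k - \<alpha> k)\<^sup>2"
    proof -
      have "\<beta>\<^sup>2 * (\<omega> (Suc k))\<^sup>2 \<le> \<beta>\<^sup>2 * ((\<omega> k)\<^sup>2 - T * \<omega> k * \<alpha> k)"
        by (intro mult_left_mono \<omega>_step[OF T0]) simp
      also have "\<dots> = \<beta>\<^sup>2 * (\<omega> k)\<^sup>2 - \<beta> * (\<beta> * T) * \<omega> k * \<alpha> k" by (simp add: power2_eq_square algebra_simps)
      also have "\<dots> = \<beta>\<^sup>2 * (\<omega> k)\<^sup>2 - 2 * \<beta> * \<omega> k * \<alpha> k + \<omega> k * \<alpha> k"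
        unfolding \<beta>(4) b by (simp add: algebra_simps)
      also have "\<dots> \<le> \<beta>\<^sup>2 * (\<omega> k)\<^sup>2 - 2 * \<beta> * \<omega> k * \<alpha> k + \<alpha> k * \<alpha> k"
        using \<alpha> \<alpha>_pos[of k] by simp
      finally show ?thesis by (simp add: power2_eq_square algebra_simps)
    qed
    then have "\<beta> * \<omega> (Suc k) \<le> \<beta> * \<omega> k - \<alpha> k" by (rule power2_le_imp_le) (use le in simp)
    moreover have "w (Suc k) a = w k a - \<alpha> k" using True w_Suc[of k] s_neq_q[of k] by auto
    ultimately show ?thesis using wa aA by (simp add: Good_def)
  qed
qed

lemma bar_target_good: "bar k \<Longrightarrow> s k \<in> Good (Suc k)"
proof -
  assume bar: "bar k"
  have \<alpha>: "\<omega> k \<le> \<alpha> k" by (rule bar_\<alpha>_ge[OF T0 bar])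
  have "(\<beta> * \<omega> (Suc k))\<^sup>2 \<le> \<beta>\<^sup>2 * ((1 - T) * (\<omega> k)\<^sup>2)"
    unfolding power_mult_distrib by (intro mult_left_mono rate_of_large_step[OF T0 \<alpha>]) simp
  also have "\<dots> = (\<beta> * \<sigma> * \<omega> k)\<^sup>2" by (simp add: power_mult_distrib \<sigma>(1))
  finally have "\<beta> * \<omega> (Suc k) \<le> \<beta> * \<sigma> * \<omega> k"
    by (rule power2_le_imp_le) (use \<beta>(2) \<sigma>(2) \<omega>_nonneg in simp)
  also have "\<dots> \<le> 1 * \<omega> k" using \<beta>(5) \<omega>_nonneg by (intro mult_right_mono) auto
  also have "\<dots> \<le> \<alpha> k" using \<alpha> by simp
  also have "\<dots> \<le> w (Suc k) (s k)" using w_Suc[of k] s_neq_q[of k] w_nonneg[OF s_in] by simp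
  finally show ?thesis using s_in by (simp add: Good_def)
qed

text \<open>A weight that a short step at \<open>k\<close> does not touch, and that is not good
  afterwards, was small already before it.\<close>

lemma bar_bystander:
  assumes "bar k" "a \<in> A" "a \<noteq> q k" "a \<notin> Good (Suc k)"
  shows "w k a < \<beta> * \<sigma> * \<omega> k"
proof -
  have \<alpha>: "\<omega> k \<le> \<alpha> k" by (rule bar_\<alpha>_ge[OF T0 assms(1)])
  have "w k a \<le> w (Suc k) a" using w_Suc[of k] \<alpha>_pos[of k] assms(3) by simp
  also have "\<dots> < \<beta> * \<omega> (Suc k)" using assms(2,4) by (simp add: Good_def)
  also have "\<omega> (Suc k) \<le> \<sigma> * \<omega> k"
    by (rule power2_le_imp_le) (use rate_of_large_step[OF T0 \<alpha>] \<sigma> \<omega>_nonneg in \<open>auto simp: power_mult_distrib\<close>)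
  then have "\<beta> * \<omega> (Suc k) \<le> \<beta> * \<sigma> * \<omega> k" using \<beta>(2) by simp
  finally show ?thesis .
qed

text \<open>Good atoms only increase. Once they are constant, short steps create no bad atom,
  because their target is good, and hops at most replace one bad atom by another. So the number of
  bad atoms is eventually constant too, and then a hop cannot merge its weight with another
  one.\<close>

lemma late_hops:
  obtains K G where "\<And>k. k \<ge> K \<Longrightarrow> Good k = G"
    "\<And>k. k \<ge> K \<Longrightarrow> \<not> bar k \<Longrightarrow> s k \<notin> G \<and> w k (s k) = 0"
proof -
  obtain K0 where K0: "\<And>k. k \<ge> K0 \<Longrightarrow> Good k = Good K0"
    using eventually_constant_mono[OF fin, of Good] Good_mono by (auto simp: Good_def)
  have finB: "finite (Bad k)" for k using fin by (simp add: Bad_def)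
  have hop_Bad: "Bad (Suc k) \<subseteq> insert (s k) (Bad k - {q k})" if "k \<ge> K0" "\<not> bar k" for k
  proof
    fix a assume "a \<in> Bad (Suc k)"
    then have a: "a \<in> A" "0 < w (Suc k) a" "a \<notin> Good k"
      using K0[of k] K0[of "Suc k"] that by (auto simp: Bad_def)
    show "a \<in> insert (s k) (Bad k - {q k})"
    proof (cases "a = s k")
      case False
      have "a \<noteq> q k"
      proof
        assume "a = q k"
        then have "w (Suc k) a = 0" using w_Suc[of k] hop[OF that(2)] s_neq_q[of k] by simp
        then show False using a by simp
      qed
      then show ?thesis using a False w_Suc[of k] by (simp add: Bad_def)
    qed simp
  qed
  have q_Bad: "q k \<in> Bad k" if "\<not> bar k" for k
    using hop_not_good[OF that] q_active[of k] by (auto simp: Bad_def active_set_def)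
  have dec: "card (Bad (Suc k)) \<le> card (Bad k)" if k: "k \<ge> K0" for k
  proof (cases "bar k")
    case True
    have "Bad (Suc k) \<subseteq> Bad k"
    proof
      fix a assume "a \<in> Bad (Suc k)"
      then have a: "a \<in> A" "0 < w (Suc k) a" "a \<notin> Good k" "a \<noteq> s k"
        using K0[of k] K0[of "Suc k"] k bar_target_good[OF True] by (auto simp: Bad_def)
      then have "w (Suc k) a \<le> w k a" using w_Suc[of k] \<alpha>_pos[of k] by simp
      then show "a \<in> Bad k" using a by (simp add: Bad_def)
    qed
    then show ?thesis by (intro card_mono finB)
  next
    case False
    have "card (Bad (Suc k)) \<le> card (insert (s k) (Bad k - {q k}))"
      by (intro card_mono hop_Bad k False) (simp add: finB)
    also have "\<dots> \<le> Suc (card (Bad k - {q k}))" by (rule card_insert_le_m1) (auto simp: finB)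
    also have "\<dots> = card (Bad k)" using q_Bad[OF False] finB by (rule card.remove[symmetric, rotated])
    finally show ?thesis .
  qed
  obtain K where K: "K \<ge> K0" "\<And>k. k \<ge> K \<Longrightarrow> card (Bad k) = card (Bad K)"
    using eventually_constant_decreasing_nat[of K0 "\<lambda>k. card (Bad k)"] dec by auto
  show ?thesis
  proof (rule that[of K "Good K0"])
    show "Good k = Good K0" if "k \<ge> K" for k using K0[of k] that K(1) by simp
    fix k assume k: "k \<ge> K" and nb: "\<not> bar k"
    have k0: "k \<ge> K0" using k K(1) by simp
    show "s k \<notin> Good K0 \<and> w k (s k) = 0"
    proof (rule ccontr)
      assume no: "\<not> ?thesis"
      have "Bad (Suc k) \<subseteq> Bad k - {q k}"
      proof
        fix a assume a: "a \<in> Bad (Suc k)"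
        show "a \<in> Bad k - {q k}"
        proof (cases "a = s k")
          case True
          then have "s k \<notin> Good K0" using a K0[of "Suc k"] k0 by (simp add: Bad_def)
          then have "w k (s k) > 0" using no w_nonneg[OF s_in, of k k] by simp
          then show ?thesis using True s_in s_neq_q[of k] \<open>s k \<notin> Good K0\<close> K0[OF k0] by (simp add: Bad_def)
        qed (use hop_Bad[OF k0 nb] a in auto)
      qed
      then have "card (Bad (Suc k)) < card (Bad k)"
        using q_Bad[OF nb] finB by (intro psubset_card_mono) auto
      then show False using K(2)[of k] K(2)[of "Suc k"] k by simp
    qed
  qed
qed

text \<open>A full step that moves weight \<open>\<alpha>\<close> leads to \<open>\<omega> \<le>
  \<alpha> / 2 \<le> \<alpha> / \<beta>\<close>, so it makes this weight good. Late hops do not do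
  this.\<close>

lemma rate_holds_narrow:
  assumes "P \<le> 1 / 4"
  shows "rate_holds"
proof -
  obtain K G where G: "\<And>k. k \<ge> K \<Longrightarrow> Good k = G"
    and s: "\<And>k. k \<ge> K \<Longrightarrow> \<not> bar k \<Longrightarrow> s k \<notin> G \<and> w k (s k) = 0"
    using late_hops by metis
  show ?thesis
  proof (rule rate_holdsI[of K])
    fix k assume k: "k \<ge> K" "full k" "\<not> bar k"
    have "w (Suc k) (s k) = \<alpha> k" using s[OF k(1,3)] w_Suc[of k] s_neq_q[of k] by simp
    then have "\<alpha> k < \<beta> * \<omega> (Suc k)" using s[OF k(1,3)] G[of "Suc k"] k(1) s_in[of k] by (auto simp: Good_def)
    also have "\<dots> \<le> 2 * \<omega> (Suc k)" using \<beta>(3) \<omega>_nonneg by (intro mult_right_mono) auto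
    also have "\<dots> \<le> \<alpha> k"
    proof (rule power2_le_imp_le)
      have "(\<omega> (Suc k))\<^sup>2 \<le> 1 / 4 * (\<alpha> k)\<^sup>2"
        using full_\<omega>[OF k(2)] mult_right_mono[OF assms, of "(\<alpha> k)\<^sup>2"] by simp
      then show "(2 * \<omega> (Suc k))\<^sup>2 \<le> (\<alpha> k)\<^sup>2" by (simp add: power_mult_distrib)
    qed (use \<alpha>_pos[of k] in simp)
    finally show "r (Suc k) \<le> (1 - T) * r k" by simp
  qed
qed

end

end

section \<open>Polytopes of large pyramidal width\<close>

lemma face_eq_hull_atoms:
  fixes B :: "'a::euclidean_space set"
  assumes "finite B" "G face_of convex hull B"
  shows "G = convex hull (B \<inter> G)"
proof -
  obtain S where S: "S \<subseteq> B" "G = convex hull S"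
    using face_of_convex_hull_subset[OF finite_imp_compact[OF assms(1)] assms(2)] by metis
  have "S \<subseteq> B \<inter> G" using S hull_subset[of S convex] by auto
  then have "G \<subseteq> convex hull (B \<inter> G)" unfolding S(2)[symmetric] using S(2) hull_mono by metis
  moreover have "convex hull (B \<inter> G) \<subseteq> G"
    using assms(2) face_of_imp_convex by (intro hull_minimal) auto
  ultimately show ?thesis by blast
qed

lemma affine_independent_not_in_hull:
  assumes "\<not> affine_dependent B" "C \<subseteq> B" "a \<in> B" "a \<notin> C"
  shows "a \<notin> convex hull C"
proof
  assume "a \<in> convex hull C"
  then have "a \<in> affine hull C" using convex_hull_subset_affine_hull by blast
  moreover have "affine hull C \<subseteq> affine hull (B - {a})" by (rule hull_mono) (use assms in auto)
  ultimately show False using assms(1,3) by (auto simp: affine_dependent_def)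
qed

text \<open>Among the affinely dependent sets of atoms that are all atoms of some face take a
  smallest one, \<open>B\<close>, and a vertex \<open>v\<close> of its face. By minimality the
  barycentre \<open>b\<close> of the other atoms is in the relative interior of the face. The line
  from \<open>v\<close> through \<open>b\<close> leaves the face at a point \<open>y\<close> of a
  proper subface that avoids \<open>v\<close>, and whose atoms are independent. So \<open>b\<close>
  is represented by equal weights on the atoms different from \<open>v\<close>, and by weights on
  \<open>v\<close> and on the subface. Cancelling common weights leaves a point \<open>x\<close> in
  the hull of some atoms which lies between \<open>v\<close> and a point \<open>Y\<close> in the
  hull \<open>Gp\<close> of some atoms of the subface. Both \<open>{v}\<close> and the latter hull
  are faces that are disjoint from the atoms of \<open>x\<close>, so the distances of
  \<open>x\<close> from \<open>v\<close> and \<open>Y\<close> are at least the width, and they add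
  up to at most \<open>D\<close>.\<close>

lemma affine_dependent_PWidth:
  fixes A :: "'a::euclidean_space set"
  assumes fin: "finite A" and dep: "affine_dependent A"
    and D: "\<And>y z. y \<in> convex hull A \<Longrightarrow> z \<in> convex hull A \<Longrightarrow> norm (y - z) \<le> D"
  shows "2 * PWidth A \<le> D"
proof -
  define good where "good B \<longleftrightarrow> B \<subseteq> A \<and> convex hull B face_of convex hull A \<and> affine_dependent B \<and> A \<inter> convex hull B = B" for B
  have "good A" using dep hull_subset[of A convex] by (auto simp: good_def face_of_refl)
  then obtain B where B: "good B" and min: "\<And>B'. card B' < card B \<Longrightarrow> \<not> good B'"
    using ex_has_least_nat[of good A card] by (metis not_less)
  let ?F = "convex hull B"
  have BA: "B \<subseteq> A" "?F face_of convex hull A" "affine_dependent B" "A \<inter> ?F = B" using B by (auto simp: good_def)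
  have finB: "finite B" using BA fin finite_subset by blast
  have cF: "convex ?F" "compact ?F" using finB by (auto simp: compact_convex_hull finite_imp_compact)
  have FA: "?F \<subseteq> convex hull A" using BA(1) by (rule hull_mono)
  have indep: "\<not> affine_dependent (B \<inter> G)" if G: "G face_of ?F" "G \<noteq> ?F" for G
  proof
    assume d: "affine_dependent (B \<inter> G)"
    have GB: "G = convex hull (B \<inter> G)" by (rule face_eq_hull_atoms[OF finB G(1)])
    have "B \<inter> G \<noteq> B" using GB G(2) by auto
    then have "card (B \<inter> G) < card B" using finB by (intro psubset_card_mono) auto
    moreover have "good (B \<inter> G)"
    proof -
      have "G face_of convex hull A" using face_of_trans[OF G(1) BA(2)] .
      moreover have "A \<inter> G = B \<inter> G" using face_of_imp_subset[OF G(1)] BA(4,1) by auto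
      ultimately show ?thesis using d BA(1) GB[symmetric] by (auto simp: good_def)
    qed
    ultimately show False using min by blast
  qed
  have Bns: "B \<noteq> {u}" "B \<noteq> {}" for u using BA(3) by (auto simp: affine_dependent_def)
  obtain v where v: "v extreme_point_of ?F"
    using extreme_point_exists_convex[OF cF(2,1)] Bns(2) by auto
  have vB: "v \<in> B" using v extreme_point_of_convex_hull by blast
  have vF: "v \<in> ?F" using vB by (rule hull_inc)
  have v_pf: "{v} \<in> pfaces (convex hull A)"
  proof -
    have "{v} face_of convex hull A"
      by (rule face_of_trans[OF _ BA(2)]) (use v in \<open>simp add: face_of_singleton\<close>)
    moreover have "{v} \<noteq> convex hull A"
    proof
      assume "{v} = convex hull A"
      then have "B \<subseteq> {v}" using BA(1) hull_subset[of A convex] by simp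
      then show False using Bns(1)[of v] Bns(2) by (metis subset_singletonD)
    qed
    ultimately show ?thesis by (simp add: pfaces_def)
  qed
  define R where "R = B - {v}"
  have R: "finite R" "R \<subseteq> B" "v \<notin> R" "B = insert v R" using finB vB by (auto simp: R_def)
  have R0: "R \<noteq> {}" using R(4) Bns(1) by auto
  define n where "n = real (card R)"
  have n: "n \<ge> 1" using R0 R(1) by (simp add: n_def Suc_le_eq card_gt_0_iff)
  define b where "b = (\<Sum>a\<in>R. (1 / n) *\<^sub>R a)"
  have bR: "b \<in> convex hull R" unfolding b_def
    by (rule convex_sum[OF R(1) convex_convex_hull]) (use n in \<open>auto simp: n_def intro: hull_inc\<close>)
  have bF: "b \<in> ?F" using bR hull_mono[OF R(2)] by blast
  have minF: "min_face ?F b = ?F"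
  proof (rule ccontr)
    let ?G = "min_face ?F b"
    assume ne: "?G \<noteq> ?F"
    have G: "?G face_of ?F" by (rule min_face_face_of[OF cF(1) bF])
    have RG: "R \<subseteq> ?G"
    proof
      fix a assume a: "a \<in> R"
      have ba: "b = (1 / n) *\<^sub>R a + (\<Sum>c\<in>R - {a}. (1 / n) *\<^sub>R c)"
        unfolding b_def using sum.remove[OF R(1) a] by simp
      show "a \<in> ?G"
      proof (cases "n = 1")
        case True
        then have "card (R - {a}) = 0" using a R(1) by (simp add: n_def)
        then have "R - {a} = {}" using R(1) by simp
        then have "b = a" using ba True by (simp only: sum.empty) simp
        then show ?thesis using mem_min_face by metis
      next
        case False
        then have n1: "n > 1" using n by simp
        define y where "y = (\<Sum>c\<in>R - {a}. (1 / (n - 1)) *\<^sub>R c)"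
        have "real (card (R - {a})) = n - 1" using a R(1) R0 by (simp add: n_def of_nat_diff Suc_le_eq card_gt_0_iff)
        then have "y \<in> convex hull R" unfolding y_def using n1 R(1)
          by (intro convex_sum[OF _ convex_convex_hull]) (auto intro: hull_inc)
        then have y: "y \<in> ?F" using hull_mono[OF R(2)] by blast
        have "(1 - 1 / n) *\<^sub>R y = (\<Sum>c\<in>R - {a}. (1 / n) *\<^sub>R c)"
          unfolding y_def scaleR_sum_right using n1 by (intro sum.cong) (auto simp: field_simps)
        then have bay: "b = (1 - (1 - 1 / n)) *\<^sub>R a + (1 - 1 / n) *\<^sub>R y" using ba by simp
        show ?thesis
        proof (cases "a = y")
          case True
          then have "b = a" using bay by (simp add: scaleR_left_diff_distrib)
          then show ?thesis using mem_min_face by metis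
        next
          case False
          then have "b \<in> open_segment a y"
            unfolding in_segment using bay n1 by (intro conjI exI[of _ "1 - 1 / n"]) auto
          moreover have "a \<in> ?F" using a R(2) by (auto intro: hull_inc)
          ultimately show ?thesis using face_ofD[OF G _ _ y mem_min_face] by blast
        qed
      qed
    qed
    have vG: "v \<notin> ?G"
    proof
      assume "v \<in> ?G"
      then have "B \<subseteq> ?G" using RG R(4) by auto
      then have "?F \<subseteq> ?G" using G face_of_imp_convex by (intro hull_minimal) auto
      then show False using ne face_of_imp_subset[OF G] by auto
    qed
    have "\<not> affine_dependent R"
      using indep[OF G ne] RG R(2) affine_independent_subset[of "B \<inter> ?G" R] by auto
    moreover have "v \<notin> affine hull R"
    proof
      assume "v \<in> affine hull R"
      then have "v \<in> affine hull ?G" using hull_mono[OF RG] by blast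
      then show False using face_of_imp_eq_affine_Int[OF cF(1) G] vF vG by auto
    qed
    ultimately show False using affine_independent_insert BA(3) R(4) by metis
  qed
  have b_int: "b \<in> rel_interior ?F" using mem_rel_interior_min_face[OF cF(1) bF] minF by simp
  have bv: "b \<noteq> v"
  proof
    assume "b = v"
    then have "?F = {v}" using extreme_point_not_in_REL_INTERIOR[OF v] b_int by auto
    then show False using Bns hull_subset[of B convex] by auto
  qed
  \<comment> \<open>The exit point \<open>y\<close> of the line from \<open>v\<close> through
    \<open>b\<close> belongs to the largest of these parameters.\<close>
  define Tl where "Tl = {l. 0 \<le> l \<and> v + l *\<^sub>R (b - v) \<in> ?F}"
  have "Tl = {0..} \<inter> (\<lambda>l. v + l *\<^sub>R (b - v)) -` ?F" by (auto simp: Tl_def)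
  moreover have "closed ((\<lambda>l::real. v + l *\<^sub>R (b - v)) -` ?F)"
    by (rule closed_vimage[OF compact_imp_closed[OF cF(2)]]) (intro continuous_intros)
  ultimately have clT: "closed Tl" by auto
  have bdT: "bdd_above Tl"
  proof (rule bdd_aboveI)
    fix l assume l: "l \<in> Tl"
    then have "norm (v + l *\<^sub>R (b - v) - v) \<le> D" using FA vF by (intro D) (auto simp: Tl_def)
    then have "l * norm (b - v) \<le> D" using l unfolding Tl_def by (simp del: scaleR_diff_right add: scaleR_right_diff_distrib[symmetric])
    then show "l \<le> D / norm (b - v)" using bv by (simp add: pos_le_divide_eq)
  qed
  define \<kappa> where "\<kappa> = Sup Tl"
  have lT: "\<kappa> \<in> Tl" unfolding \<kappa>_def
    by (rule closed_contains_Sup) (use clT bdT vF in \<open>auto simp: Tl_def intro!: exI[of _ "0::real"]\<close>)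
  have lmax: "l \<le> \<kappa>" if "l \<in> Tl" for l unfolding \<kappa>_def using bdT that by (rule cSup_upper[rotated])
  obtain e where e: "e > 1" "(1 - e) *\<^sub>R v + e *\<^sub>R b \<in> ?F"
    using b_int convex_rel_interior_iff[OF cF(1)] vF by blast
  have "(1 - e) *\<^sub>R v + e *\<^sub>R b = v + e *\<^sub>R (b - v)" by (simp add: algebra_simps)
  then have "e \<in> Tl" using e by (auto simp: Tl_def)
  then have l1: "\<kappa> > 1" using lmax e(1) by force
  define y where "y = v + \<kappa> *\<^sub>R (b - v)"
  have yF: "y \<in> ?F" using lT by (simp add: Tl_def y_def)
  let ?G2 = "min_face ?F y"
  have G2: "?G2 face_of ?F" by (rule min_face_face_of[OF cF(1) yF])
  have vG2: "v \<notin> ?G2"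
  proof
    assume "v \<in> ?G2"
    then obtain e' y' where e': "0 < e'" "e' < 1" "y' \<in> ?G2" "y = e' *\<^sub>R v + (1 - e') *\<^sub>R y'"
      using min_face_split[OF cF(1) yF] by blast
    have "(1 - e') *\<^sub>R (y' - v) = y - v" using e'(4) by (simp add: algebra_simps)
    also have "\<dots> = (1 - e') *\<^sub>R ((\<kappa> / (1 - e')) *\<^sub>R (b - v))"
      unfolding y_def scaleR_scaleR using e'(1,2) by simp
    finally have "y' - v = (\<kappa> / (1 - e')) *\<^sub>R (b - v)" unfolding scaleR_cancel_left using e' by simp
    then have "y' = v + (\<kappa> / (1 - e')) *\<^sub>R (b - v)" by (simp only: diff_eq_eq add.commute)
    then have "\<kappa> / (1 - e') \<in> Tl" using e' l1 face_of_imp_subset[OF G2] by (auto simp: Tl_def)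
    then have "\<kappa> / (1 - e') \<le> \<kappa>" by (rule lmax)
    then show False using e' l1 by (simp add: divide_le_eq mult_le_cancel_left1)
  qed
  then have G2ne: "?G2 \<noteq> ?F" using vF by blast
  define B2 where "B2 = B \<inter> ?G2"
  have B2: "B2 \<subseteq> R" "finite B2" "\<not> affine_dependent B2" "?G2 = convex hull B2"
    using vG2 R(4) finB indep[OF G2 G2ne] face_eq_hull_atoms[OF finB G2] by (auto simp: B2_def)
  obtain yy where yy: "\<And>g. g \<in> B2 \<Longrightarrow> 0 \<le> yy g" "sum yy B2 = 1" "(\<Sum>g\<in>B2. yy g *\<^sub>R g) = y"
    using mem_min_face[of y ?F] unfolding B2(4) convex_hull_finite[OF B2(2)] by auto
  define \<theta> where "\<theta> = 1 - 1 / \<kappa>"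
  have \<theta>: "0 < \<theta>" "\<theta> < 1" using l1 by (auto simp: \<theta>_def)
  have b_eq: "b = \<theta> *\<^sub>R v + (1 - \<theta>) *\<^sub>R y" using l1 by (simp add: \<theta>_def y_def algebra_simps)
  define z where "z a = (if a \<in> B2 then (1 - \<theta>) * yy a else 0)" for a
  \<comment> \<open>Where the weights of the representation through \<open>y\<close> exceed the
    equal weights \<open>1 / n\<close>.\<close>
  define Gp where "Gp = {a\<in>R. 1 / n < z a}"
  define J where "J = R - Gp"
  have Gp: "Gp \<subseteq> B2" "Gp \<subseteq> R" "finite Gp" "finite J"
    using n R(1) by (auto simp: Gp_def J_def z_def split: if_splits)
  have sz: "sum z R = 1 - \<theta>" "(\<Sum>a\<in>R. z a *\<^sub>R a) = (1 - \<theta>) *\<^sub>R y"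
  proof -
    have "sum z R = (\<Sum>a\<in>B2. (1 - \<theta>) * yy a)"
      by (rule sum.mono_neutral_cong_right[OF R(1) B2(1)]) (auto simp: z_def)
    then show "sum z R = 1 - \<theta>" using yy(2) by (simp flip: sum_distrib_left)
    have "(\<Sum>a\<in>R. z a *\<^sub>R a) = (\<Sum>a\<in>B2. ((1 - \<theta>) * yy a) *\<^sub>R a)"
      by (rule sum.mono_neutral_cong_right[OF R(1) B2(1)]) (auto simp: z_def)
    then show "(\<Sum>a\<in>R. z a *\<^sub>R a) = (1 - \<theta>) *\<^sub>R y" using yy(3) by (simp flip: scaleR_sum_right scaleR_scaleR)
  qed
  define s where "s = (\<Sum>a\<in>J. 1 / n - z a)"
  have split: "(\<Sum>a\<in>R. F a) = (\<Sum>a\<in>Gp. F a) + (\<Sum>a\<in>J. F a)" for F :: "'a \<Rightarrow> 'c::comm_monoid_add"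
    unfolding J_def using sum.subset_diff[OF Gp(2) R(1), of F] by (simp add: add.commute)
  define c where "c = (\<Sum>a\<in>Gp. z a - 1 / n)"
  have "(\<Sum>a\<in>R. 1 / n - z a) = \<theta>" using sz(1) n by (simp add: sum_subtractf n_def)
  then have s_eq: "s = \<theta> + c" using split[of "\<lambda>a. 1 / n - z a"] by (simp add: s_def c_def sum_subtractf)
  have c0: "c \<ge> 0" unfolding c_def by (rule sum_nonneg) (auto simp: Gp_def)
  have s0: "s > 0" using s_eq c0 \<theta> by simp
  define x where "x = (\<Sum>a\<in>J. ((1 / n - z a) / s) *\<^sub>R a)"
  have xJ: "x \<in> convex hull J" unfolding x_def
    by (rule convex_sum[OF Gp(4) convex_convex_hull])
      (use s0 in \<open>auto simp: J_def Gp_def s_def intro!: hull_inc divide_nonneg_pos simp flip: sum_divide_distrib\<close>)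
  have "(\<Sum>a\<in>R. (1 / n - z a) *\<^sub>R a) = \<theta> *\<^sub>R v"
    using sz(2) b_eq by (simp add: scaleR_left_diff_distrib sum_subtractf b_def)
  then have "(\<Sum>a\<in>J. (1 / n - z a) *\<^sub>R a) = \<theta> *\<^sub>R v + (\<Sum>a\<in>Gp. (z a - 1 / n) *\<^sub>R a)"
    using split[of "\<lambda>a. (1 / n - z a) *\<^sub>R a"] by (simp add: scaleR_left_diff_distrib sum_subtractf algebra_simps)
  moreover have "s *\<^sub>R x = (\<Sum>a\<in>J. (1 / n - z a) *\<^sub>R a)" unfolding x_def scaleR_sum_right using s0 by simp
  ultimately have sx: "s *\<^sub>R x = \<theta> *\<^sub>R v + (\<Sum>a\<in>Gp. (z a - 1 / n) *\<^sub>R a)" by simp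
  have "J \<subseteq> A - {v}" using R BA(1) by (auto simp: J_def)
  then have "x \<in> convex hull (A - {v})" using xJ hull_mono by blast
  then have W1: "PWidth A \<le> norm (v - x)" by (intro PWidth_le[OF fin v_pf]) auto
  show ?thesis
  proof (cases "Gp = {}")
    case True
    then have "s *\<^sub>R x = s *\<^sub>R v" using sx s_eq by (simp add: c_def)
    then have "x = v" using s0 by simp
    moreover have "0 \<le> D" using D[of v v] vF FA by auto
    ultimately show ?thesis using W1 by simp
  next
    case False
    have c: "c > 0" unfolding c_def using False Gp(3) by (intro sum_pos) (auto simp: Gp_def)
    define Y where "Y = (\<Sum>a\<in>Gp. ((z a - 1 / n) / c) *\<^sub>R a)"
    have YG: "Y \<in> convex hull Gp" unfolding Y_def
      by (rule convex_sum[OF Gp(3) convex_convex_hull])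
        (use c in \<open>auto simp: Gp_def c_def intro!: hull_inc divide_nonneg_pos simp flip: sum_divide_distrib\<close>)
    have "c *\<^sub>R Y = (\<Sum>a\<in>Gp. (z a - 1 / n) *\<^sub>R a)" unfolding Y_def scaleR_sum_right using c by simp
    then have sxY: "s *\<^sub>R x = \<theta> *\<^sub>R v + c *\<^sub>R Y" using sx by simp
    have "convex hull Gp face_of ?G2"
      unfolding B2(4) using face_of_convex_hull_affine_independent[OF B2(3)] Gp(1) by blast
    then have fG: "convex hull Gp face_of convex hull A" using G2 BA(2) face_of_trans by blast
    have "v \<notin> convex hull Gp" using vG2 B2(4) hull_mono[OF Gp(1)] by blast
    then have G_pf: "convex hull Gp \<in> pfaces (convex hull A)" using fG False vF FA by (auto simp: pfaces_def)
    have "J \<subseteq> A - convex hull Gp"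
    proof
      fix a assume a: "a \<in> J"
      then have aR: "a \<in> R" "a \<notin> Gp" by (auto simp: J_def)
      have "a \<notin> convex hull Gp"
      proof
        assume a': "a \<in> convex hull Gp"
        then have "a \<in> B2" using aR R(2) B2(4) hull_mono[OF Gp(1)] by (auto simp: B2_def)
        then show False using affine_independent_not_in_hull[OF B2(3) Gp(1) _ aR(2)] a' by blast
      qed
      then show "a \<in> A - convex hull Gp" using aR R(2) BA(1) by auto
    qed
    then have "x \<in> convex hull (A - convex hull Gp)" using xJ hull_mono by blast
    then have W2: "PWidth A \<le> norm (Y - x)" by (rule PWidth_le[OF fin G_pf YG])
    have "s *\<^sub>R (v - x) = c *\<^sub>R (v - Y)" "s *\<^sub>R (Y - x) = \<theta> *\<^sub>R (Y - v)"
      using sxY by (simp_all add: scaleR_diff_right s_eq algebra_simps)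
    then have "s * norm (v - x) = c * norm (v - Y)" "s * norm (Y - x) = \<theta> * norm (v - Y)"
      using s0 c \<theta> by (metis abs_of_pos norm_scaleR, metis abs_of_pos norm_scaleR norm_minus_commute)
    then have "s * (norm (v - x) + norm (Y - x)) = s * norm (v - Y)" by (simp add: s_eq algebra_simps)
    then have "norm (v - x) + norm (Y - x) = norm (v - Y)" using s0 by simp
    moreover have "norm (v - Y) \<le> D"
      using YG Gp R(2) BA(1) hull_mono[of Gp A convex] FA vF by (intro D) auto
    ultimately show ?thesis using W1 W2 by linarith
  qed
qed

text \<open>In a simplex every set of atoms spans a face, so the width bounds the distance of
  opposite faces.\<close>

lemma simplex_partition_width:
  assumes "finite A" "\<not> affine_dependent A" "B \<subseteq> A" "B \<noteq> A"
    and y: "y \<in> convex hull B" and z: "z \<in> convex hull (A - B)"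
  shows "PWidth A \<le> norm (y - z)"
proof (rule PWidth_le[OF assms(1) _ y])
  have out: "a \<notin> convex hull B" if "a \<in> A - B" for a
    using affine_independent_not_in_hull[OF assms(2,3)] that by auto
  obtain a where a: "a \<in> A - B" using assms(3,4) by auto
  have "convex hull B \<noteq> convex hull A" using out[OF a] a hull_inc[of a A convex] by auto
  moreover have "convex hull B face_of convex hull A"
    using face_of_convex_hull_affine_independent[OF assms(2)] assms(3) by metis
  ultimately show "convex hull B \<in> pfaces (convex hull A)" using y by (auto simp: pfaces_def)
  have "A - convex hull B = A - B" using out hull_inc[of _ B convex] by auto
  then show "z \<in> convex hull (A - convex hull B)" using z by simp
qed

text \<open>Of the six edges between four vertices, two opposite ones have midpoints at distance at
  least the width. The squares of the three such distances add up to a quarter of the sum of the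
  squared edges.\<close>

lemma simplex_width_four:
  fixes A :: "'a::euclidean_space set"
  assumes fin: "finite A" and indep: "\<not> affine_dependent A" and four: "card A \<ge> 4"
    and D: "\<And>y z. y \<in> A \<Longrightarrow> z \<in> A \<Longrightarrow> norm (y - z) \<le> D" and W: "0 \<le> PWidth A"
  shows "2 * (PWidth A)\<^sup>2 \<le> D\<^sup>2"
proof -
  obtain B where B: "B \<subseteq> A" "card B = 4" using obtain_subset_with_card_n[OF four] by metis
  obtain C where C: "C \<subseteq> B" "card C = 2" using obtain_subset_with_card_n[of 2 B] B(2) by auto
  have finB: "finite B" using B(1) fin finite_subset by blast
  have "card (B - C) = 2" using B C finB by (simp add: card_Diff_subset finite_subset)
  then obtain c e where ce: "B - C = {c, e}" "c \<noteq> e" by (auto simp: card_2_iff)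
  obtain a b where ab: "C = {a, b}" "a \<noteq> b" using C(2) by (auto simp: card_2_iff)
  have abce: "a \<in> A" "b \<in> A" "c \<in> A" "e \<in> A" "a \<noteq> c" "a \<noteq> e" "b \<noteq> c" "b \<noteq> e"
    using ab ce B(1) C(1) by auto
  have mid: "4 * (PWidth A)\<^sup>2 \<le> (norm (a + b - c - e))\<^sup>2"
    if "a \<in> A" "b \<in> A" "c \<in> A" "e \<in> A" "a \<noteq> c" "a \<noteq> e" "b \<noteq> c" "b \<noteq> e" for a b c e :: 'a
  proof -
    have "PWidth A \<le> norm (midpoint a b - midpoint c e)"
    proof (rule simplex_partition_width[OF fin indep])
      show "{a, b} \<subseteq> A" "{a, b} \<noteq> A" using that by auto
      show "midpoint a b \<in> convex hull {a, b}" using midpoint_in_closed_segment segment_convex_hull by metis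
      have "midpoint c e \<in> convex hull {c, e}" using midpoint_in_closed_segment segment_convex_hull by metis
      moreover have "{c, e} \<subseteq> A - {a, b}" using that by auto
      ultimately show "midpoint c e \<in> convex hull (A - {a, b})" using hull_mono by blast
    qed
    also have "midpoint a b - midpoint c e = (1 / 2) *\<^sub>R (a + b - c - e)"
      by (simp add: midpoint_def algebra_simps)
    also have "norm \<dots> = norm (a + b - c - e) / 2" by simp
    finally have "2 * PWidth A \<le> norm (a + b - c - e)" by simp
    from power_mono[OF this, of 2] W show ?thesis by (simp add: power_mult_distrib)
  qed
  have D2: "(norm (y - z))\<^sup>2 \<le> D\<^sup>2" if "y \<in> A" "z \<in> A" for y z
    using D[OF that] by (intro power_mono) auto
  have "(norm (a + b - c - e))\<^sup>2 + (norm (a + c - b - e))\<^sup>2 + (norm (a + e - b - c))\<^sup>2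
      = (norm (a - b))\<^sup>2 + (norm (a - c))\<^sup>2 + (norm (a - e))\<^sup>2 + (norm (b - c))\<^sup>2
        + (norm (b - e))\<^sup>2 + (norm (c - e))\<^sup>2"
    by (simp add: power2_norm_eq_inner inner_diff_left inner_diff_right inner_add_left inner_add_right inner_commute)
  then show ?thesis
    using mid[of a b c e] mid[of a c b e] mid[of a e b c] abce ab ce
      D2[of a b] D2[of a c] D2[of a e] D2[of b c] D2[of b e] D2[of c e] by auto
qed

text \<open>In terms of \<open>v = \<tau>\<^sup>2\<close> and after removing the common factor
  \<open>2 * \<tau> - 1\<close>, this is an inequality of polynomials in \<open>v\<close> up to one
  occurrence of \<open>\<tau>\<close>, which is replaced by a tangent near \<open>sqrt (1 /
  2)\<close>. There the inequality is tightest.\<close>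

lemma altitude_polynomial:
  fixes \<tau> :: real
  assumes "1 / 2 \<le> \<tau>" "2 * \<tau>\<^sup>2 \<le> 1"
  shows "(\<tau>\<^sup>2 + 1 / 4)\<^sup>2 * (1 - (2 * \<tau> - 1) * (2 - 2 * \<tau>) * \<tau>\<^sup>2) \<le> \<tau>\<^sup>2"
proof -
  define v where "v = \<tau>\<^sup>2"
  have v: "1 / 4 \<le> v" "v \<le> 1 / 2"
    using assms power_mono[of "1/2" \<tau> 2] by (auto simp: v_def power_divide)
  have "0 \<le> (\<tau> - 7072 / 10000)\<^sup>2" by simp
  then have t: "2 * 7072 / 10000 * \<tau> \<le> v + (7072 / 10000)\<^sup>2" by (simp add: v_def power2_eq_square algebra_simps)
  then have t3: "2 * v + 3 * \<tau> + 1 \<le> 8243 / 2000 * v + 2061 / 1000" using v by (simp add: power2_eq_square)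
  have "(4 * v - 1) * ((2 * \<tau> + 1) * (1 + \<tau>)) = (4 * v - 1) * (2 * v + 3 * \<tau> + 1)"
    by (simp add: v_def power2_eq_square algebra_simps)
  also have "\<dots> \<le> (4 * v - 1) * (8243 / 2000 * v + 2061 / 1000)" using t3 v by (intro mult_left_mono) auto
  also have "\<dots> \<le> (1 / 4 + v / 2) * (4 * v + 1)\<^sup>2"
  proof -
    have "0 \<le> (v - 1 / 2)\<^sup>2 * (v + 1)" using v by simp
    also have "\<dots> = v ^ 3 - 3 / 4 * v + 1 / 4" by (simp add: power2_eq_square power3_eq_cube field_simps)
    finally have "v ^ 3 \<ge> 3 / 4 * v - 1 / 4" by simp
    moreover have "0 \<le> (v - 1 / 4) * (1 / 2 - v)" using v by simp
    then have "v\<^sup>2 \<le> 3 / 4 * v - 1 / 8" by (simp add: power2_eq_square algebra_simps)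
    ultimately have "0 \<le> 8 * v ^ 3 - 4243 / 500 * v\<^sup>2 - 649 / 400 * v + 2311 / 1000" using v by linarith
    also have "8 * v ^ 3 - 4243 / 500 * v\<^sup>2 - 649 / 400 * v + 2311 / 1000
        = (1 / 4 + v / 2) * (4 * v + 1)\<^sup>2 - (4 * v - 1) * (8243 / 2000 * v + 2061 / 1000)"
      by (simp add: power2_eq_square power3_eq_cube field_simps)
    finally show ?thesis by simp
  qed
  also have "\<dots> \<le> (2 * v * (1 - v)) * (4 * v + 1)\<^sup>2"
  proof (rule mult_right_mono)
    have "0 \<le> (v - 1 / 4) * (1 / 2 - v)" using v by simp
    then show "1 / 4 + v / 2 \<le> 2 * v * (1 - v)" by (simp add: algebra_simps)
  qed simp
  also have "2 * v * (1 - v) * (4 * v + 1)\<^sup>2 = (2 * v * (1 - \<tau>) * (4 * v + 1)\<^sup>2) * (1 + \<tau>)"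
    by (simp add: v_def power2_eq_square algebra_simps)
  finally have "(4 * v - 1) * (2 * \<tau> + 1) * (1 + \<tau>) \<le> (2 * v * (1 - \<tau>) * (4 * v + 1)\<^sup>2) * (1 + \<tau>)"
    by (simp only: mult.assoc)
  then have "(4 * v - 1) * (2 * \<tau> + 1) \<le> 2 * v * (1 - \<tau>) * (4 * v + 1)\<^sup>2"
    by (rule mult_right_le_imp_le) (use assms in simp)
  from mult_left_mono[OF this, of "2 * \<tau> - 1"]
  have "(2 * \<tau> - 1) * ((4 * v - 1) * (2 * \<tau> + 1)) \<le> (2 * \<tau> - 1) * (2 * v * (1 - \<tau>) * (4 * v + 1)\<^sup>2)"
    using assms by simp
  moreover have "(2 * \<tau> - 1) * ((4 * v - 1) * (2 * \<tau> + 1)) = (4 * v + 1)\<^sup>2 - 16 * v"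
    by (simp add: v_def power2_eq_square algebra_simps)
  moreover have "(2 * \<tau> - 1) * (2 * v * (1 - \<tau>) * (4 * v + 1)\<^sup>2)
     = 16 * ((v + 1 / 4)\<^sup>2 * ((2 * \<tau> - 1) * (2 - 2 * \<tau>) * v))"
    by (simp add: power2_eq_square algebra_simps)
  moreover have "(4 * v + 1)\<^sup>2 = 16 * (v + 1 / 4)\<^sup>2" by (simp add: power2_eq_square algebra_simps)
  ultimately have "16 * (v + 1 / 4)\<^sup>2 - 16 * v \<le> 16 * ((v + 1 / 4)\<^sup>2 * ((2 * \<tau> - 1) * (2 - 2 * \<tau>) * v))"
    by metis
  then have "(v + 1 / 4)\<^sup>2 * (1 - (2 * \<tau> - 1) * (2 - 2 * \<tau>) * v) \<le> v"
    unfolding right_diff_distrib by simp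
  then show ?thesis by (simp only: v_def)
qed

section \<open>Altitudes of simplices\<close>

text \<open>The foot \<open>p\<close> of the altitude of \<open>q\<close> divides the side from \<open>r\<close> to \<open>y\<close>; comparing two formulas for
  the area gives the distance of \<open>y\<close> from the side opposite to it.\<close>

lemma triangle_altitudes:
  fixes q r y p :: "'a::real_inner"
  assumes \<beta>: "0 < \<beta>" "\<beta> < 1" and p: "p = \<beta> *\<^sub>R r + (1 - \<beta>) *\<^sub>R y" and orth: "(q - p) \<bullet> (r - y) = 0"
    and H: "\<beta> * (1 - \<beta>) * (norm (r - y))\<^sup>2 \<le> (norm (q - p))\<^sup>2" "q \<noteq> p"
  obtains z where "z \<in> closed_segment q r"
    "(norm (y - z))\<^sup>2 * (norm (q - r))\<^sup>2 = (norm (r - y))\<^sup>2 * (norm (q - p))\<^sup>2"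
proof -
  define k e where "k = q - p" and "e = r - y"
  define m2 H2 where "m2 = (norm e)\<^sup>2" and "H2 = (norm k)\<^sup>2"
  have ke: "k \<bullet> e = 0" using orth by (simp add: k_def e_def)
  have lin: "(norm (a *\<^sub>R e + b *\<^sub>R k))\<^sup>2 = a\<^sup>2 * m2 + b\<^sup>2 * H2" for a b
    using ke by (simp add: m2_def H2_def power2_norm_eq_inner inner_add_left inner_add_right inner_commute
        power2_eq_square[of a] power2_eq_square[of b])
  define N where "N = (1 - \<beta>)\<^sup>2 * m2 + H2"
  have "q - r = (- (1 - \<beta>)) *\<^sub>R e + 1 *\<^sub>R k" by (simp add: k_def e_def p algebra_simps)
  then have N: "(norm (q - r))\<^sup>2 = N" using lin[of "- (1 - \<beta>)" 1] by (simp add: N_def power2_commute)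
  have H2: "H2 > 0" using H(2) by (simp add: H2_def k_def)
  have m2: "m2 \<ge> 0" by (simp add: m2_def)
  have N0: "N > 0" using H2 m2 by (simp add: N_def add_nonneg_pos)
  define \<theta> where "\<theta> = (H2 - \<beta> * (1 - \<beta>) * m2) / N"
  have t1: "1 - \<theta> = (1 - \<beta>) * m2 / N"
    using N0 unfolding \<theta>_def by (simp add: field_simps) (simp add: N_def power2_eq_square algebra_simps)
  have t2: "\<beta> + \<theta> * (1 - \<beta>) = H2 / N"
    using N0 unfolding \<theta>_def by (simp add: field_simps) (simp add: N_def power2_eq_square algebra_simps)
  have \<theta>: "0 \<le> \<theta>" "\<theta> \<le> 1"
  proof -
    show "0 \<le> \<theta>" using H(1) N0 by (simp add: \<theta>_def H2_def m2_def k_def e_def)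
    have "1 - \<theta> \<ge> 0" unfolding t1 using \<beta> m2 N0 by simp
    then show "\<theta> \<le> 1" by simp
  qed
  show ?thesis
  proof (rule that)
    show "(1 - \<theta>) *\<^sub>R q + \<theta> *\<^sub>R r \<in> closed_segment q r" using \<theta> by (auto simp: closed_segment_def)
    have "y - ((1 - \<theta>) *\<^sub>R q + \<theta> *\<^sub>R r) = (- (\<beta> + \<theta> * (1 - \<beta>))) *\<^sub>R e + (- (1 - \<theta>)) *\<^sub>R k"
      by (simp add: k_def e_def p algebra_simps)
    then have "(norm (y - ((1 - \<theta>) *\<^sub>R q + \<theta> *\<^sub>R r)))\<^sup>2 = (\<beta> + \<theta> * (1 - \<beta>))\<^sup>2 * m2 + (1 - \<theta>)\<^sup>2 * H2"
      by (simp only: lin power2_minus)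
    also have "\<dots> = (H2 * m2 * N) / N\<^sup>2" unfolding t1 t2
      by (simp add: power_divide power_mult_distrib N_def add_divide_distrib[symmetric]) (simp add: power2_eq_square algebra_simps)
    also have "\<dots> = H2 * m2 / N" using N0 by (simp add: power2_eq_square)
    finally show "(norm (y - ((1 - \<theta>) *\<^sub>R q + \<theta> *\<^sub>R r)))\<^sup>2 * (norm (q - r))\<^sup>2 = (norm (r - y))\<^sup>2 * (norm (q - p))\<^sup>2"
      unfolding N using N0 by (simp add: m2_def H2_def k_def e_def)
  qed
qed

text \<open>The foot \<open>p\<close> of the altitude of \<open>q\<close> lies in the relative
  interior of the opposite facet: otherwise \<open>p\<close> would be in the hull of the atoms other
  than \<open>q\<close> and some \<open>r\<close> and see the segment from \<open>q\<close> to
  \<open>r\<close> at an obtuse or right angle, hence be within half the diameter of its midpoint.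
  Comparing the altitudes of the triangle of \<open>q\<close>, \<open>r\<close> and the point
  \<open>y\<close> of the facet on the other side of \<open>p\<close> gives \<open>W * norm (q - r)
  \<le> norm (r - y) * norm (q - p)\<close>. For all \<open>r\<close> this bounds the weights
  \<open>\<beta> r\<close> of \<open>p\<close> from below. For \<open>r = s\<close> it gives the
  claim if \<open>norm (s - y)\<close> is sufficiently smaller than \<open>D\<close>; this holds
  since \<open>y\<close> is a balanced mixture of points at distance at least \<open>W\<close>,
  which needs a fourth atom.\<close>

lemma simplex_altitude:
  fixes A :: "'a::euclidean_space set"
  assumes fin: "finite A" and indep: "\<not> affine_dependent A" and four: "card A \<ge> 4"
    and D: "\<And>y z. y \<in> convex hull A \<Longrightarrow> z \<in> convex hull A \<Longrightarrow> norm (y - z) \<le> D"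
    and W: "0 < D" "D < 2 * PWidth A"
    and q: "q \<in> A" and s: "s \<in> A" "s \<noteq> q"
  obtains p where "p \<noteq> q" "\<And>r. r \<in> A \<Longrightarrow> r \<noteq> q \<Longrightarrow> (q - p) \<bullet> (r - p) = 0"
    "((PWidth A)\<^sup>2 + D\<^sup>2 / 4) * norm (s - q) \<le> D\<^sup>2 * norm (q - p)"
proof -
  let ?W = "PWidth A"
  define R where "R = A - {q}"
  have R: "finite R" "R \<subseteq> A" "q \<notin> R" "A = insert q R" "R \<noteq> A" using fin q by (auto simp: R_def)
  have cR: "card R \<ge> 3" using four q fin by (simp add: R_def)
  have A_hull: "a \<in> A \<Longrightarrow> a \<in> convex hull A" for a by (rule hull_inc)
  have sub_hull: "B \<subseteq> A \<Longrightarrow> y \<in> convex hull B \<Longrightarrow> y \<in> convex hull A" for B y using hull_mono[of B A] by blast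
  have R0: "convex hull R \<noteq> {}" using cR by auto
  have cl: "closed (convex hull R)" using R(1) by (simp add: compact_convex_hull compact_imp_closed finite_imp_compact)
  define p where "p = closest_point (convex hull R) q"
  have pR: "p \<in> convex hull R" unfolding p_def by (rule closest_point_in_set[OF cl R0])
  have dot: "(q - p) \<bullet> (r - p) \<le> 0" if "r \<in> R" for r
    unfolding p_def using that by (intro closest_point_dot[OF convex_convex_hull cl]) (auto intro: hull_inc)
  obtain \<beta> where \<beta>: "\<And>r. r \<in> R \<Longrightarrow> 0 \<le> \<beta> r" "sum \<beta> R = 1" "(\<Sum>r\<in>R. \<beta> r *\<^sub>R r) = p"
    using pR unfolding convex_hull_finite[OF R(1)] by auto
  have sub_rep: "(\<Sum>r\<in>B. (\<beta> r / c) *\<^sub>R r) \<in> convex hull B" if "B \<subseteq> R" "c = sum \<beta> B" "c > 0" for B c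
    using that R(1) \<beta>(1) finite_subset
    by (intro convex_sum[OF _ convex_convex_hull]) (auto intro: hull_inc simp flip: sum_divide_distrib)
  have \<beta>pos: "\<beta> r > 0" if r: "r \<in> R" for r
  proof (rule ccontr)
    assume "\<not> \<beta> r > 0"
    then have 0: "\<beta> r = 0" using \<beta>(1)[OF r] by simp
    have 1: "sum \<beta> (R - {r}) = 1" "(\<Sum>r\<in>R - {r}. \<beta> r *\<^sub>R r) = p"
      using sum.remove[OF R(1) r, of \<beta>] sum.remove[OF R(1) r, of "\<lambda>r. \<beta> r *\<^sub>R r"] \<beta>(2,3) 0 by auto
    then have p: "p \<in> convex hull (R - {r})" using sub_rep[of "R - {r}" 1] by auto
    have "A - (R - {r}) = {q, r}" using R(4) r R(3) by auto
    then have "midpoint q r \<in> convex hull (A - (R - {r}))"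
      using midpoint_in_closed_segment segment_convex_hull by metis
    then have "?W \<le> norm (p - midpoint q r)"
      using R by (intro simplex_partition_width[OF fin indep _ _ p]) auto
    also have "\<dots> \<le> D / 2"
    proof (rule power2_le_imp_le)
      have "p - midpoint q r = (1 / 2) *\<^sub>R ((p - q) + (p - r))"
        using scaleR_half_double[of p] by (simp add: midpoint_def algebra_simps)
      then have "(norm (p - midpoint q r))\<^sup>2 = (norm ((p - q) + (p - r)))\<^sup>2 / 4"
        by (simp add: power_divide)
      also have "\<dots> = ((norm (q - r))\<^sup>2 + 4 * ((q - p) \<bullet> (r - p))) / 4"
        by (simp add: power2_norm_eq_inner algebra_simps inner_commute)
      also have "\<dots> \<le> D\<^sup>2 / 4"
        using dot[OF r] power_mono[OF D[of q r], of 2] A_hull q r R(2) by auto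
      finally show "(norm (p - midpoint q r))\<^sup>2 \<le> (D / 2)\<^sup>2" by (simp add: power_divide)
    qed (use W in simp)
    finally show False using W by simp
  qed
  have orth: "(q - p) \<bullet> (r - p) = 0" if r: "r \<in> R" for r
  proof -
    have "(\<Sum>r\<in>R. \<beta> r * ((q - p) \<bullet> (r - p))) = (q - p) \<bullet> (\<Sum>r\<in>R. \<beta> r *\<^sub>R (r - p))"
      by (simp add: inner_sum_right)
    also have "(\<Sum>r\<in>R. \<beta> r *\<^sub>R (r - p)) = p - (\<Sum>r\<in>R. \<beta> r) *\<^sub>R p"
      by (simp add: scaleR_diff_right sum_subtractf \<beta>(3) scaleR_sum_left)
    finally have "(\<Sum>r\<in>R. - (\<beta> r * ((q - p) \<bullet> (r - p)))) = 0" using \<beta>(2) by (simp add: sum_negf)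
    then have "- (\<beta> r * ((q - p) \<bullet> (r - p))) = 0"
      using r R(1) dot \<beta>(1) by (subst (asm) sum_nonneg_eq_0_iff) (auto simp: mult_nonneg_nonpos)
    then show ?thesis using \<beta>pos[OF r] by simp
  qed
  have WH: "?W \<le> norm (q - p)"
  proof -
    have "A - R = {q}" using R by auto
    then have "?W \<le> norm (p - q)"
      by (intro simplex_partition_width[OF fin indep R(2,5) pR]) simp
    then show ?thesis by (simp add: norm_minus_commute)
  qed
  have pq: "p \<noteq> q" using WH W by auto
  have split: "\<beta> r < 1 \<and> (\<exists>y. y \<in> convex hull (R - {r}) \<and> y = (\<Sum>a\<in>R - {r}. (\<beta> a / (1 - \<beta> r)) *\<^sub>R a) \<and>
      p = \<beta> r *\<^sub>R r + (1 - \<beta> r) *\<^sub>R y \<and> (q - p) \<bullet> (r - y) = 0 \<and> ?W\<^sup>2 * (norm (q - r))\<^sup>2 \<le> (norm (r - y))\<^sup>2 * (norm (q - p))\<^sup>2)"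
    if r: "r \<in> R" for r
  proof -
    have c: "sum \<beta> (R - {r}) = 1 - \<beta> r" using sum.remove[OF R(1) r, of \<beta>] \<beta>(2) by simp
    have "R - {r} \<noteq> {}" 
    proof
      assume "R - {r} = {}"
      then have "card R \<le> card {r}" using R(1) by (intro card_mono) auto
      then show False using cR by simp
    qed
    then have "0 < sum \<beta> (R - {r})" using R(1) \<beta>pos by (intro sum_pos) auto
    then have lt: "\<beta> r < 1" using c by simp
    define y where "y = (\<Sum>a\<in>R - {r}. (\<beta> a / (1 - \<beta> r)) *\<^sub>R a)"
    have y: "y \<in> convex hull (R - {r})" unfolding y_def using lt c by (intro sub_rep) auto
    have "(1 - \<beta> r) *\<^sub>R y = (\<Sum>a\<in>R - {r}. \<beta> a *\<^sub>R a)" unfolding y_def scaleR_sum_right using lt by simp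
    then have p: "p = \<beta> r *\<^sub>R r + (1 - \<beta> r) *\<^sub>R y"
      using sum.remove[OF R(1) r, of "\<lambda>a. \<beta> a *\<^sub>R a"] \<beta>(3) by simp
    have "r - p = (1 - \<beta> r) *\<^sub>R (r - y)" by (subst p) (simp add: algebra_simps)
    then have o: "(q - p) \<bullet> (r - y) = 0" using orth[OF r] lt by simp
    have "\<beta> r * (1 - \<beta> r) * (norm (r - y))\<^sup>2 \<le> 1 / 4 * D\<^sup>2"
    proof (rule mult_mono)
      have "0 \<le> (\<beta> r - 1 / 2)\<^sup>2" by simp
      then show "\<beta> r * (1 - \<beta> r) \<le> 1 / 4" by (simp add: power2_eq_square field_simps)
      have "norm (r - y) \<le> D" using r R(2) by (intro D sub_hull[OF _ y] A_hull) auto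
      then show "(norm (r - y))\<^sup>2 \<le> D\<^sup>2" by (intro power_mono) auto
    qed auto
    also have "\<dots> = (D / 2)\<^sup>2" by (simp add: power_divide)
    also have "\<dots> \<le> (norm (q - p))\<^sup>2" using WH W by (intro power_mono) auto
    finally obtain z where z: "z \<in> closed_segment q r"
      "(norm (y - z))\<^sup>2 * (norm (q - r))\<^sup>2 = (norm (r - y))\<^sup>2 * (norm (q - p))\<^sup>2"
      using triangle_altitudes[OF \<beta>pos[OF r] lt p o] pq by metis
    have "A - (R - {r}) = {q, r}" using R(4) r R(3) by auto
    then have "?W \<le> norm (y - z)" using z(1) R
      by (intro simplex_partition_width[OF fin indep _ _ y]) (auto simp: segment_convex_hull)
    then have "?W\<^sup>2 * (norm (q - r))\<^sup>2 \<le> (norm (y - z))\<^sup>2 * (norm (q - r))\<^sup>2"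
      using W by (intro mult_right_mono power_mono) auto
    then show ?thesis using lt y y_def p o z(2) by auto
  qed
  have weight: "2 * (1 - \<beta> r) * ?W \<le> D" if r: "r \<in> R" for r
  proof -
    obtain y where lt: "\<beta> r < 1" and y: "p = \<beta> r *\<^sub>R r + (1 - \<beta> r) *\<^sub>R y" "(q - p) \<bullet> (r - y) = 0"
        "?W\<^sup>2 * (norm (q - r))\<^sup>2 \<le> (norm (r - y))\<^sup>2 * (norm (q - p))\<^sup>2"
      using split[OF r] by auto
    define a2 H2 where "a2 = (norm (r - p))\<^sup>2" and "H2 = (norm (q - p))\<^sup>2"
    have rp: "r - p = (1 - \<beta> r) *\<^sub>R (r - y)" by (subst y(1)) (simp add: algebra_simps)
    have a2: "a2 = (1 - \<beta> r)\<^sup>2 * (norm (r - y))\<^sup>2" unfolding a2_def rp by (simp add: power_mult_distrib)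
    have "(norm (q - r))\<^sup>2 = a2 + H2"
      using orth[OF r] norm_add_Pythagorean[of "q - p" "p - r"]
      by (simp add: a2_def H2_def orthogonal_def inner_diff_right norm_minus_commute)
    then have N: "(norm (q - r))\<^sup>2 = a2 + H2" .
    have N0: "(norm (q - r))\<^sup>2 > 0" using r R(3) by auto
    have "(1 - \<beta> r)\<^sup>2 * (?W\<^sup>2 * (norm (q - r))\<^sup>2) \<le> (1 - \<beta> r)\<^sup>2 * ((norm (r - y))\<^sup>2 * H2)"
      unfolding H2_def using y(3) by (intro mult_left_mono) auto
    also have "\<dots> = a2 * H2" by (simp add: a2)
    also have "\<dots> \<le> (a2 + H2)\<^sup>2 / 4"
    proof -
      have "0 \<le> (a2 - H2)\<^sup>2" by simp
      then show ?thesis by (simp add: power2_eq_square algebra_simps)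
    qed
    also have "\<dots> = (norm (q - r))\<^sup>2 / 4 * (norm (q - r))\<^sup>2" unfolding N by (simp add: power2_eq_square)
    finally have "(1 - \<beta> r)\<^sup>2 * ?W\<^sup>2 * (norm (q - r))\<^sup>2 \<le> (norm (q - r))\<^sup>2 / 4 * (norm (q - r))\<^sup>2" by (simp only: mult.assoc)
    then have "(1 - \<beta> r)\<^sup>2 * ?W\<^sup>2 \<le> (norm (q - r))\<^sup>2 / 4" using N0 by (rule mult_right_le_imp_le)
    also have "\<dots> \<le> D\<^sup>2 / 4" using D[of q r] A_hull q r R(2) by (auto intro!: power_mono)
    finally have "4 * ((1 - \<beta> r)\<^sup>2 * ?W\<^sup>2) \<le> D\<^sup>2" by simp
    moreover have "(2 * (1 - \<beta> r) * ?W)\<^sup>2 = 4 * ((1 - \<beta> r)\<^sup>2 * ?W\<^sup>2)" by (simp only: power_mult_distrib) simp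
    ultimately have "(2 * (1 - \<beta> r) * ?W)\<^sup>2 \<le> D\<^sup>2" by simp
    then show ?thesis by (rule power2_le_imp_le) (use W in simp)
  qed
  define \<tau> where "\<tau> = ?W / D"
  have \<tau>: "1 / 2 < \<tau>" "\<tau> > 0" using W by (auto simp: \<tau>_def field_simps)
  have W\<tau>: "?W = \<tau> * D" using W by (simp add: \<tau>_def)
  have D2: "D\<^sup>2 > 0" using W by simp
  have \<tau>2: "2 * \<tau>\<^sup>2 \<le> 1"
  proof -
    have "2 * ?W\<^sup>2 \<le> D\<^sup>2" using W by (intro simplex_width_four[OF fin indep four]) (auto intro: D A_hull)
    then show ?thesis using D2 by (simp add: \<tau>_def power_divide field_simps)
  qed
  have sR: "s \<in> R" using s by (simp add: R_def)
  have wt: "1 - 1 / (2 * \<tau>) \<le> \<beta> r" if "r \<in> R" for r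
  proof -
    have "(2 * (1 - \<beta> r) * \<tau>) * D \<le> 1 * D" using weight[OF that] by (simp add: W\<tau>)
    then have "2 * (1 - \<beta> r) * \<tau> \<le> 1" by (rule mult_right_le_imp_le) (rule W(1))
    then show ?thesis using \<tau> by (simp add: field_simps)
  qed
  obtain y where b1: "\<beta> s < 1" and y: "y \<in> convex hull (R - {s})" "y = (\<Sum>a\<in>R - {s}. (\<beta> a / (1 - \<beta> s)) *\<^sub>R a)"
      "?W\<^sup>2 * (norm (q - s))\<^sup>2 \<le> (norm (s - y))\<^sup>2 * (norm (q - p))\<^sup>2"
    using split[OF sR] by auto
  have "card (R - {s}) \<ge> 2" using cR R(1) sR by simp
  then obtain B where B: "B \<subseteq> R - {s}" "card B = 2" using obtain_subset_with_card_n by metis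
  then obtain r r' where rr: "r \<in> R" "r' \<in> R" "r \<noteq> s" "r' \<noteq> s" "r \<noteq> r'" by (auto simp: card_2_iff)
  define c where "c = 1 - \<beta> s"
  have c: "c > 0" "sum \<beta> (R - {s}) = c" using b1 sum.remove[OF R(1) sR, of \<beta>] \<beta>(2) by (auto simp: c_def)
  define R' where "R' = R - {s} - {r}"
  have R': "finite R'" "r' \<in> R'" "R' \<subseteq> R" "r \<notin> R'" "s \<notin> R'" using R(1) rr by (auto simp: R'_def)
  have c': "sum \<beta> R' = c - \<beta> r" using sum.remove[of "R - {s}" r \<beta>] R(1) rr c by (auto simp: R'_def)
  have "\<beta> r' \<le> sum \<beta> R'" using R' \<beta>(1) by (intro member_le_sum) auto
  then have br': "1 - 1 / (2 * \<tau>) \<le> c - \<beta> r" using wt[OF rr(2)] c' by simp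
  have crpos: "c - \<beta> r > 0" using c' R' \<beta>pos sum_pos[of R' \<beta>] by auto
  define \<nu> where "\<nu> = \<beta> r / c"
  define z where "z = (\<Sum>a\<in>R'. (\<beta> a / (c - \<beta> r)) *\<^sub>R a)"
  have z: "z \<in> convex hull R'" unfolding z_def using c' crpos R' by (intro sub_rep) auto
  have "(1 - \<nu>) *\<^sub>R z = (\<Sum>a\<in>R'. (\<beta> a / c) *\<^sub>R a)"
    unfolding z_def scaleR_sum_right \<nu>_def using c(1) crpos by (intro sum.cong) (auto simp: field_simps)
  then have yz: "y = \<nu> *\<^sub>R r + (1 - \<nu>) *\<^sub>R z"
    unfolding y(2) \<nu>_def R'_def c_def[symmetric]
    using sum.remove[of "R - {s}" r "\<lambda>a. (\<beta> a / c) *\<^sub>R a"] R(1) rr by simp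
  have c\<tau>: "c * (2 * \<tau>) \<le> 1" using wt[OF sR] \<tau> by (simp add: c_def field_simps)
  have frac: "2 * \<tau> - 1 \<le> b / c" if "1 - 1 / (2 * \<tau>) \<le> b" for b
  proof -
    have "(2 * \<tau> - 1) * (c * (2 * \<tau>)) \<le> (2 * \<tau> - 1) * 1" using c\<tau> \<tau> by (intro mult_left_mono) auto
    also have "\<dots> \<le> b * (2 * \<tau>)" using that \<tau> by (simp add: field_simps)
    finally have "(2 * \<tau> - 1) * c * (2 * \<tau>) \<le> b * (2 * \<tau>)" by simp
    then have "(2 * \<tau> - 1) * c \<le> b" by (rule mult_right_le_imp_le) (use \<tau> in simp)
    then show ?thesis using c by (simp add: pos_le_divide_eq)
  qed
  have \<nu>: "2 * \<tau> - 1 \<le> \<nu>" "2 * \<tau> - 1 \<le> 1 - \<nu>"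
    using frac[OF wt[OF rr(1)]] frac[OF br'] c(1) by (auto simp: \<nu>_def diff_divide_distrib)
  have \<nu>01: "0 \<le> \<nu>" "\<nu> \<le> 1" using \<nu> \<tau> by auto
  have "0 \<le> (\<nu> - (2 * \<tau> - 1)) * (1 - \<nu> - (2 * \<tau> - 1))" using \<nu> by (intro mult_nonneg_nonneg) auto
  then have \<nu>\<nu>: "(2 * \<tau> - 1) * (2 - 2 * \<tau>) \<le> \<nu> * (1 - \<nu>)" by (simp add: algebra_simps)
  have rz: "?W \<le> norm (r - z)"
  proof (rule simplex_partition_width[OF fin indep])
    show "{r} \<subseteq> A" "{r} \<noteq> A" using rr R(2) by auto
    show "z \<in> convex hull (A - {r})" using z R'(3,4) R(2) hull_mono[of R' "A - {r}" convex] by blast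
  qed simp
  have zA: "z \<in> convex hull A" using z R'(3) R(2) sub_hull[of R' z] by auto
  have sA: "s \<in> convex hull A" "r \<in> convex hull A" using s(1) rr(1) R(2) A_hull by auto
  have "(norm (s - y))\<^sup>2 = \<nu> * (norm (s - r))\<^sup>2 + (1 - \<nu>) * (norm (s - z))\<^sup>2 - \<nu> * (1 - \<nu>) * (norm (r - z))\<^sup>2"
    unfolding yz power2_norm_eq_inner by (simp add: algebra_simps inner_commute)
  also have "\<dots> \<le> \<nu> * D\<^sup>2 + (1 - \<nu>) * D\<^sup>2 - (2 * \<tau> - 1) * (2 - 2 * \<tau>) * ?W\<^sup>2"
  proof -
    have "\<nu> * (norm (s - r))\<^sup>2 \<le> \<nu> * D\<^sup>2" "(1 - \<nu>) * (norm (s - z))\<^sup>2 \<le> (1 - \<nu>) * D\<^sup>2"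
      using \<nu>01 D sA zA by (auto intro!: mult_left_mono power_mono)
    moreover have "(2 * \<tau> - 1) * (2 - 2 * \<tau>) * ?W\<^sup>2 \<le> \<nu> * (1 - \<nu>) * (norm (r - z))\<^sup>2"
      using \<nu>01 rz W by (intro mult_mono[OF \<nu>\<nu>] power_mono mult_nonneg_nonneg) auto
    ultimately show ?thesis by linarith
  qed
  also have "\<dots> = D\<^sup>2 * (1 - (2 * \<tau> - 1) * (2 - 2 * \<tau>) * \<tau>\<^sup>2)"
    by (simp add: W\<tau> power_mult_distrib algebra_simps)
  finally have sy: "(norm (s - y))\<^sup>2 \<le> D\<^sup>2 * (1 - (2 * \<tau> - 1) * (2 - 2 * \<tau>) * \<tau>\<^sup>2)" .
  have "\<tau>\<^sup>2 * D\<^sup>2 * ((\<tau>\<^sup>2 + 1 / 4)\<^sup>2 * (norm (s - q))\<^sup>2) = (\<tau>\<^sup>2 + 1 / 4)\<^sup>2 * (?W\<^sup>2 * (norm (q - s))\<^sup>2)"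
    by (simp add: W\<tau> power_mult_distrib norm_minus_commute)
  also have "\<dots> \<le> (\<tau>\<^sup>2 + 1 / 4)\<^sup>2 * ((norm (s - y))\<^sup>2 * (norm (q - p))\<^sup>2)"
    using y(3) by (intro mult_left_mono) auto
  also have "\<dots> \<le> (\<tau>\<^sup>2 + 1 / 4)\<^sup>2 * (D\<^sup>2 * (1 - (2 * \<tau> - 1) * (2 - 2 * \<tau>) * \<tau>\<^sup>2) * (norm (q - p))\<^sup>2)"
    using sy by (intro mult_left_mono mult_right_mono) auto
  also have "\<dots> = (\<tau>\<^sup>2 + 1 / 4)\<^sup>2 * (1 - (2 * \<tau> - 1) * (2 - 2 * \<tau>) * \<tau>\<^sup>2) * (D\<^sup>2 * (norm (q - p))\<^sup>2)"
    by (simp only: mult_ac)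
  also have "\<dots> \<le> \<tau>\<^sup>2 * (D\<^sup>2 * (norm (q - p))\<^sup>2)"
    using altitude_polynomial[of \<tau>] \<tau> \<tau>2 by (intro mult_right_mono) auto
  finally have "\<tau>\<^sup>2 * D\<^sup>2 * ((\<tau>\<^sup>2 + 1 / 4) * norm (s - q))\<^sup>2 \<le> \<tau>\<^sup>2 * D\<^sup>2 * (norm (q - p))\<^sup>2"
    by (simp only: power_mult_distrib mult.assoc)
  then have "((\<tau>\<^sup>2 + 1 / 4) * norm (s - q))\<^sup>2 \<le> (norm (q - p))\<^sup>2"
    by (rule mult_left_le_imp_le) (use \<tau> D2 in simp)
  then have "(\<tau>\<^sup>2 + 1 / 4) * norm (s - q) \<le> norm (q - p)" by (rule power2_le_imp_le) simp
  then have "D\<^sup>2 * ((\<tau>\<^sup>2 + 1 / 4) * norm (s - q)) \<le> D\<^sup>2 * norm (q - p)" using D2 by simp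
  then have fin: "(?W\<^sup>2 + D\<^sup>2 / 4) * norm (s - q) \<le> D\<^sup>2 * norm (q - p)"
    by (simp add: W\<tau> power_mult_distrib algebra_simps)
  show ?thesis by (rule that[OF pq _ fin]) (use orth in \<open>auto simp: R_def\<close>)
qed

section \<open>Slopes at points of a simplex with an inactive atom\<close>

lemma segment_norm:
  fixes a b z :: "'a::real_inner"
  shows "(norm (a + \<theta> *\<^sub>R (z - a) - b))\<^sup>2 = (norm (a - b))\<^sup>2 + 2 * \<theta> * ((a - b) \<bullet> (z - a)) + \<theta>\<^sup>2 * (norm (z - a))\<^sup>2"
  unfolding power2_norm_eq_inner by (simp add: algebra_simps inner_commute power2_eq_square)

text \<open>If \<open>z\<close> is closer to \<open>b\<close> than to \<open>a\<close>, then moving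
  from \<open>a\<close> towards \<open>z\<close> approaches \<open>b\<close>, so the distance of
  \<open>a\<close> and \<open>b\<close> has to exceed \<open>W\<close> by some margin.\<close>

lemma width_pinch_far:
  fixes a b z :: "'a::real_inner"
  assumes D: "norm (a - b) \<le> D" "norm (z - a) \<le> D" "0 < D" and far: "norm (z - b) \<le> norm (z - a)" and W: "0 \<le> W"
    and seg: "\<And>\<theta>. 0 \<le> \<theta> \<Longrightarrow> \<theta> \<le> 1 \<Longrightarrow> W \<le> norm (a + \<theta> *\<^sub>R (z - a) - b)"
  shows "(W / D)\<^sup>2 + ((W / D)\<^sup>2)\<^sup>2 / 4 \<le> (norm (a - b) / D)\<^sup>2"
proof -
  define P R where "P = (W / D)\<^sup>2" and "R = (norm (a - b) / D)\<^sup>2"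
  have R: "0 \<le> R" "R \<le> 1" using D by (auto simp: R_def intro!: power_le_one)
  have PR: "P \<le> R" unfolding P_def R_def using seg[of 0] W D by (intro power_mono divide_right_mono) auto
  have P0: "0 \<le> P" by (simp add: P_def)
  have ab: "(norm (a - b))\<^sup>2 = R * D\<^sup>2" using D by (simp add: R_def power_divide)
  have "(norm (z - b))\<^sup>2 = (norm (z - a))\<^sup>2 + 2 * ((a - b) \<bullet> (z - a)) + (norm (a - b))\<^sup>2"
    unfolding power2_norm_eq_inner by (simp add: algebra_simps inner_commute)
  moreover have "(norm (z - b))\<^sup>2 \<le> (norm (z - a))\<^sup>2" using far by (intro power_mono) auto
  ultimately have ip: "(a - b) \<bullet> (z - a) \<le> - (R * D\<^sup>2 / 2)" using ab by simp
  let ?\<theta> = "R / 2"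
  have "W\<^sup>2 \<le> (norm (a + ?\<theta> *\<^sub>R (z - a) - b))\<^sup>2" using R W by (intro power_mono seg) auto
  also have "\<dots> = R * D\<^sup>2 + R * ((a - b) \<bullet> (z - a)) + (R / 2)\<^sup>2 * (norm (z - a))\<^sup>2"
    unfolding segment_norm ab by simp
  also have "\<dots> \<le> R * D\<^sup>2 + R * - (R * D\<^sup>2 / 2) + (R / 2)\<^sup>2 * D\<^sup>2"
    using ip R D by (intro add_mono mult_left_mono power_mono order_refl) auto
  also have "\<dots> = (R - R\<^sup>2 / 4) * D\<^sup>2" by (simp add: power2_eq_square field_simps)
  finally have "P \<le> R - R\<^sup>2 / 4" using D by (simp add: P_def power_divide pos_divide_le_eq)
  moreover have "P\<^sup>2 \<le> R\<^sup>2" using PR P0 by (intro power_mono) auto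
  ultimately show ?thesis unfolding P_def[symmetric] R_def[symmetric] by simp
qed

text \<open>Moving from \<open>a\<close> towards \<open>z\<close> also approaches \<open>b\<close>
  if the component of \<open>z - b\<close> in the direction of \<open>a - b\<close> is smaller than
  that of \<open>a - b\<close> itself. Here \<open>R\<close> is a bound for the normalized distance
  of \<open>a\<close> and \<open>b\<close>, and the component of \<open>z - b\<close> is at most the
  fraction \<open>G\<close> of it.\<close>

lemma width_pinch_near:
  fixes a b z :: "'a::real_inner"
  assumes D: "norm (z - a) \<le> D" "0 < D" and W: "0 \<le> W" and R: "norm (a - b) \<le> R * D"
    and G: "1 / 2 \<le> G" "G \<le> 1" and ip: "(z - b) \<bullet> (a - b) \<le> G * R * D * norm (a - b)"
    and seg: "\<And>\<theta>. 0 \<le> \<theta> \<Longrightarrow> \<theta> \<le> 1 \<Longrightarrow> W \<le> norm (a + \<theta> *\<^sub>R (z - a) - b)"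
    and P12: "2 * (W / D)\<^sup>2 \<le> 1"
  shows "(W / D)\<^sup>2 * (1 + (W / D)\<^sup>2 * (1 - G)\<^sup>2) \<le> R\<^sup>2"
proof -
  define P \<rho> where "P = (W / D)\<^sup>2" and "\<rho> = norm (a - b) / D"
  have ab: "norm (a - b) = \<rho> * D" using D by (simp add: \<rho>_def)
  have \<rho>: "0 \<le> \<rho>" "\<rho> \<le> R" using D R by (auto simp: \<rho>_def field_simps)
  have P0: "0 \<le> P" "P \<le> 1 / 2" using P12 by (auto simp: P_def)
  have "P \<le> \<rho>\<^sup>2" unfolding P_def \<rho>_def using seg[of 0] W D by (intro power_mono divide_right_mono) auto
  have x: "(1 - G)\<^sup>2 \<le> 1 / 4"
    using G power_mono[of "1 - G" "1 / 2" 2] by (simp add: power_divide)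
  have "P * (1 + P * (1 - G)\<^sup>2) \<le> R\<^sup>2"
  proof (cases "1 \<le> R")
    case True
    have "P * (1 + P * (1 - G)\<^sup>2) \<le> 1 / 2 * (1 + 1 / 2 * (1 / 4))"
      using P0 x by (intro mult_mono add_mono) auto
    also have "\<dots> \<le> 1\<^sup>2" by simp
    also have "1\<^sup>2 \<le> R\<^sup>2" using True by (intro power_mono) auto
    finally show ?thesis .
  next
    case False
    then have R1: "R \<le> 1" by simp
    define \<delta> where "\<delta> = \<rho> - G * R"
    show ?thesis
    proof (cases "\<delta> \<le> 0")
      case True
      then have "\<rho>\<^sup>2 \<le> (G * R)\<^sup>2" using \<rho> by (intro power_mono) (auto simp: \<delta>_def)
      then have "P \<le> (G * R)\<^sup>2" using \<open>P \<le> \<rho>\<^sup>2\<close> by simp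
      then have "P * (1 + P * (1 - G)\<^sup>2) \<le> (G * R)\<^sup>2 * (1 + 1 * (1 - G)\<^sup>2)"
        using P0 by (intro mult_mono add_mono) auto
      also have "\<dots> = R\<^sup>2 * (G\<^sup>2 * (1 + (1 - G)\<^sup>2))" by (simp add: power_mult_distrib)
      also have "\<dots> \<le> R\<^sup>2 * 1"
      proof (intro mult_left_mono)
        define e where "e = 1 - G"
        have e: "0 \<le> e" "e \<le> 1 / 2" "G = 1 - e" using G by (auto simp: e_def)
        have "0 \<le> e * (2 * (1 - e)) + e ^ 3 * (2 - e)" using e by (intro add_nonneg_nonneg mult_nonneg_nonneg) auto
        also have "\<dots> = 1 - G\<^sup>2 * (1 + (1 - G)\<^sup>2)"
          unfolding e(3) by (simp add: power2_eq_square power3_eq_cube algebra_simps)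
        finally show "G\<^sup>2 * (1 + (1 - G)\<^sup>2) \<le> 1" by simp
      qed simp
      finally show ?thesis by simp
    next
      case False
      then have \<delta>: "0 < \<delta>" "\<delta> \<le> \<rho>" "\<rho> \<le> 1" using \<rho> G R1 by (auto simp: \<delta>_def)
      have "(z - b) \<bullet> (a - b) = (a - b) \<bullet> (z - a) + (norm (a - b))\<^sup>2"
        unfolding power2_norm_eq_inner by (simp add: algebra_simps inner_commute)
      then have ip': "(a - b) \<bullet> (z - a) \<le> - (\<rho> * \<delta> * D\<^sup>2)"
        using ip unfolding ab by (simp add: \<delta>_def power2_eq_square algebra_simps)
      let ?\<theta> = "\<rho> * \<delta>"
      have \<theta>: "0 \<le> ?\<theta>" "?\<theta> \<le> 1" using \<delta> mult_le_one[of \<rho> \<delta>] by auto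
      have "W\<^sup>2 \<le> (norm (a + ?\<theta> *\<^sub>R (z - a) - b))\<^sup>2" using \<theta> W by (intro power_mono seg) auto
      also have "\<dots> = \<rho>\<^sup>2 * D\<^sup>2 + 2 * ?\<theta> * ((a - b) \<bullet> (z - a)) + ?\<theta>\<^sup>2 * (norm (z - a))\<^sup>2"
        unfolding segment_norm ab by (simp add: power_mult_distrib)
      also have "\<dots> \<le> \<rho>\<^sup>2 * D\<^sup>2 + 2 * ?\<theta> * - (\<rho> * \<delta> * D\<^sup>2) + ?\<theta>\<^sup>2 * D\<^sup>2"
        using ip' \<theta> D by (intro add_mono mult_left_mono power_mono order_refl) auto
      also have "\<dots> = (\<rho>\<^sup>2 - \<rho>\<^sup>2 * \<delta>\<^sup>2) * D\<^sup>2" by (simp add: power2_eq_square algebra_simps)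
      finally have P1: "P \<le> \<rho>\<^sup>2 - \<rho>\<^sup>2 * \<delta>\<^sup>2" using D by (simp add: P_def power_divide pos_divide_le_eq)
      define \<Delta> where "\<Delta> = R - G * R"
      have \<Delta>: "\<delta> \<le> \<Delta>" "\<Delta> \<le> R / 2" using \<rho> G mult_right_mono[OF G(1), of R] by (auto simp: \<delta>_def \<Delta>_def)
      have "(R * \<Delta>)\<^sup>2 - (\<rho> * \<delta>)\<^sup>2 \<le> R\<^sup>2 - \<rho>\<^sup>2"
      proof -
        have "R * \<Delta> - \<rho> * \<delta> = (R - \<rho>) * (R + \<delta>)" by (simp add: \<Delta>_def \<delta>_def algebra_simps)
        then have "(R * \<Delta>)\<^sup>2 - (\<rho> * \<delta>)\<^sup>2 = (R - \<rho>) * ((R + \<delta>) * (R * \<Delta> + \<rho> * \<delta>))"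
          unfolding power2_eq_square square_diff_square_factored by (simp only: mult_ac)
        also have "\<dots> \<le> (R - \<rho>) * ((R + \<rho>) * 1)"
        proof (intro mult_left_mono mult_mono)
          have "R * \<Delta> \<le> 1 * (1 / 2)" by (intro mult_mono) (use \<rho> \<delta> \<Delta> R1 in auto)
          moreover have "\<rho> * \<delta> \<le> 1 * (1 / 2)" by (intro mult_mono) (use \<rho> \<delta> \<Delta> R1 in auto)
          ultimately show "R * \<Delta> + \<rho> * \<delta> \<le> 1" by simp
        qed (use \<rho> \<delta> \<Delta> in auto)
        finally show ?thesis by (simp add: power2_eq_square square_diff_square_factored mult_ac)
      qed
      then have P2: "P \<le> R\<^sup>2 - (R * \<Delta>)\<^sup>2" using P1 by (simp add: power_mult_distrib)
      have "P \<le> R\<^sup>2" using P2 zero_le_power2[of "R * \<Delta>"] by linarith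
      have "P * (P * (1 - G)\<^sup>2) \<le> R\<^sup>2 * (R\<^sup>2 * (1 - G)\<^sup>2)"
        using P0 \<open>P \<le> R\<^sup>2\<close> by (intro mult_mono mult_nonneg_nonneg order_refl) auto
      also have "\<dots> = (R * \<Delta>)\<^sup>2" by (simp add: \<Delta>_def power2_eq_square algebra_simps)
      finally show ?thesis using P2 by (simp add: distrib_left)
    qed
  qed
  then show ?thesis unfolding P_def .
qed

text \<open>What the projection onto the tangent cone removes is normal to the polytope at \<open>x\<close>.\<close>

lemma closest_tangent_remainder:
  fixes A :: "'a::euclidean_space set"
  assumes fin: "finite A" and rep: "active_rep A w x"
  defines "u g \<equiv> closest_point (tangent_cone (convex hull A) x) g"
  shows "y \<in> convex hull A \<Longrightarrow> (g - u g) \<bullet> y \<le> (g - u g) \<bullet> x"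
    and "a \<in> active_set A w \<Longrightarrow> (g - u g) \<bullet> a = (g - u g) \<bullet> x"
proof -
  have x\<Omega>: "x \<in> convex hull A" by (rule active_rep_in_hull[OF fin rep])
  show n_le: "(g - u g) \<bullet> y \<le> (g - u g) \<bullet> x" if "y \<in> convex hull A" for y
    using closest_tangent_polar[OF convex_convex_hull x\<Omega> tangent_cone_minus[OF that], of g]
    by (simp add: u_def inner_diff_right)
  assume a: "a \<in> active_set A w"
  have w: "\<forall>a\<in>A. 0 \<le> w a" "sum w A = 1" "x = (\<Sum>a\<in>A. w a *\<^sub>R a)" using rep by (auto simp: active_rep_def)
  have "(\<Sum>a\<in>A. w a * ((g - u g) \<bullet> x - (g - u g) \<bullet> a)) = sum w A * ((g - u g) \<bullet> x) - (g - u g) \<bullet> (\<Sum>a\<in>A. w a *\<^sub>R a)"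
    by (simp add: right_diff_distrib sum_subtractf inner_sum_right sum_distrib_right)
  then have "(\<Sum>a\<in>A. w a * ((g - u g) \<bullet> x - (g - u g) \<bullet> a)) = 0" using w(2,3) by simp
  then have "w a * ((g - u g) \<bullet> x - (g - u g) \<bullet> a) = 0"
    using a n_le w(1) fin by (subst (asm) sum_nonneg_eq_0_iff) (auto simp: hull_inc active_set_def)
  then show "(g - u g) \<bullet> a = (g - u g) \<bullet> x" using a by (auto simp: active_set_def)
qed

text \<open>The projection \<open>u\<close> of \<open>g\<close> is parallel to a difference
  \<open>Pt - N\<close> as in \<open>direction_decomposition\<close>, and the angle condition
  improves if the distance of \<open>Pt\<close> and \<open>N\<close> exceeds the width. An inactive
  atom \<open>q\<close> enforces this. If it does not belong to the minimal face of
  \<open>Pt\<close>, then it may be joined to either side of the partition of the atoms, and it is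
  joined to the point that it is further away from. If it belongs to this face, then it may be
  joined to \<open>Pt\<close> only, but then \<open>g\<close> and \<open>u\<close> agree on \<open>q
  - N\<close>, and the result depends on how far the value of \<open>g\<close> at \<open>q\<close>
  is below the maximum. The remainder \<open>g - u\<close> is constant on that face, so the
  hypothesis of the first claim excludes this case.\<close>

lemma simplex_slope:
  fixes A :: "'a::euclidean_space set"
  assumes fin: "finite A" and indep: "\<not> affine_dependent A"
    and D: "\<And>y z. y \<in> convex hull A \<Longrightarrow> z \<in> convex hull A \<Longrightarrow> norm (y - z) \<le> D" "0 < D"
    and rep: "active_rep A w x" and W: "0 \<le> PWidth A"
    and h: "\<And>p n. p \<in> convex hull A \<Longrightarrow> n \<in> convex hull (active_set A w) \<Longrightarrow> g \<bullet> (p - n) \<le> h"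
    and pos: "proj_slope (convex hull A) x g > 0"
    and q: "q \<in> A" "q \<notin> active_set A w"
  defines "P \<equiv> (PWidth A / D)\<^sup>2" and "R \<equiv> h / (proj_slope (convex hull A) x g * D)"
    and "u \<equiv> closest_point (tangent_cone (convex hull A) x) g"
  shows "(g - u) \<bullet> q < (g - u) \<bullet> x \<Longrightarrow> P * (1 + P / 4) \<le> R\<^sup>2"
    and "\<lbrakk>2 * P \<le> 1; 1 / 2 \<le> G; G \<le> 1; \<And>n. n \<in> convex hull (active_set A w) \<Longrightarrow> g \<bullet> (q - n) \<le> G * h\<rbrakk>
      \<Longrightarrow> P * (1 + P * (1 - G)\<^sup>2) \<le> R\<^sup>2"
proof -
  let ?\<Omega> = "convex hull A" and ?S = "active_set A w"
  let ?n = "g - u"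
  define \<pi> where "\<pi> = proj_slope ?\<Omega> x g"
  have \<pi>: "\<pi> > 0" "\<pi> = norm u" using pos by (auto simp: \<pi>_def proj_slope_def u_def)
  have x\<Omega>: "x \<in> ?\<Omega>" by (rule active_rep_in_hull[OF fin rep])
  have S: "?S \<subseteq> A" by (auto simp: active_set_def)
  note n_le = closest_tangent_remainder(1)[OF fin rep, of _ g, folded u_def]
    and n_S = closest_tangent_remainder(2)[OF fin rep, of _ g, folded u_def]
  obtain l where l: "l > 0" "x + l *\<^sub>R u \<in> ?\<Omega>"
    using tangent_cone_polytope[OF _ x\<Omega> closest_tangent_in[OF convex_convex_hull x\<Omega>, of g]] fin
    by (auto simp: polytope_def u_def)
  have "x + l *\<^sub>R u \<noteq> x" using \<pi> l by auto
  then obtain M Pt N where M: "0 < M" "Pt \<in> ?\<Omega>" "x + l *\<^sub>R u - x = M *\<^sub>R (Pt - N)"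
      and N: "N \<in> convex hull (?S - min_face ?\<Omega> Pt)" and F: "min_face ?\<Omega> Pt \<in> pfaces ?\<Omega>"
    using direction_decomposition[OF fin S active_rep_hull[OF fin rep] l(2)] by metis
  define c where "c = l / M"
  have c: "c > 0" using l M by (simp add: c_def)
  have "M *\<^sub>R (Pt - N) = M *\<^sub>R (c *\<^sub>R u)" using M by (simp add: c_def)
  then have PN: "Pt - N = c *\<^sub>R u" by (rule scaleR_left_imp_eq[OF less_imp_neq[OF M(1), symmetric]])
  define \<rho> where "\<rho> = norm (Pt - N)"
  have \<rho>: "\<rho> = c * \<pi>" "\<rho> > 0" using c \<pi> by (auto simp: \<rho>_def PN)
  have N_S: "N \<in> convex hull ?S" using N hull_mono[of "?S - min_face ?\<Omega> Pt" ?S] by blast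
  then have N\<Omega>: "N \<in> ?\<Omega>" using S hull_mono by blast
  have orth: "?n \<bullet> u = 0" unfolding u_def by (rule closest_tangent_orth[OF convex_convex_hull x\<Omega>])
  have "g \<bullet> (Pt - N) = c * \<pi>\<^sup>2" unfolding PN using orth by (simp add: \<pi>(2) power2_norm_eq_inner inner_diff_left)
  then have "\<rho> * \<pi> \<le> h" using h[OF M(2) N_S] by (simp add: \<rho>(1) power2_eq_square)
  then have \<rho>R: "\<rho> \<le> R * D" unfolding R_def \<pi>_def[symmetric] using \<pi> D(2) by (simp add: pos_le_divide_eq)
  have "\<rho> / D \<le> R" using \<rho>R D(2) by (simp add: pos_divide_le_eq)
  then have \<rho>R2: "(\<rho> / D)\<^sup>2 \<le> R\<^sup>2" using \<rho> D(2) by (intro power_mono) auto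
  have nN: "?n \<bullet> N = ?n \<bullet> x"
  proof (rule antisym[OF n_le[OF N\<Omega>]])
    show "?n \<bullet> x \<le> ?n \<bullet> N" by (rule inner_ge_convex_hull[OF _ N_S]) (use n_S in simp)
  qed
  have "?n \<bullet> (Pt - N) = 0" unfolding PN using orth by simp
  then have nP: "?n \<bullet> Pt = ?n \<bullet> x" using nN by (simp add: inner_diff_right)
  have n_F: "?n \<bullet> b = ?n \<bullet> x" if b: "b \<in> min_face ?\<Omega> Pt" for b
  proof -
    have face: "min_face ?\<Omega> Pt \<subseteq> ?\<Omega>" by (rule face_of_imp_subset[OF min_face_face_of[OF convex_convex_hull M(2)]])
    obtain e y where e: "0 < e" "e < 1" "y \<in> min_face ?\<Omega> Pt" "Pt = e *\<^sub>R b + (1 - e) *\<^sub>R y"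
      using min_face_split[OF convex_convex_hull M(2) b] by blast
    have "e * (?n \<bullet> b) + (1 - e) * (?n \<bullet> y) = ?n \<bullet> x" using nP by (subst (asm) e(4)) (simp add: inner_add_right)
    moreover have "(1 - e) * (?n \<bullet> y) \<le> (1 - e) * (?n \<bullet> x)" using n_le[of y] e(2,3) face by (intro mult_left_mono) auto
    ultimately have "e * (?n \<bullet> x) \<le> e * (?n \<bullet> b)" by (simp add: algebra_simps)
    then show ?thesis using e(1) n_le[of b] b face by auto
  qed
  define B where "B = A \<inter> min_face ?\<Omega> Pt"
  have FB: "min_face ?\<Omega> Pt = convex hull B" unfolding B_def
    by (rule face_eq_hull_atoms[OF fin]) (use F in \<open>auto simp: pfaces_def\<close>)
  have PtB: "Pt \<in> convex hull B" using mem_min_face[of Pt ?\<Omega>] FB by simp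
  have sub: "?S - min_face ?\<Omega> Pt \<subseteq> A - B - {q}" using S q by (auto simp: B_def)
  have NB: "N \<in> convex hull (A - B - {q})" using N hull_mono[OF sub] by blast
  then have ne: "A - B - {q} \<noteq> {}" using NB by (metis convex_hull_empty empty_iff)
  have NB': "N \<in> convex hull (A - B)" using NB hull_mono[of "A - B - {q}" "A - B"] by blast
  have BA: "B \<subseteq> A" "B \<noteq> A" using ne by (auto simp: B_def)
  have seg: "a + \<theta> *\<^sub>R (z - a) \<in> convex hull C" if "a \<in> convex hull C" "z \<in> convex hull C" "0 \<le> \<theta>" "\<theta> \<le> 1" for a z C \<theta>
    using convexD_alt[OF convex_convex_hull that] by (simp add: algebra_simps)
  have q\<Omega>: "q \<in> ?\<Omega>" using q(1) by (rule hull_inc)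
  have far: "P * (1 + P / 4) \<le> R\<^sup>2" if qB: "q \<notin> B"
  proof (cases "norm (q - N) \<le> norm (q - Pt)")
    case True
    have "P + P\<^sup>2 / 4 \<le> (norm (Pt - N) / D)\<^sup>2" unfolding P_def
    proof (rule width_pinch_far[OF _ _ D(2) True W])
      fix \<theta> :: real assume \<theta>: "0 \<le> \<theta>" "\<theta> \<le> 1"
      have "Pt + \<theta> *\<^sub>R (q - Pt) \<in> convex hull (insert q B)"
        using PtB hull_mono[of B "insert q B"] by (intro seg \<theta>) (auto intro: hull_inc)
      moreover have "A - insert q B = A - B - {q}" by auto
      then have "N \<in> convex hull (A - insert q B)" using NB by simp
      ultimately show "PWidth A \<le> norm (Pt + \<theta> *\<^sub>R (q - Pt) - N)"
        using BA q(1) ne by (intro simplex_partition_width[OF fin indep, of "insert q B"]) auto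
    qed (use D M(2) N\<Omega> q\<Omega> in auto)
    then show ?thesis using \<rho>R2 by (simp add: \<rho>_def power2_eq_square algebra_simps)
  next
    case False
    have "P + P\<^sup>2 / 4 \<le> (norm (N - Pt) / D)\<^sup>2" unfolding P_def
    proof (rule width_pinch_far[OF _ _ D(2) _ W])
      fix \<theta> :: real assume \<theta>: "0 \<le> \<theta>" "\<theta> \<le> 1"
      have "N + \<theta> *\<^sub>R (q - N) \<in> convex hull (A - B)"
        using NB' q(1) qB by (intro seg \<theta>) (auto intro: hull_inc)
      then have "PWidth A \<le> norm (Pt - (N + \<theta> *\<^sub>R (q - N)))"
        by (rule simplex_partition_width[OF fin indep BA PtB])
      then show "PWidth A \<le> norm (N + \<theta> *\<^sub>R (q - N) - Pt)" by (simp add: norm_minus_commute)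
    qed (use D M(2) N\<Omega> q\<Omega> False in auto)
    then show ?thesis using \<rho>R2 by (simp add: \<rho>_def norm_minus_commute power2_eq_square algebra_simps)
  qed
  show "?n \<bullet> q < ?n \<bullet> x \<Longrightarrow> P * (1 + P / 4) \<le> R\<^sup>2"
    using n_F[of q] far by (auto simp: B_def)
  assume P12: "2 * P \<le> 1" and G: "1 / 2 \<le> G" "G \<le> 1"
    and gq: "\<And>n. n \<in> convex hull ?S \<Longrightarrow> g \<bullet> (q - n) \<le> G * h"
  show "P * (1 + P * (1 - G)\<^sup>2) \<le> R\<^sup>2"
  proof (cases "q \<in> B")
    case False
    have "P * (1 + P * (1 - G)\<^sup>2) \<le> P * (1 + P * (1 / 2)\<^sup>2)"
      using G by (intro mult_left_mono add_left_mono power_mono) (auto simp: P_def)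
    then show ?thesis using far[OF False] by (simp add: power_divide)
  next
    case True
    show ?thesis unfolding P_def
    proof (rule width_pinch_near[OF _ D(2) W _ G])
      show "norm (Pt - N) \<le> R * D" using \<rho>R by (simp add: \<rho>_def)
      have "u \<bullet> (q - N) = g \<bullet> (q - N)" using n_F[of q] nN True by (simp add: B_def inner_diff_left inner_diff_right)
      then have "(q - N) \<bullet> u \<le> G * h" using gq[OF N_S] by (simp add: inner_commute)
      then have "c * ((q - N) \<bullet> u) \<le> c * (G * h)" using c by (intro mult_left_mono) auto
      also have "c * (G * h) = G * R * D * norm (Pt - N)"
        unfolding \<rho>_def[symmetric] \<rho>(1) R_def \<pi>_def[symmetric] using \<pi> D(2) by simp
      finally show "(q - N) \<bullet> (Pt - N) \<le> G * R * D * norm (Pt - N)" by (simp add: PN)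
      fix \<theta> :: real assume \<theta>: "0 \<le> \<theta>" "\<theta> \<le> 1"
      have "Pt + \<theta> *\<^sub>R (q - Pt) \<in> convex hull B" using PtB True by (intro seg \<theta>) (auto intro: hull_inc)
      then show "PWidth A \<le> norm (Pt + \<theta> *\<^sub>R (q - Pt) - N)"
        by (rule simplex_partition_width[OF fin indep BA _ NB'])
    qed (use D M(2) q\<Omega> P12 in \<open>auto simp: P_def\<close>)
  qed
qed

section \<open>Paying for full steps by short ones\<close>

context pairwise_KL
begin

lemma r_mono: "i \<le> j \<Longrightarrow> r j \<le> r i"
  by (rule lift_Suc_antimono_le[of r]) (rule r_Suc)

text \<open>It is enough to bound the progress over the blocks that end with a short step.\<close>

lemma rate_holds_blocks:
  assumes block: "\<And>b K. \<lbrakk>K0 \<le> b; b \<le> K; bar K; \<And>k. b \<le> k \<Longrightarrow> k < K \<Longrightarrow> \<not> bar k\<rbrakk> \<Longrightarrow>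
    r (Suc K) \<le> (1 - T) ^ Suc (card {k\<in>{b..<K}. full k}) * r b"
  shows "rate_holds"
proof -
  let ?c = "count_before (\<lambda>k. bar k \<or> full k)" and ?q = "1 - T"
  have q: "0 < ?q" "?q \<le> 1" using T_less_1 T_nonneg by auto
  obtain N where N: "\<And>n. \<exists>m\<in>{n..n + N}. bar m" using hop_block by blast
  have c_add: "?c k = ?c b + card {i\<in>{b..<k}. full i}"
    if "b \<le> k" "\<And>i. b \<le> i \<Longrightarrow> i < k \<Longrightarrow> \<not> bar i" for b k
    using that
  proof (induction k rule: dec_induct)
    case (step k)
    have "{i\<in>{b..<Suc k}. full i} = {i\<in>{b..<k}. full i} \<union> (if full k then {k} else {})"
      using step.hyps by (auto simp: less_Suc_eq)
    then show ?case using step by (simp add: count_before_Suc)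
  qed simp
  have late: "\<exists>b. K0 \<le> b \<and> b \<le> k \<and> k \<le> b + N \<and> (\<forall>i. b \<le> i \<longrightarrow> i < k \<longrightarrow> \<not> bar i) \<and> r b \<le> ?q ^ (?c b - ?c K0) * r K0"
    if "K0 \<le> k" for k
    using that
  proof (induction k rule: dec_induct)
    case base
    then show ?case by (intro exI[of _ K0]) auto
  next
    case (step k)
    then obtain b where b: "K0 \<le> b" "b \<le> k" "k \<le> b + N" "\<And>i. b \<le> i \<Longrightarrow> i < k \<Longrightarrow> \<not> bar i"
      "r b \<le> ?q ^ (?c b - ?c K0) * r K0" by auto
    show ?case
    proof (cases "bar k")
      case True
      let ?m = "Suc (card {i\<in>{b..<k}. full i})"
      have "r (Suc k) \<le> ?q ^ ?m * r b" by (rule block[OF b(1,2) True b(4)])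
      also have "\<dots> \<le> ?q ^ ?m * (?q ^ (?c b - ?c K0) * r K0)" using b(5) q by (intro mult_left_mono) auto
      also have "\<dots> = ?q ^ (?m + (?c b - ?c K0)) * r K0" by (simp add: power_add)
      also have "?m + (?c b - ?c K0) = ?c (Suc k) - ?c K0"
        using c_add[OF b(2,4)] True count_before_mono[OF b(1), of "\<lambda>k. bar k \<or> full k"] by (simp add: count_before_Suc)
      finally show ?thesis using b(1,2) by (intro exI[of _ "Suc k"]) auto
    next
      case False
      obtain m where "b \<le> m" "m \<le> b + N" "bar m" using N[of b] by auto
      then have "Suc k \<le> b + N" using b(4)[of m] False by (metis le_less_linear le_neq_implies_less less_le_trans not_less_eq_eq)
      then show ?thesis using b False by (intro exI[of _ b]) (auto simp: less_Suc_eq)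
    qed
  qed
  show ?thesis unfolding rate_holds_def
  proof (rule rate_from_late_rate[where r = r and q = "1 - T" and K = K0 and C = "r K0 / ?q ^ N"])
    fix k assume "K0 \<le> k"
    then obtain b where b: "K0 \<le> b" "b \<le> k" "k \<le> b + N" "\<And>i. b \<le> i \<Longrightarrow> i < k \<Longrightarrow> \<not> bar i"
      "r b \<le> ?q ^ (?c b - ?c K0) * r K0" using late by blast
    have "card {i\<in>{b..<k}. full i} \<le> card {b..<k}" by (rule card_mono) auto
    then have "?c k - ?c K0 \<le> N + (?c b - ?c K0)" using c_add[OF b(2,4)] b(3) by simp
    then have "?q ^ (N + (?c b - ?c K0)) \<le> ?q ^ (?c k - ?c K0)" using q by (intro power_decreasing) auto
    then have "?q ^ (?c b - ?c K0) \<le> ?q ^ (?c k - ?c K0) / ?q ^ N" using q by (simp add: power_add pos_le_divide_eq mult.commute)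
    then have "?q ^ (?c b - ?c K0) * r K0 \<le> ?q ^ (?c k - ?c K0) / ?q ^ N * r K0"
      using r_nonneg by (intro mult_right_mono) auto
    then show "r k \<le> r K0 / ?q ^ N * ?q ^ (?c k - ?c K0)" using r_mono[OF b(2)] b(5) by (simp add: mult_ac)
  qed (use r_nonneg r_Suc q r_pos in auto)
qed

text \<open>If the slope quotient at a short step has the first improvement of
  \<open>simplex_slope\<close>, then this step gains enough to make up for a preceding full step
  that contracts by \<open>inverse (1 + \<mu> / L)\<close> only: the two sides differ by
  \<open>\<mu> / L\<close> times a square.\<close>

lemma bar_pays_full:
  assumes "bar k" "(1 + P / 4) * (\<omega> k)\<^sup>2 \<le> (h k / (L * D\<^sup>2))\<^sup>2" "T > 0"
  shows "r (Suc k) \<le> (1 + \<mu> / L) * (1 - T)\<^sup>2 * r k"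
proof (rule r_rate[OF _ assms(3)])
  define t where "t = \<mu> / L"
  have t: "t \<ge> 0" "T = t * P" using \<mu> L by (auto simp: t_def T_def)
  have "0 \<le> t * (1 - P / 2 - t * P)\<^sup>2" using t(1) by (intro mult_nonneg_nonneg) auto
  also have "\<dots> = (1 + t) * (1 - T)\<^sup>2 - (1 - T * (1 + P / 4))"
    unfolding t(2) by (simp add: power2_eq_square algebra_simps)
  finally have le: "1 - T * (1 + P / 4) \<le> (1 + t) * (1 - T)\<^sup>2" by simp
  have "(\<omega> (Suc k))\<^sup>2 \<le> (\<omega> k)\<^sup>2 - T * ((1 + P / 4) * (\<omega> k)\<^sup>2)"
    using bar_\<omega>[OF assms(1)] mult_left_mono[OF assms(2) T_nonneg] by linarith
  also have "\<dots> = (1 - T * (1 + P / 4)) * (\<omega> k)\<^sup>2" by (simp add: algebra_simps)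
  also have "\<dots> \<le> (1 + t) * (1 - T)\<^sup>2 * (\<omega> k)\<^sup>2" by (rule mult_right_mono[OF le]) simp
  finally show "(\<omega> (Suc k))\<^sup>2 \<le> (1 + \<mu> / L) * (1 - T)\<^sup>2 * (\<omega> k)\<^sup>2" unfolding t_def .
qed

lemma slope_pos: "slope (x k) > 0"
proof -
  have "0 < 2 * \<mu> * r k" using \<mu> r_pos[of k] by simp
  then have "0 < (slope (x k))\<^sup>2" using KL[of k] by linarith
  then show ?thesis using proj_slope_nonneg[of \<Omega> "x k"] by (simp add: order_less_le)
qed

lemma slope_quotient:
  assumes "P * c \<le> (h k / (slope (x k) * D))\<^sup>2" "T > 0"
  shows "c * (\<omega> k)\<^sup>2 \<le> (h k / (L * D\<^sup>2))\<^sup>2"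
proof -
  define R where "R = h k / (slope (x k) * D)"
  have P: "P > 0" by (rule P_pos[OF assms(2)])
  have R0: "R \<ge> 0" unfolding R_def
    by (intro divide_nonneg_nonneg mult_nonneg_nonneg less_imp_le[OF descent_dir] less_imp_le[OF slope_pos] less_imp_le[OF D_pos])
  have "R * D * (L * D\<^sup>2 * \<omega> k) \<le> W * h k"
  proof (rule h_ge_of_slope)
    show "R * D * slope (x k) \<le> h k" using slope_pos[of k] D_pos by (simp add: R_def)
    show "R * D \<ge> 0" using R0 D_pos by simp
  qed
  then have "(R * D * (L * D\<^sup>2 * \<omega> k))\<^sup>2 \<le> (W * h k)\<^sup>2"
    using R0 D_pos L \<omega>_nonneg by (intro power_mono) auto
  then have "R\<^sup>2 * (\<omega> k)\<^sup>2 * (D\<^sup>2 * (L * D\<^sup>2)\<^sup>2) \<le> W\<^sup>2 * (h k)\<^sup>2"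
    by (simp only: power_mult_distrib mult_ac)
  also have "W\<^sup>2 = P * D\<^sup>2" using D_pos by (simp add: P_def power_divide)
  finally have "R\<^sup>2 * (\<omega> k)\<^sup>2 * (L * D\<^sup>2)\<^sup>2 * D\<^sup>2 \<le> P * (h k)\<^sup>2 * D\<^sup>2" by (simp only: mult_ac)
  then have 1: "R\<^sup>2 * (\<omega> k)\<^sup>2 * (L * D\<^sup>2)\<^sup>2 \<le> P * (h k)\<^sup>2" by (rule mult_right_le_imp_le) (use D_pos in auto)
  have "P * c * ((\<omega> k)\<^sup>2 * (L * D\<^sup>2)\<^sup>2) \<le> R\<^sup>2 * ((\<omega> k)\<^sup>2 * (L * D\<^sup>2)\<^sup>2)"
    using assms(1) by (intro mult_right_mono) (auto simp: R_def)
  also have "\<dots> \<le> P * (h k)\<^sup>2" using 1 by (simp only: mult.assoc)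
  finally have "P * (c * (\<omega> k)\<^sup>2 * (L * D\<^sup>2)\<^sup>2) \<le> P * (h k)\<^sup>2" by (simp only: mult_ac)
  then have "c * (\<omega> k)\<^sup>2 * (L * D\<^sup>2)\<^sup>2 \<le> (h k)\<^sup>2" by (rule mult_left_le_imp_le[OF _ P])
  moreover have "(L * D\<^sup>2)\<^sup>2 > 0" using L D_pos by simp
  ultimately show ?thesis unfolding power_divide by (subst pos_le_divide_eq)
qed

lemma hop_\<alpha>_less: "\<not> bar k \<Longrightarrow> \<alpha> k * (L * (norm (d k))\<^sup>2) < h k"
proof -
  assume "\<not> bar k"
  then have "\<alpha> k < h k / (L * (norm (d k))\<^sup>2)" using hop[of k] unfolding short_step_def by blast
  then show ?thesis using L d_nonzero[of k] by (subst (asm) pos_less_divide_eq) auto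
qed

lemma hop_weights:
  assumes "\<not> bar k"
  shows "w (Suc k) (q k) = 0" "w (Suc k) (s k) = w k (s k) + \<alpha> k" "w (Suc k) (s k) > 0"
    "a \<noteq> s k \<Longrightarrow> a \<noteq> q k \<Longrightarrow> w (Suc k) a = w k a"
  using w_Suc[of k] hop[OF assms] s_neq_q[of k] \<alpha>_pos[of k] w_nonneg[OF s_in, of k k] by auto

text \<open>The slope in the direction of the step stays positive up to the short stepsize, which a
  hop does not reach.\<close>

lemma hop_order:
  assumes "\<not> bar k"
  shows "g (Suc k) \<bullet> q k < g (Suc k) \<bullet> s k"
proof -
  have "(g k - g (Suc k)) \<bullet> d k \<le> norm (g k - g (Suc k)) * norm (d k)" by (rule norm_cauchy_schwarz)
  also have "\<dots> \<le> L * norm (x (Suc k) - x k) * norm (d k)"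
    using lip[OF x_in x_in, of "Suc k" k] by (intro mult_right_mono) (auto simp: norm_minus_commute)
  also have "\<dots> = \<alpha> k * (L * (norm (d k))\<^sup>2)" using \<alpha>_nonneg by (simp add: x_Suc power2_eq_square)
  also have "\<dots> < h k" by (rule hop_\<alpha>_less[OF assms])
  finally have "g (Suc k) \<bullet> d k > 0" by (simp add: inner_diff_left)
  then show ?thesis by (simp add: d_eq inner_diff_right)
qed

text \<open>If the remainder of the projection did not separate \<open>q k\<close> from the new
  point, then it would vanish on \<open>d k\<close>. Since the old gradient has no ascent along the
  projection \<open>u\<close>, the component of \<open>d k\<close> orthogonal to \<open>u\<close>
  (or \<open>d k\<close> itself) would exhibit a change of the gradient by at least \<open>h k /
  norm (d k)\<close>, more than a hop can cause.\<close>

lemma full_hop_leaves_face: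
  assumes "full k" "\<not> bar k"
  defines "u \<equiv> closest_point (tangent_cone \<Omega> (x (Suc k))) (g (Suc k))"
  shows "(g (Suc k) - u) \<bullet> q k < (g (Suc k) - u) \<bullet> x (Suc k)"
proof (rule ccontr)
  let ?g' = "g (Suc k)"
  assume no: "\<not> ?thesis"
  have q: "(?g' - u) \<bullet> q k \<le> (?g' - u) \<bullet> x (Suc k)"
    unfolding u_def by (rule closest_tangent_remainder(1)[OF fin rep]) (auto intro: hull_inc q_in)
  have "s k \<in> S (Suc k)" using hop_weights(3)[OF assms(2)] s_in by (simp add: active_set_def)
  then have "(?g' - u) \<bullet> s k = (?g' - u) \<bullet> x (Suc k)"
    unfolding u_def by (rule closest_tangent_remainder(2)[OF fin rep])
  then have "(?g' - u) \<bullet> d k = 0" using no q by (simp add: d_eq inner_diff_right)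
  then have ud: "u \<bullet> d k = ?g' \<bullet> d k" by (simp add: inner_diff_left)
  have orth: "(?g' - u) \<bullet> u = 0" unfolding u_def by (rule closest_tangent_orth[OF convex_convex_hull x_in])
  have "u \<in> tangent_cone \<Omega> (x (Suc k))" unfolding u_def by (rule closest_tangent_in[OF convex_convex_hull x_in])
  then obtain l where l: "l > 0" "x (Suc k) + l *\<^sub>R u \<in> \<Omega>"
    using tangent_cone_polytope[of \<Omega> "x (Suc k)" u] fin x_in by (auto simp: polytope_def)
  then have "l * (g k \<bullet> u) \<le> 0" using assms(1) by (auto simp: full_def inner_add_right)
  then have gu: "g k \<bullet> u \<le> 0" using l(1) by (simp add: zero_le_mult_iff)
  define e where "e = g k - ?g'"
  have eu: "e \<bullet> u \<le> - (u \<bullet> u)" using gu orth by (simp add: e_def inner_diff_left)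
  have ed: "e \<bullet> d k = h k - u \<bullet> d k" using ud by (simp add: e_def inner_diff_left)
  have u0: "u \<bullet> u > 0" using slope_pos[of "Suc k"] by (simp add: proj_slope_def u_def)
  have "\<exists>v. norm v \<le> norm (d k) \<and> h k \<le> e \<bullet> v"
  proof (cases "u \<bullet> d k \<le> 0")
    case True
    then show ?thesis using ed by (intro exI[of _ "d k"]) simp
  next
    case False
    define \<kappa> where "\<kappa> = (u \<bullet> d k) / (u \<bullet> u)"
    have \<kappa>: "\<kappa> > 0" "\<kappa> * (u \<bullet> u) = u \<bullet> d k" using False u0 by (auto simp: \<kappa>_def)
    have "e \<bullet> (d k - \<kappa> *\<^sub>R u) = h k - u \<bullet> d k - \<kappa> * (e \<bullet> u)" by (simp add: inner_diff_right ed)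
    moreover have "\<kappa> * (e \<bullet> u) \<le> \<kappa> * - (u \<bullet> u)" using eu \<kappa>(1) by (intro mult_left_mono) auto
    ultimately have 1: "h k \<le> e \<bullet> (d k - \<kappa> *\<^sub>R u)" using \<kappa>(2) by simp
    have "(norm (d k - \<kappa> *\<^sub>R u))\<^sup>2 = (norm (d k))\<^sup>2 - 2 * \<kappa> * (u \<bullet> d k) + \<kappa> * (\<kappa> * (u \<bullet> u))"
      unfolding power2_norm_eq_inner by (simp add: algebra_simps inner_commute)
    also have "\<dots> = (norm (d k))\<^sup>2 - \<kappa> * (u \<bullet> d k)" unfolding \<kappa>(2) by simp
    also have "\<dots> \<le> (norm (d k))\<^sup>2" using \<kappa>(1) False by simp
    finally have "norm (d k - \<kappa> *\<^sub>R u) \<le> norm (d k)" by (rule power2_le_imp_le) simp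
    then show ?thesis using 1 by blast
  qed
  then obtain v where v: "norm v \<le> norm (d k)" "h k \<le> e \<bullet> v" by blast
  have "e \<bullet> v \<le> norm e * norm v" by (rule norm_cauchy_schwarz)
  also have "\<dots> \<le> (L * norm (x (Suc k) - x k)) * norm (d k)"
    using lip[OF x_in x_in, of "Suc k" k] v(1) L by (intro mult_mono) (auto simp: e_def norm_minus_commute)
  also have "\<dots> = \<alpha> k * (L * (norm (d k))\<^sup>2)" using \<alpha>_nonneg by (simp add: x_Suc power2_eq_square)
  also have "\<dots> < h k" by (rule hop_\<alpha>_less[OF assms(2)])
  finally show False using v(2) by simp
qed

lemma block_rate:
  assumes "b \<le> K" "\<And>k. b \<le> k \<Longrightarrow> k < K \<Longrightarrow> Q k \<Longrightarrow> r (Suc k) \<le> (1 - T) * r k"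
  shows "r K \<le> (1 - T) ^ card {k\<in>{b..<K}. Q k} * r b"
  using assms
proof (induction K rule: dec_induct)
  case (step K)
  have IH: "r K \<le> (1 - T) ^ card {k\<in>{b..<K}. Q k} * r b" using step.IH step.prems by simp
  have eq: "{k\<in>{b..<Suc K}. Q k} = {k\<in>{b..<K}. Q k} \<union> (if Q K then {K} else {})"
    using step.hyps by (auto simp: less_Suc_eq)
  show ?case
  proof (cases "Q K")
    case True
    have "r (Suc K) \<le> (1 - T) * r K" using step.prems[of K] step.hyps True by simp
    also have "\<dots> \<le> (1 - T) * ((1 - T) ^ card {k\<in>{b..<K}. Q k} * r b)"
      using IH T_less_1 by (intro mult_left_mono) auto
    finally show ?thesis unfolding eq using True by (simp add: mult_ac)
  next
    case False
    then show ?thesis unfolding eq using IH r_Suc[of K] by simp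
  qed
qed simp

end

locale simplex_KL = pairwise_KL +
  assumes indep: "\<not> affine_dependent A" and T_pos: "T > 0"
begin

lemma inactive_slope:
  assumes "a \<in> A" "a \<notin> S k"
  shows "(g k - closest_point (tangent_cone \<Omega> (x k)) (g k)) \<bullet> a < (g k - closest_point (tangent_cone \<Omega> (x k)) (g k)) \<bullet> x k
      \<Longrightarrow> (1 + P / 4) * (\<omega> k)\<^sup>2 \<le> (h k / (L * D\<^sup>2))\<^sup>2"
    and "\<lbrakk>2 * P \<le> 1; 1 / 2 \<le> G; G \<le> 1; g k \<bullet> (a - q k) \<le> G * h k\<rbrakk>
      \<Longrightarrow> (1 + P * (1 - G)\<^sup>2) * (\<omega> k)\<^sup>2 \<le> (h k / (L * D\<^sup>2))\<^sup>2"
proof -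
  note * = simplex_slope[OF fin indep norm_le_D D_pos rep PWidth_nonneg gap_le_h slope_pos assms, folded P_def]
  show "(1 + P / 4) * (\<omega> k)\<^sup>2 \<le> (h k / (L * D\<^sup>2))\<^sup>2"
    if "(g k - closest_point (tangent_cone \<Omega> (x k)) (g k)) \<bullet> a < (g k - closest_point (tangent_cone \<Omega> (x k)) (g k)) \<bullet> x k"
    by (rule slope_quotient[OF *(1) T_pos]) (assumption | rule that)+
  assume G: "2 * P \<le> 1" "1 / 2 \<le> G" "G \<le> 1" "g k \<bullet> (a - q k) \<le> G * h k"
  show "(1 + P * (1 - G)\<^sup>2) * (\<omega> k)\<^sup>2 \<le> (h k / (L * D\<^sup>2))\<^sup>2"
  proof (rule slope_quotient[OF *(2)[OF _ _ _ _ G(1-3)] T_pos])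
    fix n assume n: "n \<in> convex hull (S k)"
    have "g k \<bullet> q k \<le> g k \<bullet> n" by (rule inner_ge_convex_hull[OF q_min n])
    then show "g k \<bullet> (a - n) \<le> G * h k" using G(4) by (simp add: inner_diff_right)
  qed assumption+
qed

text \<open>A full hop empties one of three atoms, which is not attractive at the next step either.
  A further hop would lead to a vertex, which happens only finitely often. So the next step is
  short, and pays for the full one.\<close>

lemma rate_holds_triangle:
  assumes "card A \<le> 3"
  shows "rate_holds"
proof -
  have "inj x"
  proof (rule linorder_injI)
    fix i j :: nat assume "i < j"
    then show "x i \<noteq> x j" using f_strict_less[of i j] by auto
  qed
  then have "finite (x -` A)" using fin by (intro finite_vimageI)
  then obtain K1 where K1: "\<And>k. k \<ge> K1 \<Longrightarrow> x k \<notin> A"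
    by (metis finite_nat_set_iff_bounded leD vimage_eq)
  have next_bar: "bar (Suc k)" if k: "k \<ge> K1" "\<not> bar k" for k
  proof (rule ccontr)
    assume nb: "\<not> bar (Suc k)"
    let ?s = "s (Suc k)" and ?q = "q (Suc k)"
    have 1: "?s \<noteq> q k" using hop_order[OF k(2)] s_max[of "s k" "Suc k"] s_in hull_inc[of "s k" A convex] by force
    have 2: "?q \<noteq> q k" using hop_weights(1)[OF k(2)] q_active[of "Suc k"] by (auto simp: active_set_def)
    have sub: "{q k, ?s, ?q} \<subseteq> A" using q_in s_in by auto
    have "card {q k, ?s, ?q} = 3" using 1 2 s_neq_q[of "Suc k"] by simp
    then have A: "A = {q k, ?s, ?q}" using card_seteq[OF fin sub] assms by simp
    have "w (Suc (Suc k)) (q k) = 0" using hop_weights(4)[OF nb] hop_weights(1)[OF k(2)] 1 2 by metis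
    moreover have "w (Suc (Suc k)) ?q = 0" by (rule hop_weights(1)[OF nb])
    moreover have "sum (w (Suc (Suc k))) A = 1" using rep by (auto simp: active_rep_def)
    then have "w (Suc (Suc k)) (q k) + (w (Suc (Suc k)) ?s + w (Suc (Suc k)) ?q) = 1"
      by (subst (asm) A) (use 1 2 s_neq_q[of "Suc k"] in simp)
    ultimately have "x (Suc (Suc k)) = ?s" by (intro active_rep_eq_atom[OF fin rep s_in]) simp
    then show False using K1[of "Suc (Suc k)"] k(1) s_in by simp
  qed
  show ?thesis
  proof (rule rate_holds_blocks[of K1])
    fix b K
    assume b: "K1 \<le> b" "b \<le> K" "bar K" and nb: "\<And>k. b \<le> k \<Longrightarrow> k < K \<Longrightarrow> \<not> bar k"
    show "r (Suc K) \<le> (1 - T) ^ Suc (card {k\<in>{b..<K}. full k}) * r b"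
    proof (cases "\<exists>k\<in>{b..<K}. full k")
      case False
      then have none: "{k\<in>{b..<K}. full k} = {}" by auto
      have "(1 - T) * r K \<le> (1 - T) * r b"
        using T_less_1 by (intro mult_left_mono r_mono b(2)) auto
      then show ?thesis unfolding none using bar_rate[OF b(3)] by simp
    next
      case True
      then obtain k where k: "b \<le> k" "k < K" "full k" by auto
      have kb: "\<not> bar k" using nb k by auto
      have "bar (Suc k)" using next_bar[of k] k b kb by auto
      then have K: "K = Suc k" using nb[of "Suc k"] k by (metis Suc_lessI le_SucI)
      have "b = k" using next_bar[of b] nb[of b] nb[of "Suc b"] k b K by (metis Suc_lessI le_SucI lessI less_Suc_eq less_le_not_le nat_less_le order_refl)
      then have "{k\<in>{b..<K}. full k} = {k}" using k K by auto
      have "q k \<notin> S K" using hop_weights(1)[OF kb] by (simp add: K active_set_def)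
      then have "(1 + P / 4) * (\<omega> K)\<^sup>2 \<le> (h K / (L * D\<^sup>2))\<^sup>2"
        by (rule inactive_slope(1)[OF q_in]) (use full_hop_leaves_face[OF k(3) kb] K in simp)
      then have "r (Suc K) \<le> (1 + \<mu> / L) * (1 - T)\<^sup>2 * r K" by (rule bar_pays_full[OF b(3) _ T_pos])
      also have "\<dots> = (1 - T)\<^sup>2 * ((1 + \<mu> / L) * r (Suc k))" by (simp add: K)
      also have "\<dots> \<le> (1 - T)\<^sup>2 * r k" using full_r[OF k(3)] by (intro mult_left_mono) auto
      finally show ?thesis using \<open>b = k\<close> \<open>{k\<in>{b..<K}. full k} = {k}\<close> by (simp add: power2_eq_square)
    qed
  qed
qed

lemma P_eq: "P * D\<^sup>2 = W\<^sup>2"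
  using D_pos by (simp add: P_def power_divide)

text \<open>Before a full hop all active atoms but \<open>q\<close> are maximizers. So the
  linearisation decreases only with the barycentric coordinate of \<open>q\<close>, whose gradient
  is the inverse of the altitude.\<close>

lemma full_hop_slope:
  assumes full: "full k" and nb: "\<not> bar k" and p: "p \<noteq> q k"
    and orth: "\<And>r. r \<in> A \<Longrightarrow> r \<noteq> q k \<Longrightarrow> (q k - p) \<bullet> (r - p) = 0"
  shows "norm (q k - p) * slope (x k) \<le> h k"
proof -
  define e where "e = q k - p"
  have e0: "norm e > 0" using p by (simp add: e_def)
  have e_atom: "e \<bullet> (a - p) = (if a = q k then (norm e)\<^sup>2 else 0)" if "a \<in> A" for a
    using orth[OF that] by (simp add: e_def power2_norm_eq_inner)
  have w: "sum (w k) A = 1" "x k = (\<Sum>a\<in>A. w k a *\<^sub>R a)" using rep[of k] by (auto simp: active_rep_def)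
  have "x k - p = (\<Sum>a\<in>A. w k a *\<^sub>R (a - p))"
    using w by (simp add: scaleR_diff_right sum_subtractf flip: scaleR_sum_left)
  then have "e \<bullet> (x k - p) = (\<Sum>a\<in>A. w k a * (e \<bullet> (a - p)))" by (simp add: inner_sum_right)
  also have "\<dots> = (\<Sum>a\<in>A. if a = q k then w k a * (norm e)\<^sup>2 else 0)"
    by (rule sum.cong) (auto simp: e_atom)
  also have "\<dots> = \<alpha> k * (norm e)\<^sup>2" using q_in fin hop[OF nb] by simp
  finally have ex: "e \<bullet> (x k - p) = \<alpha> k * (norm e)\<^sup>2" .
  have "g k \<bullet> s k \<le> g k \<bullet> x (Suc k)" using full hull_inc[of "s k" A convex, OF s_in] by (simp add: full_def)
  then have gx: "g k \<bullet> s k \<le> g k \<bullet> x k + \<alpha> k * h k" by (simp add: x_Suc inner_add_right)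
  let ?c = "g k + (h k / (norm e)\<^sup>2) *\<^sub>R e"
  have "slope (x k) \<le> h k / norm e"
  proof (rule proj_slope_le[OF convex_convex_hull x_in])
    fix y assume y: "y \<in> \<Omega>"
    have "?c \<bullet> y \<le> g k \<bullet> s k + h k / (norm e)\<^sup>2 * (e \<bullet> p)"
    proof (rule inner_le_convex_hull[OF _ y])
      fix a assume a: "a \<in> A"
      have "h k / (norm e)\<^sup>2 * (e \<bullet> a) = h k / (norm e)\<^sup>2 * (e \<bullet> p) + (if a = q k then h k else 0)"
        using e_atom[OF a] e0 by (simp add: inner_diff_right algebra_simps split: if_splits)
      moreover have "g k \<bullet> a + (if a = q k then h k else 0) \<le> g k \<bullet> s k"
        using s_max[of a k] hull_inc[of a A convex, OF a] by (simp add: d_eq inner_diff_right)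
      ultimately show "?c \<bullet> a \<le> g k \<bullet> s k + h k / (norm e)\<^sup>2 * (e \<bullet> p)" unfolding inner_add_left inner_scaleR_left by linarith
    qed
    moreover have "g k \<bullet> s k + h k / (norm e)\<^sup>2 * (e \<bullet> p) \<le> ?c \<bullet> x k"
    proof -
      have "h k / (norm e)\<^sup>2 * (e \<bullet> (x k - p)) = \<alpha> k * h k" unfolding ex using e0 by simp
      then have "h k / (norm e)\<^sup>2 * (e \<bullet> x k) = h k / (norm e)\<^sup>2 * (e \<bullet> p) + \<alpha> k * h k"
        unfolding inner_diff_right right_diff_distrib by linarith
      then show ?thesis using gx unfolding inner_add_left inner_scaleR_left by linarith
    qed
    ultimately have "g k \<bullet> (y - x k) \<le> h k / (norm e)\<^sup>2 * (e \<bullet> (x k - y))"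
      unfolding inner_add_left inner_scaleR_left inner_diff_right right_diff_distrib by linarith
    also have "\<dots> \<le> h k / (norm e)\<^sup>2 * (norm e * norm (x k - y))"
      by (intro mult_left_mono norm_cauchy_schwarz divide_nonneg_nonneg less_imp_le[OF descent_dir]) auto
    also have "\<dots> = h k / norm e * norm (y - x k)"
      using e0 by (simp add: power2_eq_square norm_minus_commute)
    finally show "g k \<bullet> (y - x k) \<le> h k / norm e * norm (y - x k)" .
  next
    show "0 \<le> h k / norm e" by (intro divide_nonneg_nonneg less_imp_le[OF descent_dir]) auto
  qed
  then have "slope (x k) * norm e \<le> h k" using e0 by (simp only: pos_le_divide_eq)
  then show ?thesis by (simp only: e_def mult.commute)
qed

text \<open>In terms of the normalized length \<open>\<xi>\<close> of a full hop there are two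
  bounds for the new gap: \<open>(\<tau> * \<xi>)\<^sup>2\<close> since the step is full, and
  \<open>1 - T * (2 * e * \<xi> - \<xi>\<^sup>2)\<close> from the decrease, where \<open>e = \<tau>
  + 1 / (4 * \<tau>)\<close> is the bound for the altitude. The first one is sufficient for
  \<open>\<xi> \<le> 1 / (2 * \<tau>)\<close>, the second one from there up to \<open>2 *
  \<tau>\<close>, as these numbers are the roots of \<open>2 * e * \<xi> - \<xi>\<^sup>2 =
  1\<close>. For longer steps the decrease is at least half of its linear part, which
  suffices.\<close>

lemma rate_holds_altitude:
  assumes "T \<le> 3 / 4" "4 * P > 1" "card A \<ge> 4"
  shows "rate_holds"
proof (rule rate_holdsI[of 0])
  fix k assume full: "full k" and nb: "\<not> bar k"
  define \<tau> where "\<tau> = W / D"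
  have P\<tau>: "P = \<tau>\<^sup>2" by (simp add: P_def \<tau>_def)
  have \<tau>0: "\<tau> \<ge> 0" using PWidth_nonneg D_pos by (simp add: \<tau>_def)
  have \<tau>: "1 / 2 < \<tau>" by (rule power2_less_imp_less[OF _ \<tau>0]) (use assms(2) P\<tau> in \<open>simp add: power_divide\<close>)
  have W: "W = \<tau> * D" using D_pos by (simp add: \<tau>_def)
  have "D < 2 * W" using \<tau> D_pos by (simp add: W)
  then obtain p where p: "p \<noteq> q k" "\<And>r. r \<in> A \<Longrightarrow> r \<noteq> q k \<Longrightarrow> (q k - p) \<bullet> (r - p) = 0"
    "(W\<^sup>2 + D\<^sup>2 / 4) * norm (s k - q k) \<le> D\<^sup>2 * norm (q k - p)"
    using simplex_altitude[OF fin indep assms(3) norm_le_D D_pos _ q_in s_in s_neq_q, of k] by metis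
  have \<omega>0: "\<omega> k > 0" by (rule \<omega>_pos[OF T_pos])
  define \<xi> e where "\<xi> = \<alpha> k * norm (d k) / (D * \<omega> k)" and "e = \<tau> + 1 / (4 * \<tau>)"
  have \<xi>: "\<xi> \<ge> 0" "\<alpha> k * norm (d k) = \<xi> * (D * \<omega> k)" using \<alpha>_nonneg[of k] \<omega>0 D_pos by (auto simp: \<xi>_def)
  have e: "\<tau> * e = \<tau>\<^sup>2 + 1 / 4" using \<tau> by (simp add: e_def power2_eq_square field_simps)
  have "norm (q k - p) * (L * D\<^sup>2 * \<omega> k) \<le> W * h k"
    by (rule h_ge_of_slope[OF full_hop_slope[OF full nb p(1,2)]]) auto
  then have "D\<^sup>2 * norm (q k - p) * (L * \<omega> k) \<le> W * h k" by (simp add: mult_ac)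
  moreover have "(W\<^sup>2 + D\<^sup>2 / 4) * norm (d k) * (L * \<omega> k) \<le> D\<^sup>2 * norm (q k - p) * (L * \<omega> k)"
    using p(3) L \<omega>0 by (intro mult_right_mono) (auto simp: d_eq)
  moreover have "W\<^sup>2 + D\<^sup>2 / 4 = \<tau> * e * D\<^sup>2" unfolding e W by (simp add: power_mult_distrib algebra_simps)
  ultimately have "\<tau> * D * (e * D * norm (d k) * L * \<omega> k) \<le> \<tau> * D * h k"
    unfolding W by (simp add: power2_eq_square mult_ac)
  then have hge: "e * D * norm (d k) * L * \<omega> k \<le> h k"
    by (rule mult_left_le_imp_le) (use \<tau> D_pos in simp)
  have "\<alpha> k * (e * D * norm (d k) * L * \<omega> k) \<le> \<alpha> k * h k" by (rule mult_left_mono[OF hge \<alpha>_nonneg])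
  also have "\<alpha> k * (e * D * norm (d k) * L * \<omega> k) = (e * \<xi> * (\<omega> k)\<^sup>2) * (L * D\<^sup>2)"
    using \<xi>(2) by (simp add: power2_eq_square mult_ac)
  finally have main: "e * \<xi> * (\<omega> k)\<^sup>2 \<le> \<alpha> k * h k / (L * D\<^sup>2)" using L D_pos by (subst pos_le_divide_eq) auto
  have quad: "(\<alpha> k)\<^sup>2 * (norm (d k) / D)\<^sup>2 = \<xi>\<^sup>2 * (\<omega> k)\<^sup>2"
  proof -
    have "\<alpha> k * (norm (d k) / D) = \<xi> * \<omega> k" using \<xi>(2) D_pos by (simp add: field_simps)
    then show ?thesis by (metis power_mult_distrib)
  qed
  have "(\<omega> (Suc k))\<^sup>2 \<le> (1 - T) * (\<omega> k)\<^sup>2"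
  proof (cases "\<xi> < 1 / (2 * \<tau>)")
    case True
    then have "\<tau> * \<xi> \<le> 1 / 2" using \<tau> by (simp add: field_simps)
    then have "(\<tau> * \<xi>)\<^sup>2 \<le> (1 / 2)\<^sup>2" using \<tau>0 \<xi>(1) by (intro power_mono) auto
    also have "\<dots> \<le> 1 - T" using assms(1) by (simp add: power_divide)
    finally have "(\<tau> * \<xi>)\<^sup>2 * (\<omega> k)\<^sup>2 \<le> (1 - T) * (\<omega> k)\<^sup>2" by (intro mult_right_mono) auto
    moreover have "(\<omega> (Suc k))\<^sup>2 \<le> (\<tau> * \<xi>)\<^sup>2 * (\<omega> k)\<^sup>2"
      using full_\<omega>_dist[OF full] unfolding mult.assoc quad by (simp add: P\<tau> power_mult_distrib mult_ac)
    ultimately show ?thesis by simp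
  next
    case False
    show ?thesis
    proof (cases "\<xi> \<le> 2 * \<tau>")
      case True
      then have "0 \<le> (2 * \<tau> - \<xi>) * (\<xi> - 1 / (2 * \<tau>))" using False by (intro mult_nonneg_nonneg) auto
      also have "\<dots> = 2 * (e * \<xi>) - \<xi>\<^sup>2 - 1" using \<tau> by (simp add: e_def power2_eq_square field_simps)
      finally have *: "1 * (\<omega> k)\<^sup>2 \<le> (2 * (e * \<xi>) - \<xi>\<^sup>2) * (\<omega> k)\<^sup>2" by (intro mult_right_mono) auto
      have "(\<omega> k)\<^sup>2 \<le> 2 * \<alpha> k * h k / (L * D\<^sup>2) - (\<alpha> k)\<^sup>2 * (norm (d k) / D)\<^sup>2"
      proof -
        have "2 * \<alpha> k * h k / (L * D\<^sup>2) = 2 * (\<alpha> k * h k / (L * D\<^sup>2))" by simp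
        moreover have "(2 * (e * \<xi>) - \<xi>\<^sup>2) * (\<omega> k)\<^sup>2 = 2 * (e * \<xi> * (\<omega> k)\<^sup>2) - \<xi>\<^sup>2 * (\<omega> k)\<^sup>2" by (simp add: algebra_simps)
        ultimately show ?thesis using main * unfolding quad by linarith
      qed
      then have "T * (\<omega> k)\<^sup>2 \<le> T * (2 * \<alpha> k * h k / (L * D\<^sup>2) - (\<alpha> k)\<^sup>2 * (norm (d k) / D)\<^sup>2)"
        by (rule mult_left_mono[OF _ T_nonneg])
      then show ?thesis using \<omega>_decrease[of k] by (simp add: algebra_simps)
    next
      case False
      then have "e * (2 * \<tau>) \<le> e * \<xi>" using \<tau> by (intro mult_left_mono) (auto simp: e_def)
      moreover have "1 \<le> e * (2 * \<tau>)" using e assms(2) P\<tau> by (simp add: mult_ac)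
      ultimately have "1 * (\<omega> k)\<^sup>2 \<le> (e * \<xi>) * (\<omega> k)\<^sup>2" by (intro mult_right_mono) auto
      then have "T * (\<omega> k)\<^sup>2 \<le> T * (\<alpha> k * h k / (L * D\<^sup>2))" using main by (intro mult_left_mono[OF _ T_nonneg]) simp
      then show ?thesis using \<omega>_decrease_half[of k] by (simp add: algebra_simps)
    qed
  qed
  then show "r (Suc k) \<le> (1 - T) * r k" by (rule r_rate[OF _ T_pos])
qed

lemma grad_drift:
  assumes "i \<le> j"
  shows "(g i - g j) \<bullet> v \<le> L * (\<Sum>l\<in>{i..<j}. \<alpha> l * norm (d l)) * norm v"
proof -
  have "norm (x j - x i) \<le> (\<Sum>l\<in>{i..<j}. \<alpha> l * norm (d l))"
    using assms
  proof (induction j rule: dec_induct)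
    case (step j)
    have "norm (x (Suc j) - x i) \<le> norm (x j - x i) + norm (\<alpha> j *\<^sub>R d j)"
      using norm_triangle_ineq[of "x j - x i" "\<alpha> j *\<^sub>R d j"] by (simp add: x_Suc algebra_simps)
    then show ?case using step \<alpha>_nonneg[of j] by simp
  qed simp
  then have n: "norm (g i - g j) \<le> L * (\<Sum>l\<in>{i..<j}. \<alpha> l * norm (d l))"
    using lip[OF x_in x_in, of j i] L by (simp add: norm_minus_commute) (meson mult_left_mono less_imp_le order_trans)
  have "(g i - g j) \<bullet> v \<le> norm (g i - g j) * norm v" by (rule norm_cauchy_schwarz)
  also have "\<dots> \<le> L * (\<Sum>l\<in>{i..<j}. \<alpha> l * norm (d l)) * norm v" by (rule mult_right_mono[OF n]) simp
  finally show ?thesis .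
qed

lemma grad_drift_atoms:
  assumes "i \<le> j" "a \<in> A" "c \<in> A"
  shows "(g i - g j) \<bullet> (a - c) \<le> L * D\<^sup>2 * (\<Sum>l\<in>{i..<j}. \<alpha> l)"
proof -
  have "(g i - g j) \<bullet> (a - c) \<le> L * (\<Sum>l\<in>{i..<j}. \<alpha> l * norm (d l)) * norm (a - c)" by (rule grad_drift[OF assms(1)])
  also have "\<dots> \<le> L * (\<Sum>l\<in>{i..<j}. \<alpha> l * D) * D"
    using L \<alpha>_nonneg norm_d_le_D assms(2,3)
    by (intro mult_mono mult_left_mono sum_mono norm_le_D mult_nonneg_nonneg sum_nonneg) (auto intro: hull_inc less_imp_le[OF D_pos])
  finally show ?thesis by (simp add: sum_distrib_right[symmetric] power2_eq_square mult_ac)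
qed

lemma norm_d_ge_W: "card A \<ge> 2 \<Longrightarrow> W \<le> norm (d k)"
proof -
  assume c: "card A \<ge> 2"
  have "{s k} \<noteq> A" using c by (metis One_nat_def card.empty card_insert_if equals0D finite.emptyI not_less_eq_eq numeral_2_eq_2 order_refl)
  moreover have "q k \<in> convex hull (A - {s k})" using q_in[of k] s_neq_q[of k] by (intro hull_inc) auto
  ultimately show ?thesis unfolding d_eq using s_in[of k]
    by (intro simplex_partition_width[OF fin indep, of "{s k}"]) auto
qed

text \<open>The decrease is at least \<open>L / 2\<close> times the squared length of the step, and
  distinct vertices of a simplex have distance at least \<open>W\<close>.\<close>

lemma heavy_step:
  assumes "card A \<ge> 2" "(\<omega> k)\<^sup>2 \<le> P * (\<alpha> k)\<^sup>2"
  shows "r (Suc k) \<le> (1 - T) * r k"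
proof (rule r_rate[OF _ T_pos])
  have "P * (\<alpha> k)\<^sup>2 * (L * D\<^sup>2) = \<alpha> k * (\<alpha> k * (L * W\<^sup>2))" unfolding P_eq[symmetric] by (simp add: power2_eq_square mult_ac)
  also have "\<dots> \<le> \<alpha> k * (\<alpha> k * (L * (norm (d k))\<^sup>2))"
    using norm_d_ge_W[OF assms(1), of k] PWidth_nonneg \<alpha>_nonneg[of k] L
    by (intro mult_left_mono power_mono) auto
  also have "\<dots> \<le> \<alpha> k * h k" by (rule mult_left_mono[OF \<alpha>_mult_le \<alpha>_nonneg])
  finally have "P * (\<alpha> k)\<^sup>2 \<le> \<alpha> k * h k / (L * D\<^sup>2)" using L D_pos by (subst pos_le_divide_eq) auto
  then have "(\<omega> k)\<^sup>2 \<le> \<alpha> k * h k / (L * D\<^sup>2)" using assms(2) by linarith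
  then have "T * (\<omega> k)\<^sup>2 \<le> T * (\<alpha> k * h k / (L * D\<^sup>2))" by (rule mult_left_mono[OF _ T_nonneg])
  then show "(\<omega> (Suc k))\<^sup>2 \<le> (1 - T) * (\<omega> k)\<^sup>2" using \<omega>_decrease_half[of k] by (simp add: algebra_simps)
qed

lemma \<omega>_sum:
  assumes "i \<le> j"
  shows "(\<omega> j)\<^sup>2 + T * \<omega> j * (\<Sum>l\<in>{i..<j}. \<alpha> l) \<le> (\<omega> i)\<^sup>2"
proof -
  have "(\<omega> j')\<^sup>2 + T * \<omega> j * (\<Sum>l\<in>{i..<j'}. \<alpha> l) \<le> (\<omega> i)\<^sup>2" if "i \<le> j'" "j' \<le> j" for j'
    using that
  proof (induction j' rule: dec_induct)
    case (step j')
    have "T * \<omega> j * \<alpha> j' \<le> T * \<omega> j' * \<alpha> j'"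
      using \<omega>_mono[of j' j] step.prems \<alpha>_nonneg T_nonneg by (intro mult_right_mono mult_left_mono) auto
    then show ?case using step \<omega>_step[OF T_pos, of j'] by (simp add: distrib_left)
  qed simp
  then show ?thesis using assms by blast
qed

text \<open>Let the weight moved by a hop at \<open>k\<close> from \<open>q k\<close> to \<open>s
  k\<close> be moved on by the short step \<open>K\<close>. At \<open>k\<close> the atom \<open>s
  k\<close> is better than \<open>q k\<close>, even after the change of the gradient that the step
  itself causes. If \<open>q k\<close> is inactive at \<open>K\<close> and clearly below the best
  atom, then the slope quotient at \<open>K\<close> is improved. Otherwise \<open>q k\<close> has
  overtaken \<open>s k\<close>, so the gradient has changed considerably in between, which requires
  that the steps moved much weight. If \<open>q k\<close> is active again at \<open>K\<close>, it
  has been the best atom in between.\<close>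

lemma improvement_or_drift:
  assumes kK: "k < K" and nb: "\<not> bar k" and qK: "q K = s k" and P12: "2 * P \<le> 1"
  obtains "(1 + P / 4) * (\<omega> K)\<^sup>2 \<le> (h K / (L * D\<^sup>2))\<^sup>2"
  | y where "0 \<le> y" "y \<le> 1 / 2" "(1 + P * y\<^sup>2) * (\<omega> K)\<^sup>2 \<le> (h K / (L * D\<^sup>2))\<^sup>2"
      "(1 - y) * \<omega> K \<le> (\<Sum>l\<in>{Suc k..<K}. \<alpha> l)"
proof -
  let ?\<Sigma> = "\<Sum>l\<in>{Suc k..<K}. \<alpha> l"
  note outcome = that
  have LD: "L * D\<^sup>2 > 0" using L D_pos by simp
  have kK': "k \<le> K" using kK by simp
  have \<omega>h: "L * D\<^sup>2 * \<omega> K \<le> h K" by (rule h_ge[OF T_pos])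
  have Y1: "(1 + P * 0\<^sup>2) * (\<omega> K)\<^sup>2 \<le> (h K / (L * D\<^sup>2))\<^sup>2"
    using power_mono[OF \<omega>_le_h[OF T_pos] \<omega>_nonneg, of K 2] by simp
  have large: ?thesis if "h K \<le> L * D\<^sup>2 * ?\<Sigma>"
  proof (rule outcome(2)[of 0])
    have "L * D\<^sup>2 * \<omega> K \<le> L * D\<^sup>2 * ?\<Sigma>" using \<omega>h \<open>h K \<le> L * D\<^sup>2 * ?\<Sigma>\<close> by linarith
    then show "(1 - 0) * \<omega> K \<le> ?\<Sigma>" using mult_left_le_imp_le[OF _ LD] by simp
  qed (use Y1 in auto)
  have gap: "g K \<bullet> (q k - s k) \<le> L * D\<^sup>2 * ?\<Sigma>"
  proof -
    have "(g k - g K) \<bullet> d k \<le> L * (\<Sum>l\<in>{k..<K}. \<alpha> l * norm (d l)) * norm (d k)" by (rule grad_drift[OF kK'])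
    also have "(\<Sum>l\<in>{k..<K}. \<alpha> l * norm (d l)) = \<alpha> k * norm (d k) + (\<Sum>l\<in>{Suc k..<K}. \<alpha> l * norm (d l))"
      by (rule sum.atLeast_Suc_lessThan[OF kK])
    also have "L * (\<alpha> k * norm (d k) + (\<Sum>l\<in>{Suc k..<K}. \<alpha> l * norm (d l))) * norm (d k)
       = \<alpha> k * (L * (norm (d k))\<^sup>2) + L * (\<Sum>l\<in>{Suc k..<K}. \<alpha> l * norm (d l)) * norm (d k)"
      by (simp add: power2_eq_square algebra_simps)
    also have "L * (\<Sum>l\<in>{Suc k..<K}. \<alpha> l * norm (d l)) * norm (d k) \<le> L * (\<Sum>l\<in>{Suc k..<K}. \<alpha> l * D) * D"
      using L \<alpha>_nonneg norm_d_le_D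
      by (intro mult_mono mult_left_mono sum_mono mult_nonneg_nonneg sum_nonneg) (auto intro: less_imp_le[OF D_pos])
    also have "L * (\<Sum>l\<in>{Suc k..<K}. \<alpha> l * D) * D = L * D\<^sup>2 * ?\<Sigma>"
      by (simp add: sum_distrib_right[symmetric] power2_eq_square mult_ac)
    finally have "h k - g K \<bullet> d k \<le> \<alpha> k * (L * (norm (d k))\<^sup>2) + L * D\<^sup>2 * ?\<Sigma>" by (simp add: inner_diff_left)
    then show ?thesis using hop_\<alpha>_less[OF nb] by (simp add: d_eq inner_diff_right)
  qed
  show ?thesis
  proof (cases "q k \<in> S K")
    case True
    have "\<exists>j\<in>{Suc k..<K}. s j = q k"
    proof (rule ccontr)
      assume no: "\<not> ?thesis"
      have w0: "w j (q k) \<le> 0" if "Suc k \<le> j" "j \<le> K" for j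
        using that
      proof (induction j rule: dec_induct)
        case base
        show ?case using hop_weights(1)[OF nb] by simp
      next
        case (step j)
        then have "w (Suc j) (q k) \<le> w j (q k)" using no w_Suc[of j] \<alpha>_nonneg[of j] by auto
        then show ?case using step by simp
      qed
      have "w K (q k) \<le> 0" by (rule w0) (use kK in auto)
      then show False using True by (simp add: active_set_def)
    qed
    then obtain j where j: "Suc k \<le> j" "j < K" "s j = q k" by auto
    show ?thesis
    proof (rule large)
      have sum: "?\<Sigma> = (\<Sum>l\<in>{Suc k..<j}. \<alpha> l) + (\<Sum>l\<in>{j..<K}. \<alpha> l)"
        using j by (simp add: sum.atLeastLessThan_concat)
      have "g j \<bullet> (q k - s k) \<le> L * D\<^sup>2 * (\<Sum>l\<in>{Suc k..<j}. \<alpha> l)"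
      proof -
        have "(g (Suc k) - g j) \<bullet> (s k - q k) \<le> L * D\<^sup>2 * (\<Sum>l\<in>{Suc k..<j}. \<alpha> l)"
          by (rule grad_drift_atoms[OF j(1) s_in q_in])
        then show ?thesis using hop_order[OF nb] by (simp add: inner_diff_left inner_diff_right)
      qed
      moreover have "g j \<bullet> s K \<le> g j \<bullet> q k"
        using s_max[of "s K" j] hull_inc[of "s K" A convex, OF s_in] by (simp add: j(3))
      moreover have "(g j - g K) \<bullet> (s k - s K) \<le> L * D\<^sup>2 * (\<Sum>l\<in>{j..<K}. \<alpha> l)"
        using j by (intro grad_drift_atoms s_in) auto
      moreover have "h K = g K \<bullet> (s K - s k)" by (simp add: d_eq qK)
      ultimately show "h K \<le> L * D\<^sup>2 * ?\<Sigma>" unfolding sum distrib_left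
        by (simp add: inner_diff_left inner_diff_right)
    qed
  next
    case False
    define G where "G = g K \<bullet> (q k - s k) / h K"
    have hK: "h K > 0" by (rule descent_dir)
    have G: "g K \<bullet> (q k - q K) = G * h K" using hK by (simp add: G_def qK)
    have Gs: "G * h K \<le> L * D\<^sup>2 * ?\<Sigma>" using gap G qK by simp
    consider "G \<le> 1 / 2" | "1 / 2 < G" "G \<le> 1" | "1 < G" by linarith
    then show ?thesis
    proof cases
      case 1
      then have "g K \<bullet> (q k - q K) \<le> 1 / 2 * h K" unfolding G using hK by (intro mult_right_mono) auto
      then have "(1 + P * (1 - 1 / 2)\<^sup>2) * (\<omega> K)\<^sup>2 \<le> (h K / (L * D\<^sup>2))\<^sup>2"
        by (intro inactive_slope(2)[OF q_in False P12]) auto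
      then show ?thesis by (intro outcome(1)) (simp add: power_divide)
    next
      case 2
      have "(1 + P * (1 - G)\<^sup>2) * (\<omega> K)\<^sup>2 \<le> (h K / (L * D\<^sup>2))\<^sup>2"
        by (rule inactive_slope(2)[OF q_in False P12]) (use 2 G in auto)
      moreover have "G * \<omega> K \<le> ?\<Sigma>"
      proof -
        have "G * (L * D\<^sup>2 * \<omega> K) \<le> G * h K" using \<omega>h 2 by (intro mult_left_mono) auto
        then have "L * D\<^sup>2 * (G * \<omega> K) \<le> L * D\<^sup>2 * ?\<Sigma>" using Gs by (simp add: mult_ac)
        then show ?thesis by (rule mult_left_le_imp_le[OF _ LD])
      qed
      ultimately show ?thesis using 2 by (intro outcome(2)[of "1 - G"]) auto
    next
      case 3
      then have "1 * h K \<le> G * h K" using hK by (intro mult_right_mono) auto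
      then show ?thesis using Gs by (intro large) simp
    qed
  qed
qed

text \<open>For \<open>v = \<alpha> k / \<omega> k < 1\<close> the new gap is bounded both by
  \<open>v\<^sup>2 / 2\<close> and by \<open>1 - T * (2 * v - v\<^sup>2)\<close>. The ratio of the
  smaller one to \<open>\<sigma>\<^sup>2\<close> is largest for \<open>\<sigma> = 2 / 5\<close>,
  where the two bounds cross near \<open>v = 44 / 25 * \<sigma>\<close>.\<close>

lemma full_shortfall:
  assumes full: "full k" and T34: "T \<ge> 3 / 4" and P12: "2 * P \<le> 1" and \<sigma>25: "\<sigma> \<ge> 2 / 5"
  shows "r (Suc k) \<le> 31 / 20 * (1 - T) * r k"
proof (rule r_rate[OF _ T_pos])
  note \<sigma>' = \<sigma>[OF T34]
  have \<omega>0: "\<omega> k > 0" by (rule \<omega>_pos[OF T_pos])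
  consider "\<omega> k \<le> \<alpha> k" | "\<alpha> k \<le> 44 / 25 * \<sigma> * \<omega> k" | "44 / 25 * \<sigma> * \<omega> k < \<alpha> k" "\<alpha> k < \<omega> k" by linarith
  then show "(\<omega> (Suc k))\<^sup>2 \<le> 31 / 20 * (1 - T) * (\<omega> k)\<^sup>2"
  proof cases
    case 1
    have "1 * ((1 - T) * (\<omega> k)\<^sup>2) \<le> 31 / 20 * ((1 - T) * (\<omega> k)\<^sup>2)" using T_less_1 by (intro mult_right_mono) auto
    then show ?thesis using rate_of_large_step[OF T_pos 1] unfolding mult.assoc by linarith
  next
    case 2
    have "(\<omega> (Suc k))\<^sup>2 \<le> 1 / 2 * (\<alpha> k)\<^sup>2"
      using full_\<omega>[OF full] mult_right_mono[of P "1 / 2" "(\<alpha> k)\<^sup>2"] P12 by simp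
    also have "\<dots> \<le> 1 / 2 * (44 / 25 * \<sigma> * \<omega> k)\<^sup>2" using 2 \<alpha>_nonneg by (intro mult_left_mono power_mono) auto
    also have "\<dots> = 968 / 625 * (\<sigma>\<^sup>2 * (\<omega> k)\<^sup>2)" by (simp add: power_mult_distrib power_divide)
    also have "\<dots> \<le> 31 / 20 * (\<sigma>\<^sup>2 * (\<omega> k)\<^sup>2)" by (intro mult_right_mono) auto
    finally show ?thesis unfolding \<sigma>'(1) mult.assoc .
  next
    case 3
    define c where "c = 1 - 44 / 25 * \<sigma>"
    have c: "0 \<le> c" "c \<le> 37 / 125" using \<sigma>25 \<sigma>'(3) by (auto simp: c_def)
    have "(\<omega> k - \<alpha> k)\<^sup>2 \<le> (c * \<omega> k)\<^sup>2" using 3 by (intro power_mono) (auto simp: c_def algebra_simps)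
    then have "T * (\<omega> k - \<alpha> k)\<^sup>2 \<le> T * (c * \<omega> k)\<^sup>2" by (rule mult_left_mono[OF _ T_nonneg])
    also have "\<dots> = T * c\<^sup>2 * (\<omega> k)\<^sup>2" by (simp add: power_mult_distrib)
    also have "\<dots> \<le> 11 / 20 * \<sigma>\<^sup>2 * (\<omega> k)\<^sup>2"
    proof (rule mult_right_mono)
      have s2: "\<sigma>\<^sup>2 \<ge> 4 / 25" using power_mono[OF \<sigma>25, of 2] by (simp add: power_divide)
      then have "T \<le> 21 / 25" using \<sigma>'(1) by simp
      moreover have "c\<^sup>2 \<le> (37 / 125)\<^sup>2" using c by (intro power_mono) auto
      ultimately have "T * c\<^sup>2 \<le> 21 / 25 * (37 / 125)\<^sup>2" using T_nonneg by (intro mult_mono) auto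
      also have "\<dots> \<le> 11 / 20 * (4 / 25)" by (simp add: power2_eq_square)
      finally show "T * c\<^sup>2 \<le> 11 / 20 * \<sigma>\<^sup>2" using s2 by simp
    qed simp
    finally have "T * (\<omega> k - \<alpha> k)\<^sup>2 \<le> 11 / 20 * \<sigma>\<^sup>2 * (\<omega> k)\<^sup>2" .
    moreover have "(\<omega> (Suc k))\<^sup>2 \<le> (1 - T) * (\<omega> k)\<^sup>2 + T * (\<omega> k - \<alpha> k)\<^sup>2"
      using \<omega>_step_quadratic[OF T_pos, of k] by (simp add: power2_eq_square algebra_simps)
    ultimately show ?thesis using \<sigma>'(1) by (simp add: algebra_simps)
  qed
qed

text \<open>The second case of \<open>improvement_or_drift\<close> for a full hop at
  \<open>k\<close>: its weight is not good at \<open>K\<close>, which limits how much the gap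
  decreases up to \<open>K\<close>. So \<open>\<sigma>\<close> is large, the shortfall of full steps
  is at most \<open>31 / 20\<close> by \<open>full_shortfall\<close>, and the improvement at
  \<open>K\<close> together with the decrease up to \<open>K\<close> matches it.\<close>

lemma drift_pays:
  assumes T34: "T \<ge> 3 / 4" and P12: "2 * P \<le> 1" and y: "0 \<le> y" "y \<le> 1 / 2"
    and bar: "bar K" "(1 + P * y\<^sup>2) * (\<omega> K)\<^sup>2 \<le> (h K / (L * D\<^sup>2))\<^sup>2"
    and drift: "k < K" "(1 - y) * \<omega> K \<le> (\<Sum>l\<in>{Suc k..<K}. \<alpha> l)"
    and weight: "(\<omega> (Suc k))\<^sup>2 < P * \<beta>\<^sup>2 * (\<omega> K)\<^sup>2"
  shows "\<sigma> \<ge> 2 / 5" "31 / 20 * r (Suc K) \<le> (1 - T) * r (Suc k)"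
proof -
  note \<sigma>' = \<sigma>[OF T34] and \<beta>' = \<beta>[OF T34]
  have \<omega>0: "(\<omega> K)\<^sup>2 > 0" "\<omega> K > 0" using \<omega>_pos[OF T_pos, of K] by auto
  have "(1 + T * (1 - y)) * (\<omega> K)\<^sup>2 = (\<omega> K)\<^sup>2 + T * \<omega> K * ((1 - y) * \<omega> K)"
    by (simp add: power2_eq_square algebra_simps)
  also have "\<dots> \<le> (\<omega> K)\<^sup>2 + T * \<omega> K * (\<Sum>l\<in>{Suc k..<K}. \<alpha> l)"
    using drift(2) T_nonneg \<omega>0(2) by (intro add_left_mono mult_left_mono) auto
  also have "\<dots> \<le> (\<omega> (Suc k))\<^sup>2" by (rule \<omega>_sum) (use drift(1) in simp)
  finally have up: "(1 + T * (1 - y)) * (\<omega> K)\<^sup>2 \<le> (\<omega> (Suc k))\<^sup>2" .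
  then have "(1 + T * (1 - y)) * (\<omega> K)\<^sup>2 < P * \<beta>\<^sup>2 * (\<omega> K)\<^sup>2" using weight by linarith
  then have "1 + T * (1 - y) < P * \<beta>\<^sup>2" using \<omega>0(1) by (simp only: mult_less_cancel_right_pos)
  moreover have "T * (1 / 2) \<le> T * (1 - y)" using y T_nonneg by (intro mult_left_mono) auto
  ultimately have PT: "1 + T / 2 < P * \<beta>\<^sup>2" by simp
  have "(1 - \<sigma>)\<^sup>2 * (P * \<beta>\<^sup>2) = P * (\<beta> * (1 - \<sigma>))\<^sup>2" by (simp add: power_mult_distrib)
  also have "\<dots> = P" unfolding \<beta>'(1) by simp
  finally have "(1 - \<sigma>)\<^sup>2 * (P * \<beta>\<^sup>2) = P" .
  moreover have "(1 - \<sigma>)\<^sup>2 * (1 + T / 2) < (1 - \<sigma>)\<^sup>2 * (P * \<beta>\<^sup>2)" using PT \<sigma>'(3) by (intro mult_strict_left_mono) auto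
  ultimately have P\<sigma>: "(1 - \<sigma>)\<^sup>2 * (1 + T / 2) < P" by linarith
  show "\<sigma> \<ge> 2 / 5"
  proof (rule ccontr)
    assume no: "\<not> ?thesis"
    then have "\<sigma>\<^sup>2 \<le> (2 / 5)\<^sup>2" using \<sigma>'(2) by (intro power_mono) auto
    then have "T \<ge> 21 / 25" using \<sigma>'(1) by (simp add: power_divide)
    moreover have "(3 / 5)\<^sup>2 \<le> (1 - \<sigma>)\<^sup>2" using no by (intro power_mono) auto
    ultimately have "(3 / 5)\<^sup>2 * (1 + 21 / 50) \<le> (1 - \<sigma>)\<^sup>2 * (1 + T / 2)" by (intro mult_mono) auto
    then show False using P\<sigma> P12 by (simp add: power_divide)
  qed
  have "(1 / 2)\<^sup>2 \<le> (1 - \<sigma>)\<^sup>2" using \<sigma>'(3) by (intro power_mono) auto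
  then have "(1 / 2)\<^sup>2 * (1 + 3 / 8) \<le> (1 - \<sigma>)\<^sup>2 * (1 + T / 2)" using T34 by (intro mult_mono) auto
  then have PT4: "1 - T \<le> P" using P\<sigma> T34 by (simp add: power_divide)
  have "0 \<le> (y - 1 / 2)\<^sup>2" by simp
  then have "3 / 4 \<le> 1 - y + y\<^sup>2" by (simp add: power2_eq_square field_simps)
  then have "3 / 4 \<le> 1 - y + 31 / 20 * y\<^sup>2" using zero_le_power2[of y] by linarith
  then have "3 / 4 * (3 / 4) \<le> T * (1 - y + 31 / 20 * y\<^sup>2)" using T34 by (intro mult_mono) auto
  also have "\<dots> = T * (1 - y) + 31 / 20 * (T * y\<^sup>2)" by (simp add: field_simps)
  finally have num: "31 / 20 * (1 - T * y\<^sup>2) \<le> 1 + T * (1 - y)" unfolding right_diff_distrib by linarith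
  show "31 / 20 * r (Suc K) \<le> (1 - T) * r (Suc k)"
  proof -
    have "(\<omega> (Suc K))\<^sup>2 \<le> (\<omega> K)\<^sup>2 - T * ((1 + P * y\<^sup>2) * (\<omega> K)\<^sup>2)"
      using bar_\<omega>[OF bar(1)] mult_left_mono[OF bar(2) T_nonneg] by linarith
    also have "\<dots> = (1 - T - T * (P * y\<^sup>2)) * (\<omega> K)\<^sup>2" by (simp add: algebra_simps)
    also have "\<dots> \<le> (1 - T - T * ((1 - T) * y\<^sup>2)) * (\<omega> K)\<^sup>2"
      using PT4 T_nonneg by (intro mult_right_mono diff_left_mono mult_left_mono) auto
    also have "\<dots> = (1 - T) * ((1 - T * y\<^sup>2) * (\<omega> K)\<^sup>2)" by (simp add: algebra_simps)
    finally have "31 / 20 * (\<omega> (Suc K))\<^sup>2 \<le> 31 / 20 * ((1 - T) * ((1 - T * y\<^sup>2) * (\<omega> K)\<^sup>2))" by (intro mult_left_mono) auto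
    also have "\<dots> = (1 - T) * ((31 / 20 * (1 - T * y\<^sup>2)) * (\<omega> K)\<^sup>2)" by (simp only: mult_ac)
    also have "\<dots> \<le> (1 - T) * ((1 + T * (1 - y)) * (\<omega> K)\<^sup>2)"
      using num T_less_1 by (intro mult_left_mono mult_right_mono) auto
    also have "\<dots> \<le> (1 - T) * (\<omega> (Suc k))\<^sup>2" using up T_less_1 by (intro mult_left_mono) auto
    finally have "31 / 20 * (\<omega> (Suc K))\<^sup>2 \<le> (1 - T) * (\<omega> (Suc k))\<^sup>2" .
    then have "2 * T / (L * D\<^sup>2) * (31 / 20 * r (Suc K)) \<le> 2 * T / (L * D\<^sup>2) * ((1 - T) * r (Suc k))"
      by (simp add: \<omega>_sq mult_ac)
    moreover have "2 * T / (L * D\<^sup>2) > 0" using T_pos L D_pos by simp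
    ultimately show ?thesis by (rule mult_left_le_imp_le)
  qed
qed

text \<open>Consider the hops between two short steps. A full hop moves a weight that is large
  compared with \<open>\<omega>\<close>. As the next short step leaves at most one large weight
  outside the good atoms, namely on the atom that it takes weight from, and late hops do not merge
  weights, all full hops have moved the same weight \<open>m\<close>. All but the first one make
  good progress, since \<open>m\<close> is large compared with the gap that the first one leaves. If
  the weight is also moved by a hop that is not full, then this hop makes good progress too and pays
  for the first one. Otherwise the short step moves the weight on from where the last full hop has
  put it, and \<open>improvement_or_drift\<close> applies.\<close>

lemma rate_holds_tokens:
  assumes T34: "T \<ge> 3 / 4" and P12: "2 * P \<le> 1" and two: "card A \<ge> 2"
  shows "rate_holds"
proof -
  note \<beta>' = \<beta>[OF T34]
  obtain K0 G where G: "\<And>k. k \<ge> K0 \<Longrightarrow> Good k = G"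
    and s_new: "\<And>k. k \<ge> K0 \<Longrightarrow> \<not> bar k \<Longrightarrow> s k \<notin> G \<and> w k (s k) = 0"
    using late_hops[OF T34] by metis
  show ?thesis
  proof (rule rate_holds_blocks[of K0])
    fix b K
    assume b: "K0 \<le> b" "b \<le> K" and bK: "bar K" and nb: "\<And>k. b \<le> k \<Longrightarrow> k < K \<Longrightarrow> \<not> bar k"
    define F where "F = {k\<in>{b..<K}. full k}"
    have finF: "finite F" by (simp add: F_def)
    have Fb: "b \<le> k" "k < K" "full k" "\<not> bar k" if "k \<in> F" for k using that nb by (auto simp: F_def)
    have q1: "0 \<le> 1 - T" using T_less_1 by simp
    have \<omega>K: "\<omega> K > 0" by (rule \<omega>_pos[OF T_pos])
    define heavy where "heavy i a \<longleftrightarrow> a \<in> A \<and> a \<notin> G \<and> \<omega> K < w i a" for i a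
    have heavy_K: "a = q K" if "heavy K a" for a
    proof (rule ccontr)
      assume "a \<noteq> q K"
      then have "w K a < \<beta> * \<sigma> * \<omega> K"
        using bar_bystander[OF T34 bK, of a] that G[of "Suc K"] b by (auto simp: heavy_def)
      also have "\<dots> \<le> 1 * \<omega> K" using \<beta>'(5) \<omega>K by (intro mult_right_mono) auto
      finally show False using that by (simp add: heavy_def)
    qed
    \<comment> \<open>Where a weight at the atom \<open>a\<close> is after the hop
      \<open>i\<close>.\<close>
    define carry where "carry i a = (if a = q i then s i else a)" for i a
    have heavy_Suc: "heavy (Suc i) (carry i a) \<and> w (Suc i) (carry i a) = w i a \<and> a \<noteq> s i"
      if i: "b \<le> i" "i < K" and h: "heavy i a" for i a
    proof -
      have ni: "\<not> bar i" and i0: "i \<ge> K0" using nb i b by auto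
      have as: "a \<noteq> s i" using s_new[OF i0 ni] h \<omega>K by (auto simp: heavy_def)
      have "w (Suc i) (carry i a) = w i a"
        using hop_weights(2,4)[OF ni] s_new[OF i0 ni] hop[OF ni] as by (simp add: carry_def)
      then show ?thesis using h as s_new[OF i0 ni] s_in by (auto simp: heavy_def carry_def)
    qed
    define m where "m = w K (q K)"
    have token: "(\<forall>a. heavy i a \<longrightarrow> w i a = m) \<and> (\<forall>a a'. heavy i a \<longrightarrow> heavy i a' \<longrightarrow> a = a')"
      if "i \<le> K" "b \<le> i" for i
      using that
    proof (induction i rule: inc_induct)
      case base
      then show ?case using heavy_K by (auto simp: m_def)
    next
      case (step i)
      have i: "b \<le> i" "i < K" using step by auto
      have IH: "\<And>a. heavy (Suc i) a \<Longrightarrow> w (Suc i) a = m" "\<And>a a'. heavy (Suc i) a \<Longrightarrow> heavy (Suc i) a' \<Longrightarrow> a = a'"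
        using step by auto
      have inj: "a = a'" if "carry i a = carry i a'" "heavy i a" "heavy i a'" for a a'
        using that heavy_Suc[OF i that(2)] heavy_Suc[OF i that(3)] by (auto simp: carry_def split: if_splits)
      show ?case using heavy_Suc[OF i] IH inj by metis
    qed
    have full_weight: "(\<omega> (Suc k))\<^sup>2 \<le> P * m\<^sup>2" "\<alpha> k = m" "heavy (Suc k) (s k)" if k: "k \<in> F" for k
    proof -
      have \<omega>P: "(\<omega> (Suc k))\<^sup>2 \<le> P * (\<alpha> k)\<^sup>2" by (rule full_\<omega>[OF Fb(3)[OF k]])
      have "\<omega> K \<le> \<omega> (Suc k)" using Fb(2)[OF k] by (intro \<omega>_mono) simp
      then have "(\<omega> K)\<^sup>2 \<le> (\<omega> (Suc k))\<^sup>2" using \<omega>K by (intro power_mono) auto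
      then have "(\<omega> K)\<^sup>2 \<le> P * (\<alpha> k)\<^sup>2" using \<omega>P by simp
      also have "\<dots> \<le> 1 / 2 * (\<alpha> k)\<^sup>2" using P12 by (intro mult_right_mono) auto
      also have "\<dots> < (\<alpha> k)\<^sup>2" using \<alpha>_pos[of k] by simp
      finally have \<omega>\<alpha>: "\<omega> K < \<alpha> k" by (rule power2_less_imp_less) (rule \<alpha>_nonneg)
      have k0: "k \<ge> K0" using Fb(1)[OF k] b by simp
      have "heavy k (q k)" unfolding heavy_def
        using \<omega>\<alpha> hop[OF Fb(4)[OF k]] hop_not_good[OF T34 Fb(4)[OF k]] G[OF k0] q_in by simp
      then show "\<alpha> k = m" "heavy (Suc k) (s k)"
        using token[of k] heavy_Suc[of k "q k"] Fb[OF k] hop[OF Fb(4)[OF k]] by (auto simp: carry_def)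
      then show "(\<omega> (Suc k))\<^sup>2 \<le> P * m\<^sup>2" using \<omega>P by simp
    qed
    have bar_K: "r (Suc K) \<le> (1 - T) * r K" by (rule bar_rate[OF bK])
    show "r (Suc K) \<le> (1 - T) ^ Suc (card {k\<in>{b..<K}. full k}) * r b"
    proof (cases "F = {}")
      case True
      then have none: "{k\<in>{b..<K}. full k} = {}" by (simp only: F_def)
      have "(1 - T) * r K \<le> (1 - T) * r b" using q1 by (intro mult_left_mono r_mono b(2)) auto
      then show ?thesis unfolding none using bar_K by simp
    next
      case False
      define k1 km where "k1 = Min F" and "km = Max F"
      have k1: "k1 \<in> F" "\<And>k. k \<in> F \<Longrightarrow> k1 \<le> k" and km: "km \<in> F" "\<And>k. k \<in> F \<Longrightarrow> k \<le> km"
        using finF False by (auto simp: k1_def km_def)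
      define n where "n = card (F - {k1})"
      have cardF: "card {k\<in>{b..<K}. full k} = Suc n"
        unfolding F_def[symmetric] n_def using card.remove[OF finF k1(1)] .
      have r_b: "r k1 \<le> r b" using Fb(1)[OF k1(1)] by (rule r_mono)
      define Q where "Q j \<longleftrightarrow> \<alpha> j = m" for j
      have Q_rate: "r (Suc j) \<le> (1 - T) * r j" if "Suc k1 \<le> j" "Q j" for j
      proof (rule heavy_step[OF two])
        have "(\<omega> j)\<^sup>2 \<le> (\<omega> (Suc k1))\<^sup>2" using that(1) \<omega>_nonneg by (intro power_mono \<omega>_mono) auto
        then show "(\<omega> j)\<^sup>2 \<le> P * (\<alpha> j)\<^sup>2" using full_weight(1)[OF k1(1)] that(2) by (simp add: Q_def)
      qed
      have Q_block: "r j \<le> (1 - T) ^ card {i\<in>{Suc k1..<j}. Q i} * r (Suc k1)" if "Suc k1 \<le> j" for j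
        by (rule block_rate[OF that]) (use Q_rate in auto)
      have F_Q: "F - {k1} \<subseteq> {i\<in>{Suc k1..<j}. Q i}" if "km < j" for j
        using k1(2) km(2) full_weight(2) that by (fastforce simp: Q_def less_Suc_eq_le Suc_le_eq)
      have k1K: "Suc k1 \<le> K" using Fb(2)[OF k1(1)] by simp
      have k1m: "k1 \<le> km" by (rule k1(2)[OF km(1)])
      have F_block: "r j \<le> (1 - T) ^ n * r (Suc k1)" if "km < j" for j
      proof -
        have "n \<le> card {i\<in>{Suc k1..<j}. Q i}" unfolding n_def by (intro card_mono F_Q that) auto
        then have "(1 - T) ^ card {i\<in>{Suc k1..<j}. Q i} \<le> (1 - T) ^ n" using q1 T_nonneg by (intro power_decreasing) auto
        then have "(1 - T) ^ card {i\<in>{Suc k1..<j}. Q i} * r (Suc k1) \<le> (1 - T) ^ n * r (Suc k1)"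
          by (rule mult_right_mono[OF _ r_nonneg])
        then show ?thesis using Q_block[of j] that k1m by simp
      qed
      have "r (Suc K) \<le> (1 - T) ^ Suc (Suc n) * r k1"
      proof (cases "\<exists>j\<in>{Suc km..<K}. Q j")
        case True
        then obtain j where j: "km < j" "j < K" "Q j" by (metis Suc_le_eq atLeastLessThan_iff)
        have "insert j (F - {k1}) \<subseteq> {i\<in>{Suc k1..<K}. Q i}" using F_Q[of K] j k1m by auto
        then have "card (insert j (F - {k1})) \<le> card {i\<in>{Suc k1..<K}. Q i}" by (intro card_mono) auto
        moreover have "j \<notin> F" using km(2)[of j] j(1) by auto
        ultimately have "Suc n \<le> card {i\<in>{Suc k1..<K}. Q i}" using finF by (simp add: n_def)
        then have "(1 - T) ^ card {i\<in>{Suc k1..<K}. Q i} \<le> (1 - T) ^ Suc n" using q1 T_nonneg by (intro power_decreasing) auto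
        then have "(1 - T) ^ card {i\<in>{Suc k1..<K}. Q i} * r (Suc k1) \<le> (1 - T) ^ Suc n * r k1"
          using r_Suc[of k1] q1 r_nonneg by (intro mult_mono) auto
        then have "r K \<le> (1 - T) ^ Suc n * r k1" using Q_block[OF k1K] by linarith
        then have "(1 - T) * r K \<le> (1 - T) * ((1 - T) ^ Suc n * r k1)" by (rule mult_left_mono[OF _ q1])
        then show ?thesis using bar_K by (simp add: mult_ac)
      next
        case noQ: False
        have stay: "heavy j (s km) \<and> w j (s km) = m" if "Suc km \<le> j" "j \<le> K" for j
          using that
        proof (induction j rule: dec_induct)
          case base
          show ?case using full_weight(3)[OF km(1)] token[of "Suc km"] Fb[OF km(1)] by auto
        next
          case (step j)
          have j: "b \<le> j" "j < K" using step Fb(1)[OF km(1)] by auto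
          have "s km \<noteq> q j"
          proof
            assume "s km = q j"
            then have "\<alpha> j = m" using step hop[OF nb[OF j]] by auto
            then show False using noQ step by (auto simp: Q_def)
          qed
          then show ?case using heavy_Suc[OF j, of "s km"] step by (auto simp: carry_def)
        qed
        have kmK: "km < K" by (rule Fb(2)[OF km(1)])
        have qK: "q K = s km" using heavy_K[of "s km"] stay[of K] kmK by auto
        have sG: "s km \<notin> G" "w K (s km) = m" using stay[of K] kmK by (auto simp: heavy_def)
        have "Good K = G" using G b by simp
        then have m\<omega>: "m < \<beta> * \<omega> K" using sG s_in[of km] by (auto simp: Good_def)
        have "0 \<le> m" using sG(2) w_nonneg[OF s_in, of K km] by simp
        then have "m\<^sup>2 < (\<beta> * \<omega> K)\<^sup>2" using m\<omega> by (intro power_strict_mono) auto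
        then have "P * m\<^sup>2 < P * (\<beta> * \<omega> K)\<^sup>2" using P_pos[OF T_pos] by (intro mult_strict_left_mono) auto
        then have weight: "(\<omega> (Suc km))\<^sup>2 < P * \<beta>\<^sup>2 * (\<omega> K)\<^sup>2"
          using full_weight(1)[OF km(1)] by (simp add: power_mult_distrib)
        show ?thesis
        proof (rule improvement_or_drift[OF kmK Fb(4)[OF km(1)] qK P12])
          assume "(1 + P / 4) * (\<omega> K)\<^sup>2 \<le> (h K / (L * D\<^sup>2))\<^sup>2"
          then have "r (Suc K) \<le> (1 + \<mu> / L) * (1 - T)\<^sup>2 * r K" by (rule bar_pays_full[OF bK _ T_pos])
          also have "\<dots> \<le> (1 + \<mu> / L) * (1 - T)\<^sup>2 * ((1 - T) ^ n * r (Suc k1))"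
            using F_block[OF kmK] \<mu> L by (intro mult_left_mono) auto
          also have "\<dots> = (1 - T) ^ Suc (Suc n) * ((1 + \<mu> / L) * r (Suc k1))"
            by (simp only: power2_eq_square power_Suc mult_ac)
          also have "\<dots> \<le> (1 - T) ^ Suc (Suc n) * r k1"
            by (rule mult_left_mono[OF full_r[OF Fb(3)[OF k1(1)]]]) (rule zero_le_power[OF q1])
          finally show ?thesis .
        next
          fix y :: real
          assume y: "0 \<le> y" "y \<le> 1 / 2" "(1 + P * y\<^sup>2) * (\<omega> K)\<^sup>2 \<le> (h K / (L * D\<^sup>2))\<^sup>2"
            "(1 - y) * \<omega> K \<le> (\<Sum>l\<in>{Suc km..<K}. \<alpha> l)"
          note pays = drift_pays[OF T34 P12 y(1,2) bK y(3) kmK y(4) weight]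
          have "31 / 20 * r (Suc K) \<le> (1 - T) * r (Suc km)" by (rule pays(2))
          also have "\<dots> \<le> (1 - T) * ((1 - T) ^ n * r (Suc k1))"
            using F_block[of "Suc km"] q1 by (intro mult_left_mono) auto
          also have "\<dots> \<le> (1 - T) * ((1 - T) ^ n * (31 / 20 * (1 - T) * r k1))"
            using full_shortfall[OF Fb(3)[OF k1(1)] T34 P12 pays(1)] q1 by (intro mult_left_mono) auto
          also have "\<dots> = 31 / 20 * ((1 - T) ^ Suc (Suc n) * r k1)" by (simp only: power_Suc mult_ac)
          finally show ?thesis by simp
        qed
      qed
      also have "\<dots> \<le> (1 - T) ^ Suc (Suc n) * r b" by (rule mult_left_mono[OF r_b]) (rule zero_le_power[OF q1])
      finally show ?thesis unfolding cardF .
    qed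
  qed
qed

end

context pairwise_KL
begin

lemma pairwise_rate: "rate_holds"
proof (cases "T + P \<le> 1")
  case True
  then show ?thesis by (rule rate_holds_small)
next
  case TP: False
  show ?thesis
  proof (cases "T = 0 \<or> P \<le> 1 / 4")
    case True
    moreover have ?thesis if "T = 0" using that r_Suc by (intro rate_holdsI[of 0]) simp
    moreover have ?thesis if "P \<le> 1 / 4" using that TP by (intro rate_holds_narrow) auto
    ultimately show ?thesis by blast
  next
    case False
    then have P4: "\<not> P \<le> 1 / 4" and T: "T > 0" using T_nonneg by auto
    have "D < 2 * W"
    proof (rule ccontr)
      assume "\<not> ?thesis"
      then have "W / D \<le> 1 / 2" using D_pos by (simp add: field_simps)
      then have "P \<le> (1 / 2)\<^sup>2" unfolding P_def using PWidth_nonneg D_pos by (intro power_mono) auto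
      then show False using P4 by (simp add: power_divide)
    qed
    then have indep: "\<not> affine_dependent A"
      using affine_dependent_PWidth[OF fin _ norm_le_D] by force
    interpret simplex_KL A f f' L x d \<alpha> w s q \<mu> by unfold_locales (use indep T in auto)
    show ?thesis
    proof (cases "card A \<le> 3")
      case True
      then show ?thesis by (rule rate_holds_triangle)
    next
      case False
      have "2 * W\<^sup>2 \<le> D\<^sup>2"
        using False by (intro simplex_width_four[OF fin indep _ _ PWidth_nonneg] norm_le_D) (auto intro: hull_inc)
      then have "2 * P \<le> 1" using D_pos by (simp add: P_def power_divide)
      then show ?thesis
        using rate_holds_tokens rate_holds_altitude P4 False by (cases "T \<ge> 3 / 4") auto
    qed
  qed
qed

end

section \<open>The rates of the three methods\<close>

lemma count_before_shift: "count_before G (k + K) = count_before G K + count_before (\<lambda>i. G (i + K)) k"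
  by (induction k) (simp_all add: count_before_Suc)

context smooth_on_polytope
begin

text \<open>The KL inequality holds along a late segment of the run only, so the analysis above is
  applied to the run without its first steps.\<close>

lemma pfw_rate:
  assumes run: "infinite_run PFW A f' L x d \<alpha>" and \<mu>: "\<mu> > 0"
    and KL: "\<And>z. z \<in> \<Omega> \<Longrightarrow> f z = lim (\<lambda>k. f (x k)) \<Longrightarrow> stationary \<Omega> f' z \<Longrightarrow> KL_at \<Omega> f f' \<mu> z"
  shows "\<exists>M>0. \<forall>k. f (x k) - lim (\<lambda>k. f (x k)) \<le> M * q_gs PFW A L \<mu> ^ good_steps \<Omega> f' L x d \<alpha> k"
proof -
  obtain w where w0: "active_rep A (w 0) (x 0)"
    and st: "\<And>k. pfw_step A L (- f' (x k)) (w k) (d k) (\<alpha> k) (w (Suc k))"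
    using run by (auto simp: infinite_run_def)
  have xs: "x (Suc k) = x k + \<alpha> k *\<^sub>R d k" and ns: "\<not> stationary \<Omega> f' (x k)" for k
    using run by (auto simp: infinite_run_def)
  have asc: "\<exists>y\<in>\<Omega>. - f' (x k) \<bullet> (y - x k) > 0" if "active_rep A (w k) (x k)" for k
    using nonstationary_direction[OF active_rep_in_hull[OF fin that] ns] by blast
  have rep: "active_rep A (w k) (x k)" for k
  proof (induction k)
    case (Suc k)
    show ?case unfolding xs by (rule pfw_step_properties[OF fin Suc L asc[OF Suc] st])
  qed (rule w0)
  define R where "R k s q \<longleftrightarrow> s \<in> A \<and> (\<forall>y\<in>\<Omega>. - f' (x k) \<bullet> y \<le> - f' (x k) \<bullet> s) \<and> q \<in> active_set A (w k) \<and>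
    (\<forall>a\<in>active_set A (w k). - f' (x k) \<bullet> q \<le> - f' (x k) \<bullet> a) \<and> d k = s - q \<and> - f' (x k) \<bullet> d k > 0 \<and> 0 < \<alpha> k \<and>
    \<alpha> k = min (short_step L (- f' (x k)) (d k)) (w k q) \<and>
    w (Suc k) = (\<lambda>a. w k a + (if a = s then \<alpha> k else 0) - (if a = q then \<alpha> k else 0))" for k s q
  have "\<exists>s q. R k s q" for k
    by (rule pfw_step_properties[OF fin rep L asc[OF rep] st, of k]) (unfold R_def, blast)
  then obtain s q where sq: "\<And>k. R k (s k) (q k)" by metis
  have P: "s k \<in> A" "y \<in> \<Omega> \<Longrightarrow> - f' (x k) \<bullet> y \<le> - f' (x k) \<bullet> s k" "q k \<in> active_set A (w k)"
    "a \<in> active_set A (w k) \<Longrightarrow> - f' (x k) \<bullet> q k \<le> - f' (x k) \<bullet> a" "d k = s k - q k"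
    "- f' (x k) \<bullet> d k > 0" "0 < \<alpha> k" "\<alpha> k = min (short_step L (- f' (x k)) (d k)) (w k (q k))"
    "w (Suc k) = (\<lambda>a. w k a + (if a = s k then \<alpha> k else 0) - (if a = q k then \<alpha> k else 0))" for k y a
    using sq[of k] unfolding R_def by blast+
  have le: "0 \<le> \<alpha> k" "\<alpha> k \<le> short_step L (- f' (x k)) (d k)" for k
    using less_imp_le[OF P(7)] by (simp, subst P(8), simp)
  interpret pairwise_run A f f' L x d \<alpha> w s q
    by unfold_locales (rule active_rep_in_hull[OF fin rep] xs P le rep | assumption)+
  have fs: "fstar = lim (\<lambda>k. f (x k))" by (simp only: fstar_def)
  obtain K where K: "\<And>k. k \<ge> K \<Longrightarrow> 2 * \<mu> * r k \<le> (slope (x k))\<^sup>2"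
    using KL_late[OF _ \<mu>] KL unfolding fs by blast
  interpret late: pairwise_run A f f' L "\<lambda>k. x (k + K)" "\<lambda>k. d (k + K)" "\<lambda>k. \<alpha> (k + K)" "\<lambda>k. w (k + K)" "\<lambda>k. s (k + K)" "\<lambda>k. q (k + K)"
    by unfold_locales (use x_in x_Suc descent_dir \<alpha>_nonneg \<alpha>_le rep s_in s_max q_active q_min d_eq \<alpha>_pos \<alpha>_eq w_Suc in auto)
  have "late.fstar = fstar" unfolding late.fstar_def
    by (rule limI) (rule LIMSEQ_ignore_initial_segment[OF tendsto_fstar])
  then have r_late: "late.r k = r (k + K)" for k by (simp add: late.r_def r_def)
  interpret late: pairwise_KL A f f' L "\<lambda>k. x (k + K)" "\<lambda>k. d (k + K)" "\<lambda>k. \<alpha> (k + K)" "\<lambda>k. w (k + K)" "\<lambda>k. s (k + K)" "\<lambda>k. q (k + K)" \<mu>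
    by unfold_locales (use \<mu> K r_late in auto)
  have q_eq: "1 - late.T = q_gs PFW A L \<mu>" by (simp add: late.T_def late.P_def)
  have good: "late.bar k \<or> late.full k \<longleftrightarrow> good_step \<Omega> f' L x d \<alpha> (k + K)" for k
    using x_in[of "Suc (k + K)"] by (auto simp: late.bar_def late.full_def good_step_def is_arg_min_linorder)
  obtain M where M: "M > 0" "\<And>k. late.r k \<le> M * (1 - late.T) ^ count_before (\<lambda>k. late.bar k \<or> late.full k) k"
    using late.pairwise_rate by (auto simp: late.rate_holds_def)
  have "\<exists>M>0. \<forall>k. r k \<le> M * q_gs PFW A L \<mu> ^ count_before (good_step \<Omega> f' L x d \<alpha>) k"
  proof (rule rate_from_late_rate[where r = r and C = M and K = K])
    fix k assume "K \<le> k"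
    then have k: "(k - K) + K = k" by simp
    have "count_before (good_step \<Omega> f' L x d \<alpha>) k - count_before (good_step \<Omega> f' L x d \<alpha>) K
        = count_before (\<lambda>k. late.bar k \<or> late.full k) (k - K)"
      using count_before_shift[of "good_step \<Omega> f' L x d \<alpha>" "k - K" K] unfolding good k by simp
    then show "r k \<le> M * q_gs PFW A L \<mu> ^ (count_before (good_step \<Omega> f' L x d \<alpha>) k - count_before (good_step \<Omega> f' L x d \<alpha>) K)"
      using M(2)[of "k - K"] k r_late[of "k - K"] q_eq by simp
  qed (use r_nonneg r_Suc M(1) late.T_less_1 late.T_nonneg q_eq in auto)
  then show ?thesis unfolding good_steps_eq_count r_def fs .
qed

end

theorem corollary3p1:
  fixes A \<Omega> U :: "'a::euclidean_space set"
    and f :: "'a \<Rightarrow> real" and f' :: "'a \<Rightarrow> 'a"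
    and L \<mu> fstar :: real
    and m :: fw_variant
    and x d :: "nat \<Rightarrow> 'a" and \<alpha> :: "nat \<Rightarrow> real"
  assumes "finite A"
    and "\<Omega> = convex hull A"
    and "\<exists>y\<in>\<Omega>. \<exists>z\<in>\<Omega>. y \<noteq> z"
    and "open U" and "\<Omega> \<subseteq> U"
    and "\<And>y. y \<in> U \<Longrightarrow> GDERIV f y :> f' y"
    and "continuous_on U f'"
    and "L > 0"
    and "\<And>y z. y \<in> \<Omega> \<Longrightarrow> z \<in> \<Omega> \<Longrightarrow> norm (f' y - f' z) \<le> L * norm (y - z)"
    and "infinite_run m A f' L x d \<alpha>"
    and "fstar = lim (\<lambda>k. f (x k))"
    and "\<mu> > 0"
    and "\<And>z. z \<in> \<Omega> \<Longrightarrow> f z = fstar \<Longrightarrow> stationary \<Omega> f' z \<Longrightarrow> KL_at \<Omega> f f' \<mu> z"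
  shows "\<exists>M>0. \<forall>k. f (x k) - fstar \<le> M * q_gs m A L \<mu> ^ good_steps \<Omega> f' L x d \<alpha> k"
proof -
  interpret smooth_on_polytope A f f' L
    by unfold_locales (use assms(1-3,5,6,8,9) in auto)
  have KL: "z \<in> convex hull A \<Longrightarrow> f z = lim (\<lambda>k. f (x k)) \<Longrightarrow> stationary (convex hull A) f' z
      \<Longrightarrow> KL_at (convex hull A) f f' \<mu> z" for z
    using assms(13) unfolding assms(2,11) .
  show ?thesis
    unfolding assms(2,11)
    using afw_rate[OF _ assms(12) KL] pfw_rate[OF _ assms(12) KL] fdfw_rate[OF _ assms(12) KL] assms(10)
    by (cases m) auto
qed

end
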